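(* Let $(M^4,g)$ be an oriented 4-dimensional pseudo-Riemannian manifold with metric $g$ of neutral signature $(2,2)$, and let $\mathcal P$ be the para-quaternionic structure corresponding to the (oriented) conformal class generated by $g$, with admissible local basis $J_1,J_2,J_3$. Then the following conditions are equivalent: i) the neutral metric $g$ is anti-self-dual; ii) the Ricci forms $\rho^g_a$ of the Levi-Civita connection $\nabla^g$ satisfy, for every cyclic permutation $(a,b,c)$ of $(1,2,3)$ and all $X,Y$, $$\rho^g_a(J_bX,J_bY)+\epsilon_b\,\rho^g_a(X,Y)+\epsilon_a\,\rho^g_c(J_bX,Y)+\epsilon_a\,\rho^g_c(X,J_bY)=0;$$ iii) for every para-quaternionic connection $\nabla\in\Delta(\mathcal P)$, if the torsion satisfies $(T^\nabla)^{0,2}_J=0$ for all $J\in\mathcal P$ with $J^2=\pm\mathrm{id}$, then the Ricci forms $\rho^\nabla_a$ of $\nabla$ satisfy, for every cyclic permutation $(a,b,c)$ of $(1,2,3)$ and all $X,Y$, $$\rho^\nabla_a(J_bX,J_bY)+\epsilon_b\,\rho^\nabla_a(X,Y)+\epsilon_a\,\rho^\nabla_c(J_bX,Y)+\epsilon_a\,\rho^\nabla_c(X,J_bY)=0.$$ Here $\epsilon_1=\epsilon_2=-\epsilon_3=1$.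
   Context: An almost para-quaternionic structure on a smooth manifold $M$ of dimension $4n$ is a rank-3 subbundle $\mathcal P\subset \mathrm{End}(TM)$ locally spanned by a triple $(J_1,J_2,J_3)$ with $J_1^2=J_2^2=-J_3^2=\mathrm{id}$, $J_1J_2=-J_2J_1=J_3$; such a triple is called an admissible local basis. A para-quaternionic connection is a linear connection $\nabla$ on $TM$ preserving $\mathcal P$ (torsion is allowed); $\Delta(\mathcal P)$ is the set of all of them. In dimension 4 an almost para-quaternionic structure is the same as an oriented neutral conformal structure: for an oriented neutral $(M^4,g)$, $\mathcal P$ is the bundle of $g$-skew-symmetric endomorphisms $A$ whose associated 2-forms $g(A\cdot,\cdot)$ are self-dual. The Levi-Civita connection $\nabla^g$ lies in $\Delta(\mathcal P)$. The metric $g$ is anti-self-dual if the self-dual part $W^+$ of its Weyl tensor (the part acting on the bundle $\Lambda^+\cong\mathcal P$ of self-dual 2-forms) vanishes. For $\nabla\in\Delta(\mathcal P)$ with curvature $R^\nabla$ the Ricci 2-forms with respect to an admissible local basis are $$\rho^\nabla_a(X,Y)=\tfrac12\mathrm{Tr}\big(Z\mapsto J_aR^\nabla(X,Y)Z\big)\ (a=1,2),\qquad \rho^\nabla_3(X,Y)=-\tfrac12\mathrm{Tr}\big(Z\mapsto J_3R^\nabla(X,Y)Z\big),$$ and $\rho^g_a:=\rho^{\nabla^g}_a$. For the torsion $T=T^\nabla$ and $J\in\mathcal P_p$ with $J^2=\epsilon\,\mathrm{id}$, $\epsilon=\pm1$, the $(0,2)_J$-part is $$T^{0,2}_J(X,Y)=\tfrac14\big(\epsilon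 T(X,Y)+T(JX,JY)-JT(JX,Y)-JT(X,JY)\big).$$ *)

theory Defs
  imports "HOL-Analysis.Analysis"
begin

text \<open>
  The manifold is a Hausdorff, second countable type \<open>'m\<close> with an oriented smooth atlas.
  Geometric objects are given in the classical way, by their components in every chart
  of the atlas together with the transformation law between overlapping charts.
  Tangent vectors at a point \<open>p\<close> are written in the coordinates of a chart around \<open>p\<close>;
  an endomorphism \<open>A\<close> has the matrix with \<open>A *v X\<close> as its value on \<open>X\<close>,
  a bilinear form \<open>b\<close> the matrix \<open>B\<close> with \<open>b X Y = X \<bullet> (B *v Y)\<close>.
  A chart is a pair of its domain and its coordinate map.
\<close>

section \<open>Oriented smooth 4-manifolds\<close>

type_synonym 'm chart = "'m set \<times> ('m \<Rightarrow> real ^ 4)"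

abbreviation chart_dom :: "'m chart \<Rightarrow> 'm set" where
  "chart_dom c \<equiv> fst c"

abbreviation coords :: "'m chart \<Rightarrow> 'm \<Rightarrow> real ^ 4" where
  "coords c \<equiv> snd c"

abbreviation chart_inv :: "'m chart \<Rightarrow> real ^ 4 \<Rightarrow> 'm" where
  "chart_inv c \<equiv> inv_into (chart_dom c) (coords c)"

primrec times_differentiable_on ::
    "nat \<Rightarrow> 'a::real_normed_vector set \<Rightarrow> ('a \<Rightarrow> 'b::real_normed_vector) \<Rightarrow> bool" where
  "times_differentiable_on 0 S f \<longleftrightarrow> continuous_on S f"
| "times_differentiable_on (Suc k) S f \<longleftrightarrow>
     (\<forall>x\<in>S. f differentiable (at x)) \<and>
     (\<forall>v. times_differentiable_on k S (\<lambda>x. frechet_derivative f (at x) v))"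

text \<open>Only used for open \<open>S\<close>.\<close>
definition smooth_on ::
    "'a::real_normed_vector set \<Rightarrow> ('a \<Rightarrow> 'b::real_normed_vector) \<Rightarrow> bool" where
  "smooth_on S f \<longleftrightarrow> (\<forall>k. times_differentiable_on k S f)"

definition smooth_in_chart ::
    "'m chart \<Rightarrow> 'm set \<Rightarrow> ('m \<Rightarrow> 'b::real_normed_vector) \<Rightarrow> bool" where
  "smooth_in_chart c U f \<longleftrightarrow> smooth_on (coords c ` (U \<inter> chart_dom c)) (f \<circ> chart_inv c)"

text \<open>The derivative at \<open>p\<close> of a (vector valued) function on the domain of \<open>c\<close> in the direction
  of the vector with coordinates \<open>X\<close>.\<close>
definition chart_deriv ::
    "'m chart \<Rightarrow> real ^ 4 \<Rightarrow> ('m \<Rightarrow> 'b::real_normed_vector) \<Rightarrow> 'm \<Rightarrow> 'b" where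
  "chart_deriv c X f p = frechet_derivative (f \<circ> chart_inv c) (at (coords c p)) X"

text \<open>The Jacobian matrix at \<open>p\<close> of the transition map from \<open>c\<close> to \<open>d\<close>: it takes the
  \<open>c\<close>-coordinates of a tangent vector at \<open>p\<close> to its \<open>d\<close>-coordinates.\<close>
definition jacobian :: "'m chart \<Rightarrow> 'm chart \<Rightarrow> 'm \<Rightarrow> real ^ 4 ^ 4" where
  "jacobian c d p = matrix (\<lambda>X. chart_deriv c X (coords d) p)"

definition is_chart :: "'m::topological_space chart \<Rightarrow> bool" where
  "is_chart c \<longleftrightarrow> open (chart_dom c) \<and> open (coords c ` chart_dom c) \<and>
     homeomorphism (chart_dom c) (coords c ` chart_dom c) (coords c) (chart_inv c)"

definition oriented_smooth_atlas :: "'m::topological_space chart set \<Rightarrow> bool" where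
  "oriented_smooth_atlas \<A> \<longleftrightarrow>
     (\<forall>c\<in>\<A>. is_chart c) \<and>
     (\<Union>c\<in>\<A>. chart_dom c) = UNIV \<and>
     (\<forall>c\<in>\<A>. \<forall>d\<in>\<A>. smooth_in_chart c (chart_dom d) (coords d)) \<and>
     (\<forall>c\<in>\<A>. \<forall>d\<in>\<A>. \<forall>p\<in>chart_dom c \<inter> chart_dom d. det (jacobian c d p) > 0)"


section \<open>Neutral metrics, self-duality, and the para-quaternionic structure\<close>

type_synonym 'm matrix_field = "'m chart \<Rightarrow> 'm \<Rightarrow> real ^ 4 ^ 4"

definition neutral_signature :: "real ^ 4 ^ 4 \<Rightarrow> bool" where
  "neutral_signature G \<longleftrightarrow> transpose G = G \<and>
     (\<exists>E :: real ^ 4 ^ 4. invertible E \<and>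
        transpose E ** G ** E =
          (\<chi> i j. if i = j then (if i = 1 \<or> i = 2 then 1 else - 1) else 0))"

definition neutral_metric :: "'m chart set \<Rightarrow> 'm matrix_field \<Rightarrow> bool" where
  "neutral_metric \<A> g \<longleftrightarrow>
     (\<forall>c\<in>\<A>. smooth_in_chart c (chart_dom c) (g c)) \<and>
     (\<forall>c\<in>\<A>. \<forall>p\<in>chart_dom c. neutral_signature (g c p)) \<and>
     (\<forall>c\<in>\<A>. \<forall>d\<in>\<A>. \<forall>p\<in>chart_dom c \<inter> chart_dom d.
        g c p = transpose (jacobian c d p) ** g d p ** jacobian c d p)"

text \<open>The value on four vectors of the volume form of the metric with Gram matrix \<open>G\<close>
  in a positively oriented basis.\<close>
definition volume_form ::
    "real ^ 4 ^ 4 \<Rightarrow> real ^ 4 \<Rightarrow> real ^ 4 \<Rightarrow> real ^ 4 \<Rightarrow> real ^ 4 \<Rightarrow> real" where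
  "volume_form G X Y Z V = sqrt \<bar>det G\<bar> * det (vector [X, Y, Z, V] :: real ^ 4 ^ 4)"

text \<open>Raising both indices of a 2-form.\<close>
definition raise :: "real ^ 4 ^ 4 \<Rightarrow> real ^ 4 ^ 4 \<Rightarrow> real ^ 4 ^ 4" where
  "raise G \<omega> = matrix_inv G ** \<omega> ** matrix_inv G"

text \<open>The Hodge star on 2-forms, normalised by \<open>\<alpha> \<and> \<star>\<beta> = \<langle>\<alpha>, \<beta>\<rangle> vol\<close>.\<close>
definition hodge :: "real ^ 4 ^ 4 \<Rightarrow> real ^ 4 ^ 4 \<Rightarrow> real ^ 4 ^ 4" where
  "hodge G \<omega> = (\<chi> k l. (\<Sum>i\<in>UNIV. \<Sum>j\<in>UNIV.
     raise G \<omega> $ i $ j * volume_form G (axis i 1) (axis j 1) (axis k 1) (axis l 1)) / 2)"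

definition self_dual :: "real ^ 4 ^ 4 \<Rightarrow> real ^ 4 ^ 4 \<Rightarrow> bool" where
  "self_dual G \<omega> \<longleftrightarrow> transpose \<omega> = - \<omega> \<and> hodge G \<omega> = \<omega>"

type_synonym 'm endo_bundle = "'m chart \<Rightarrow> 'm \<Rightarrow> (real ^ 4 ^ 4) set"

text \<open>The matrix \<open>transpose A ** G\<close> represents the bilinear form \<open>g(A\<cdot>, \<cdot>)\<close>, and
  \<open>G ** A\<close> represents \<open>g(\<cdot>, A\<cdot>)\<close>.\<close>
definition pq_structure :: "'m matrix_field \<Rightarrow> 'm endo_bundle" where
  "pq_structure g c p =
     {A. transpose A ** g c p = - (g c p ** A) \<and> self_dual (g c p) (transpose A ** g c p)}"

text \<open>Smooth endomorphism fields on an open set \<open>U\<close>, and smooth sections of \<open>P\<close> over \<open>U\<close>.\<close>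
definition smooth_endo_field :: "'m chart set \<Rightarrow> 'm set \<Rightarrow> 'm matrix_field \<Rightarrow> bool" where
  "smooth_endo_field \<A> U J \<longleftrightarrow>
     (\<forall>c\<in>\<A>. smooth_in_chart c U (J c)) \<and>
     (\<forall>c\<in>\<A>. \<forall>d\<in>\<A>. \<forall>p\<in>U \<inter> chart_dom c \<inter> chart_dom d.
        J d p ** jacobian c d p = jacobian c d p ** J c p)"

definition local_section ::
    "'m chart set \<Rightarrow> 'm endo_bundle \<Rightarrow> 'm set \<Rightarrow> 'm matrix_field \<Rightarrow> bool" where
  "local_section \<A> P U J \<longleftrightarrow> smooth_endo_field \<A> U J \<and>
     (\<forall>c\<in>\<A>. \<forall>p\<in>U \<inter> chart_dom c. J c p \<in> P c p)"

text \<open>A triple \<open>(J 1, J 2, J 3)\<close>; the values of \<open>J\<close> at other indices are irrelevant.\<close>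
definition admissible_local_basis ::
    "'m::topological_space chart set \<Rightarrow> 'm endo_bundle \<Rightarrow> 'm set \<Rightarrow> (nat \<Rightarrow> 'm matrix_field) \<Rightarrow> bool"
  where
  "admissible_local_basis \<A> P U J \<longleftrightarrow> open U \<and>
     (\<forall>a\<in>{1,2,3}. local_section \<A> P U (J a)) \<and>
     (\<forall>c\<in>\<A>. \<forall>p\<in>U \<inter> chart_dom c.
        P c p = span {J 1 c p, J 2 c p, J 3 c p} \<and>
        J 1 c p ** J 1 c p = mat 1 \<and>
        J 2 c p ** J 2 c p = mat 1 \<and>
        J 3 c p ** J 3 c p = - mat 1 \<and>
        J 1 c p ** J 2 c p = J 3 c p \<and>
        J 2 c p ** J 1 c p = - J 3 c p)"


section \<open>Linear connections\<close>

text \<open>In a chart \<open>c\<close> a linear connection on the tangent bundle is given by its connection form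
  \<open>\<Gamma> c p X\<close>, the matrix with entries \<open>\<Sum>i. X\<^sup>i \<Gamma>\<^sup>k\<^sub>i\<^sub>j\<close> (row \<open>k\<close>, column \<open>j\<close>), so that
  \<open>\<nabla>\<^sub>X Y = D\<^sub>X Y + \<Gamma> c p X *v Y\<close>. The last clause is the transformation law of the
  Christoffel symbols.\<close>
type_synonym 'm conn = "'m chart \<Rightarrow> 'm \<Rightarrow> real ^ 4 \<Rightarrow> real ^ 4 ^ 4"

definition linear_connection :: "'m chart set \<Rightarrow> 'm conn \<Rightarrow> bool" where
  "linear_connection \<A> \<Gamma> \<longleftrightarrow>
     (\<forall>c\<in>\<A>. \<forall>p\<in>chart_dom c. linear (\<Gamma> c p)) \<and>
     (\<forall>c\<in>\<A>. \<forall>X. smooth_in_chart c (chart_dom c) (\<lambda>p. \<Gamma> c p X)) \<and>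
     (\<forall>c\<in>\<A>. \<forall>d\<in>\<A>. \<forall>p\<in>chart_dom c \<inter> chart_dom d. \<forall>X.
        jacobian c d p ** \<Gamma> c p X =
        \<Gamma> d p (jacobian c d p *v X) ** jacobian c d p + chart_deriv c X (jacobian c d) p)"

text \<open>The covariant derivative \<open>\<nabla>\<^sub>X J\<close> of an endomorphism field.\<close>
definition cov_deriv_endo ::
    "'m conn \<Rightarrow> 'm matrix_field \<Rightarrow> 'm chart \<Rightarrow> 'm \<Rightarrow> real ^ 4 \<Rightarrow> real ^ 4 ^ 4" where
  "cov_deriv_endo \<Gamma> J c p X = chart_deriv c X (J c) p + \<Gamma> c p X ** J c p - J c p ** \<Gamma> c p X"

text \<open>The set \<open>\<Delta>(P)\<close>.\<close>
definition pq_connections ::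
    "'m::topological_space chart set \<Rightarrow> 'm endo_bundle \<Rightarrow> 'm conn set" where
  "pq_connections \<A> P = {\<Gamma>. linear_connection \<A> \<Gamma> \<and>
     (\<forall>U J. open U \<and> local_section \<A> P U J \<longrightarrow>
        (\<forall>c\<in>\<A>. \<forall>p\<in>U \<inter> chart_dom c. \<forall>X. cov_deriv_endo \<Gamma> J c p X \<in> P c p))}"

definition torsion :: "'m conn \<Rightarrow> 'm chart \<Rightarrow> 'm \<Rightarrow> real ^ 4 \<Rightarrow> real ^ 4 \<Rightarrow> real ^ 4" where
  "torsion \<Gamma> c p X Y = \<Gamma> c p X *v Y - \<Gamma> c p Y *v X"

text \<open>\<open>R(X,Y) = [\<nabla>\<^sub>X, \<nabla>\<^sub>Y] - \<nabla>\<^bsub>[X,Y]\<^esub>\<close>, evaluated on vector fields with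
  constant coefficients in \<open>c\<close>.\<close>
definition curvature :: "'m conn \<Rightarrow> 'm chart \<Rightarrow> 'm \<Rightarrow> real ^ 4 \<Rightarrow> real ^ 4 \<Rightarrow> real ^ 4 ^ 4" where
  "curvature \<Gamma> c p X Y =
     chart_deriv c X (\<lambda>q. \<Gamma> c q Y) p - chart_deriv c Y (\<lambda>q. \<Gamma> c q X) p
     + \<Gamma> c p X ** \<Gamma> c p Y - \<Gamma> c p Y ** \<Gamma> c p X"

text \<open>Koszul formula for vector fields with constant coefficients in \<open>c\<close>:
  the value of \<open>g(\<nabla>\<^sub>X Y, Z)\<close>.\<close>
definition koszul ::
    "'m matrix_field \<Rightarrow> 'm chart \<Rightarrow> 'm \<Rightarrow> real ^ 4 \<Rightarrow> real ^ 4 \<Rightarrow> real ^ 4 \<Rightarrow> real" where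
  "koszul g c p X Y Z =
     (chart_deriv c X (\<lambda>q. Y \<bullet> (g c q *v Z)) p
      + chart_deriv c Y (\<lambda>q. X \<bullet> (g c q *v Z)) p
      - chart_deriv c Z (\<lambda>q. X \<bullet> (g c q *v Y)) p) / 2"

definition levi_civita :: "'m matrix_field \<Rightarrow> 'm conn" where
  "levi_civita g c p X = matrix_inv (g c p) ** (\<chi> l j. koszul g c p X (axis j 1) (axis l 1))"


section \<open>The Weyl tensor and anti-self-duality\<close>

definition ricci :: "'m matrix_field \<Rightarrow> 'm chart \<Rightarrow> 'm \<Rightarrow> real ^ 4 \<Rightarrow> real ^ 4 \<Rightarrow> real" where
  "ricci g c p Y Z = trace (matrix (\<lambda>X. curvature (levi_civita g) c p X Y *v Z))"

definition scalar_curvature :: "'m matrix_field \<Rightarrow> 'm chart \<Rightarrow> 'm \<Rightarrow> real" where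
  "scalar_curvature g c p =
     trace (matrix_inv (g c p) ** (\<chi> i j. ricci g c p (axis i 1) (axis j 1)))"

text \<open>The trace-free part of \<open>g(R(X,Y)Z, V)\<close> in dimension 4.\<close>
definition weyl ::
    "'m matrix_field \<Rightarrow> 'm chart \<Rightarrow> 'm \<Rightarrow> real ^ 4 \<Rightarrow> real ^ 4 \<Rightarrow> real ^ 4 \<Rightarrow> real ^ 4 \<Rightarrow> real" where
  "weyl g c p X Y Z V =
     (let G = (\<lambda>X Y. X \<bullet> (g c p *v Y)); Ric = ricci g c p in
      G (curvature (levi_civita g) c p X Y *v Z) V
      - (G X V * Ric Y Z - G X Z * Ric Y V + G Y Z * Ric X V - G Y V * Ric X Z) / 2
      + scalar_curvature g c p / 6 * (G X V * G Y Z - G X Z * G Y V))"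

text \<open>The Weyl tensor acting on 2-forms.\<close>
definition weyl_operator :: "'m matrix_field \<Rightarrow> 'm chart \<Rightarrow> 'm \<Rightarrow> real ^ 4 ^ 4 \<Rightarrow> real ^ 4 ^ 4" where
  "weyl_operator g c p \<omega> = (\<chi> i j. (\<Sum>k\<in>UNIV. \<Sum>l\<in>UNIV.
     weyl g c p (axis i 1) (axis j 1) (axis k 1) (axis l 1) * raise (g c p) \<omega> $ k $ l) / 2)"

text \<open>\<open>W\<^sup>+\<close> is the restriction of the Weyl operator to the self-dual 2-forms.\<close>
definition anti_self_dual :: "'m chart set \<Rightarrow> 'm matrix_field \<Rightarrow> bool" where
  "anti_self_dual \<A> g \<longleftrightarrow>
     (\<forall>c\<in>\<A>. \<forall>p\<in>chart_dom c. \<forall>\<omega>. self_dual (g c p) \<omega> \<longrightarrow> weyl_operator g c p \<omega> = 0)"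


section \<open>Ricci forms and the (0,2)-part of the torsion\<close>

definition sgn_idx :: "nat \<Rightarrow> real" ("\<epsilon>") where
  "\<epsilon> a = (if a = 3 then - 1 else 1)"

definition ricci_form ::
    "'m conn \<Rightarrow> (nat \<Rightarrow> 'm matrix_field) \<Rightarrow> nat \<Rightarrow> 'm chart \<Rightarrow> 'm \<Rightarrow> real ^ 4 \<Rightarrow> real ^ 4 \<Rightarrow> real" where
  "ricci_form \<Gamma> J a c p X Y = \<epsilon> a / 2 * trace (J a c p ** curvature \<Gamma> c p X Y)"

definition ricci_form_condition ::
    "'m::topological_space chart set \<Rightarrow> 'm endo_bundle \<Rightarrow> 'm conn \<Rightarrow> bool" where
  "ricci_form_condition \<A> P \<Gamma> \<longleftrightarrow>
     (\<forall>U J. admissible_local_basis \<A> P U J \<longrightarrow>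
       (\<forall>(a, b, d) \<in> {(1,2,3), (2,3,1), (3,1,2)}. \<forall>c\<in>\<A>. \<forall>p\<in>U \<inter> chart_dom c. \<forall>X Y.
          ricci_form \<Gamma> J a c p (J b c p *v X) (J b c p *v Y)
          + \<epsilon> b * ricci_form \<Gamma> J a c p X Y
          + \<epsilon> a * ricci_form \<Gamma> J d c p (J b c p *v X) Y
          + \<epsilon> a * ricci_form \<Gamma> J d c p X (J b c p *v Y) = 0))"

text \<open>The (0,2)-part of a vector valued 2-form \<open>T\<close> with respect to \<open>J\<close>, where
  \<open>J ** J = mat e\<close> and \<open>e\<close> is \<open>1\<close> or \<open>- 1\<close>.\<close>
definition part02 ::
    "real \<Rightarrow> real ^ 4 ^ 4 \<Rightarrow> (real ^ 4 \<Rightarrow> real ^ 4 \<Rightarrow> real ^ 4) \<Rightarrow> real ^ 4 \<Rightarrow> real ^ 4 \<Rightarrow> real ^ 4" where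
  "part02 e J T X Y =
     (1/4) *\<^sub>R (e *\<^sub>R T X Y + T (J *v X) (J *v Y) - J *v T (J *v X) Y - J *v T X (J *v Y))"

definition torsion02_vanishes :: "'m chart set \<Rightarrow> 'm endo_bundle \<Rightarrow> 'm conn \<Rightarrow> bool" where
  "torsion02_vanishes \<A> P \<Gamma> \<longleftrightarrow>
     (\<forall>c\<in>\<A>. \<forall>p\<in>chart_dom c. \<forall>J\<in>P c p. \<forall>e\<in>{1, - 1}. J ** J = mat e \<longrightarrow>
        (\<forall>X Y. part02 e J (torsion \<Gamma> c p) X Y = 0))"

end

theory Submission
  imports Defs
begin

text \<open>
  Fix a point and an admissible basis \<open>J\<^sub>1, J\<^sub>2, J\<^sub>3\<close> of the fibre \<open>P\<close>. Up to constants, the Ricci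
  forms of a connection are the two-forms \<open>t\<^sub>a(X, Y) = tr (J\<^sub>a R(X, Y))\<close>, and the identity in
  conditions (ii) and (iii) is a linear condition on the triple \<open>(t\<^sub>1, t\<^sub>2, t\<^sub>3)\<close>, called
  \<open>ricci_identity\<close> below. Its basic solutions are
  \<open>t\<^sub>a(X, Y) = b(X, J\<^sub>a Y) - b(Y, J\<^sub>a X)\<close>
  for an arbitrary bilinear form \<open>b\<close> (\<open>ricci_identity_bilinear\<close>); both equivalences rest on this.

  For the Levi-Civita curvature, contracting the Weyl tensor with the self-dual form of
  \<open>A \<in> P\<close> gives, up to sign, the difference of \<open>tr (A R(X, Y))\<close> and
  \<open>s(Y, A X) - s(X, A Y)\<close>, where \<open>s\<close> is the Ricci tensor minus a sixth of the scalar curvature times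
  the metric. So \<open>W\<^sup>+ = 0\<close> says that the \<open>t\<^sub>a\<close> are of the basic form with \<open>b = - s\<close>, which gives the
  Ricci identity. Conversely, the Ricci identity restricts the self-dual block of the curvature
  operator, a symmetric map \<open>P \<rightarrow> P\<close>, to multiples of the identity; that is again \<open>W\<^sup>+ = 0\<close>
  (\<open>ricci_identity_iff_schouten\<close>, \<open>weyl_operator_vanishes_iff\<close>).

  For a para-quaternionic connection \<open>\<nabla> = \<nabla>\<^sup>g + S\<close> every \<open>S\<^sub>X\<close> normalises \<open>P\<close>. The part of \<open>S\<close> that
  commutes with \<open>P\<close> contributes neither to \<open>T\<^sup>0\<^sup>,\<^sup>2\<close> nor to the \<open>t\<^sub>a\<close>, and the vanishing of
  \<open>T\<^sup>0\<^sup>,\<^sup>2\<close> forces the remaining part to depend on a single one-form \<open>\<alpha>\<close>: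
  \<open>tr (A S\<^sub>X) = \<alpha>(A X)\<close> for all \<open>A \<in> P\<close> (\<open>part02_vanishes_trace\<close>). Differentiating this equation shows
  that \<open>t\<^sub>a\<close> changes by the basic solution with \<open>b = \<nabla>\<^sup>g \<alpha>\<close> and by a term quadratic in \<open>\<alpha>\<close> that solves the
  Ricci identity as well, so that (ii) and the identity for \<open>\<nabla>\<close> are equivalent
  (\<open>ricci_identity_independent_of_connection\<close>). As \<open>\<nabla>\<^sup>g\<close> is itself a para-quaternionic connection
  with vanishing torsion, (ii) and (iii) are equivalent.

  The rest provides what these arguments take for granted: smooth calculus in charts, the
  Levi-Civita connection with its transformation law and curvature symmetries, the existence of
  local admissible bases from smooth oriented orthonormal frames, and
  \<open>\<nabla>\<^sup>g \<in> \<Delta>(P)\<close>.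
\<close>

section \<open>Calculus of smooth maps\<close>

lemma times_differentiable_on_cong:
  assumes "open S" "\<And>x. x \<in> S \<Longrightarrow> f x = g x" "times_differentiable_on k S f"
  shows "times_differentiable_on k S g"
  using assms(2,3)
proof (induction k arbitrary: f g)
  case 0
  then show ?case by (simp cong: continuous_on_cong)
next
  case (Suc k)
  have d: "g differentiable (at x)" and e: "frechet_derivative g (at x) = frechet_derivative f (at x)"
    if "x \<in> S" for x
  proof -
    have "(f has_derivative frechet_derivative f (at x)) (at x)"
      using Suc.prems(2) that by (simp add: frechet_derivative_works[symmetric])
    then have "(g has_derivative frechet_derivative f (at x)) (at x)"
      by (rule has_derivative_transform_within_open[OF _ assms(1) that]) (use Suc.prems in auto)
    then show "g differentiable (at x)" "frechet_derivative g (at x) = frechet_derivative f (at x)"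
      by (auto simp: differentiable_def frechet_derivative_at[symmetric])
  qed
  show ?case
  proof -
    have "times_differentiable_on k S (\<lambda>x. frechet_derivative g (at x) v)" for v
      by (rule Suc.IH[where f="\<lambda>x. frechet_derivative f (at x) v"]) (use e Suc.prems in auto)
    then show ?thesis using d by simp
  qed
qed

lemma times_differentiable_on_Suc_D:
  "times_differentiable_on (Suc k) S f \<Longrightarrow> times_differentiable_on k S f"
proof (induction k arbitrary: f)
  case 0
  then show ?case
    by (auto intro!: continuous_at_imp_continuous_on differentiable_imp_continuous_within)
next
  case (Suc k)
  show ?case
    using Suc.prems Suc.IH unfolding times_differentiable_on.simps(2)[of "Suc k"]
      times_differentiable_on.simps(2)[of "k" S f] by blast
qed

lemma times_differentiable_on_subset:
  "times_differentiable_on k S f \<Longrightarrow> T \<subseteq> S \<Longrightarrow> times_differentiable_on k T f"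
  by (induction k arbitrary: f) (auto intro: continuous_on_subset)

lemma times_differentiable_on_const: "times_differentiable_on k S (\<lambda>x. c)"
  by (induction k arbitrary: c) auto

lemma times_differentiable_on_SucI:
  assumes "open S" "\<And>x. x \<in> S \<Longrightarrow> (f has_derivative f' x) (at x)"
    and "\<And>v. times_differentiable_on k S (\<lambda>x. f' x v)"
  shows "times_differentiable_on (Suc k) S f"
proof -
  have e: "frechet_derivative f (at x) = f' x" if "x \<in> S" for x
    using assms(2)[OF that] by (simp add: frechet_derivative_at[symmetric])
  have "times_differentiable_on k S (\<lambda>x. frechet_derivative f (at x) v)" for v
    by (rule times_differentiable_on_cong[OF assms(1) _ assms(3)[of v]]) (simp add: e)
  then show ?thesis
    using assms(2) by (auto simp: differentiable_def)
qed

lemma times_differentiable_on_SucD: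
  assumes "times_differentiable_on (Suc k) S f"
  shows "x \<in> S \<Longrightarrow> (f has_derivative frechet_derivative f (at x)) (at x)"
    "times_differentiable_on k S (\<lambda>x. frechet_derivative f (at x) v)"
  using assms by (auto simp: frechet_derivative_works[symmetric])

lemma (in bounded_linear) times_differentiable_on:
  assumes "open S" "times_differentiable_on k S g"
  shows "times_differentiable_on k S (\<lambda>x. f (g x))"
  using assms(2)
proof (induction k arbitrary: g)
  case 0
  then show ?case by (auto intro: continuous_on)
next
  case (Suc k)
  note D = times_differentiable_on_SucD[OF Suc.prems]
  show ?case
    by (rule times_differentiable_on_SucI[OF assms(1) has_derivative[OF D(1)] Suc.IH[OF D(2)]])
qed

lemma times_differentiable_on_add:
  assumes "open S" "times_differentiable_on k S f" "times_differentiable_on k S g"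
  shows "times_differentiable_on k S (\<lambda>x. f x + g x)"
  using assms(2,3)
proof (induction k arbitrary: f g)
  case 0
  then show ?case by (auto intro: continuous_intros)
next
  case (Suc k)
  note D = times_differentiable_on_SucD[OF Suc.prems(1)]
  note E = times_differentiable_on_SucD[OF Suc.prems(2)]
  show ?case
    by (rule times_differentiable_on_SucI[OF assms(1) has_derivative_add[OF D(1) E(1)]
      Suc.IH[OF D(2) E(2)]])
qed

lemma (in bounded_bilinear) times_differentiable_on:
  assumes "open S" "times_differentiable_on k S f" "times_differentiable_on k S g"
  shows "times_differentiable_on k S (\<lambda>x. prod (f x) (g x))"
  using assms(2,3)
proof (induction k arbitrary: f g)
  case 0
  then show ?case by (auto intro: continuous_on)
next
  case (Suc k)
  note D = times_differentiable_on_SucD[OF Suc.prems(1)]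
  note E = times_differentiable_on_SucD[OF Suc.prems(2)]
  show ?case
    by (rule times_differentiable_on_SucI[OF assms(1) FDERIV[OF D(1) E(1)]
          times_differentiable_on_add[OF assms(1)
            Suc.IH[OF times_differentiable_on_Suc_D[OF Suc.prems(1)] E(2)]
            Suc.IH[OF D(2) times_differentiable_on_Suc_D[OF Suc.prems(2)]]]])
qed

lemmas times_differentiable_on_mult =
  bounded_bilinear.times_differentiable_on[OF bounded_bilinear_mult]

text \<open>Real powers provide both the inverse and the inverse square root. The family of all exponents is
  closed under differentiation, which makes the induction on the order possible.\<close>

lemma times_differentiable_on_powr:
  fixes f :: "'a::real_normed_vector \<Rightarrow> real"
  assumes "open S" "times_differentiable_on k S f" "\<And>x. x \<in> S \<Longrightarrow> f x > 0"
  shows "times_differentiable_on k S (\<lambda>x. f x powr r)"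
  using assms(2)
proof (induction k arbitrary: r)
  case 0
  then show ?case
    by (auto intro!: continuous_intros dest: assms(3))
next
  case (Suc k)
  note D = times_differentiable_on_SucD[OF Suc.prems]
  have "((\<lambda>x. f x powr r) has_derivative (\<lambda>v. (r * f x powr (r - 1)) * frechet_derivative f (at x) v)) (at x)"
    if "x \<in> S" for x
    using has_derivative_powr[OF D(1)[OF that] has_derivative_const[of r] assms(3)[OF that] UNIV_I]
      assms(3)[OF that]
    by (simp add: powr_diff mult_ac)
  moreover have "times_differentiable_on k S (\<lambda>x. (r * f x powr (r - 1)) * frechet_derivative f (at x) v)" for v
    by (rule times_differentiable_on_mult[OF assms(1) times_differentiable_on_mult[OF assms(1)
        times_differentiable_on_const Suc.IH[OF times_differentiable_on_Suc_D[OF Suc.prems]]] D(2)])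
  ultimately show ?case
    by (rule times_differentiable_on_SucI[OF assms(1)])
qed

subsection \<open>Symmetry of second derivatives\<close>

text \<open>The second difference of \<open>f\<close> along \<open>u\<close> and \<open>v\<close> is, by the mean value theorem applied twice,
  a mixed second derivative at a nearby point.\<close>

lemma second_difference_mean_value:
  fixes f :: "'a::real_normed_vector \<Rightarrow> real"
  assumes f: "\<And>y. y \<in> ball x r \<Longrightarrow> (f has_derivative f' y) (at y)"
    and f': "\<And>y. y \<in> ball x r \<Longrightarrow> ((\<lambda>y. f' y u) has_derivative f'' y) (at y)"
    and h: "0 < h" "h * (norm u + norm v) < r"
  shows "\<exists>y. norm (y - x) \<le> h * (norm u + norm v) \<and>
    f (x + h *\<^sub>R u + h *\<^sub>R v) - f (x + h *\<^sub>R u) - f (x + h *\<^sub>R v) + f x = h * h * f'' y v"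
proof -
  have near: "norm (a *\<^sub>R u + b *\<^sub>R v) \<le> h * (norm u + norm v)" if "0 \<le> a" "a \<le> h" "0 \<le> b" "b \<le> h" for a b
  proof -
    have "norm (a *\<^sub>R u + b *\<^sub>R v) \<le> a * norm u + b * norm v"
      using norm_triangle_ineq[of "a *\<^sub>R u" "b *\<^sub>R v"] that by simp
    also have "\<dots> \<le> h * (norm u + norm v)"
      using that by (auto simp: distrib_left intro!: add_mono mult_right_mono)
    finally show ?thesis .
  qed
  then have inb: "x + a *\<^sub>R u + b *\<^sub>R v \<in> ball x r" if "0 \<le> a" "a \<le> h" "0 \<le> b" "b \<le> h" for a b
    using le_less_trans[OF near[OF that] h(2)] norm_minus_cancel[of "a *\<^sub>R u + b *\<^sub>R v"]
    by (simp add: dist_norm add.assoc del: norm_minus_cancel)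
  have lin: "linear (f' y)" if "y \<in> ball x r" for y
    using f[OF that] by (rule has_derivative_linear)
  have lin2: "linear (f'' y)" if "y \<in> ball x r" for y
    using f'[OF that] by (rule has_derivative_linear)
  define \<phi> where "\<phi> a = f (x + a *\<^sub>R u + h *\<^sub>R v) - f (x + a *\<^sub>R u)" for a
  have d\<phi>: "(\<phi> has_derivative (\<lambda>t. t * (f' (x + a *\<^sub>R u + h *\<^sub>R v) u - f' (x + a *\<^sub>R u) u))) (at a)"
    if "0 \<le> a" "a \<le> h" for a
  proof -
    have 1: "x + a *\<^sub>R u + h *\<^sub>R v \<in> ball x r" "x + a *\<^sub>R u \<in> ball x r"
      using inb[of a h] inb[of a 0] that h by auto
    have "((\<lambda>a. f (x + a *\<^sub>R u + h *\<^sub>R v)) has_derivative (\<lambda>t. f' (x + a *\<^sub>R u + h *\<^sub>R v) (t *\<^sub>R u))) (at a)"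
      by (rule has_derivative_compose[where f="\<lambda>a. x + a *\<^sub>R u + h *\<^sub>R v", OF _ f[OF 1(1)]]) (auto intro!: derivative_eq_intros)
    moreover have "((\<lambda>a. f (x + a *\<^sub>R u)) has_derivative (\<lambda>t. f' (x + a *\<^sub>R u) (t *\<^sub>R u))) (at a)"
      by (rule has_derivative_compose[where f="\<lambda>a. x + a *\<^sub>R u", OF _ f[OF 1(2)]]) (auto intro!: derivative_eq_intros)
    ultimately show ?thesis
      unfolding \<phi>_def
      by (rule has_derivative_eq_rhs[OF has_derivative_diff])
         (simp add: linear_scale[OF lin[OF 1(1)]] linear_scale[OF lin[OF 1(2)]] right_diff_distrib)
  qed
  obtain a where a: "0 < a" "a < h"
    and a1: "\<phi> h - \<phi> 0 = h * (f' (x + a *\<^sub>R u + h *\<^sub>R v) u - f' (x + a *\<^sub>R u) u)"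
    using mvt_simple[OF h(1) has_derivative_at_withinI[OF d\<phi>]] by auto
  define \<psi> where "\<psi> b = f' (x + a *\<^sub>R u + b *\<^sub>R v) u" for b
  have d\<psi>: "(\<psi> has_derivative (\<lambda>t. t * f'' (x + a *\<^sub>R u + b *\<^sub>R v) v)) (at b)"
    if "0 \<le> b" "b \<le> h" for b
  proof -
    have 1: "x + a *\<^sub>R u + b *\<^sub>R v \<in> ball x r"
      using inb[of a b] that a by auto
    have "(\<psi> has_derivative (\<lambda>t. f'' (x + a *\<^sub>R u + b *\<^sub>R v) (t *\<^sub>R v))) (at b)"
      unfolding \<psi>_def
      by (rule has_derivative_compose[where f="\<lambda>b. x + a *\<^sub>R u + b *\<^sub>R v", OF _ f'[OF 1]]) (auto intro!: derivative_eq_intros)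
    then show ?thesis
      by (simp add: linear_scale[OF lin2[OF 1]])
  qed
  obtain b where b: "0 < b" "b < h" and b1: "\<psi> h - \<psi> 0 = h * f'' (x + a *\<^sub>R u + b *\<^sub>R v) v"
    using mvt_simple[OF h(1) has_derivative_at_withinI[OF d\<psi>]] by auto
  have "f (x + h *\<^sub>R u + h *\<^sub>R v) - f (x + h *\<^sub>R u) - f (x + h *\<^sub>R v) + f x
    = h * h * f'' (x + a *\<^sub>R u + b *\<^sub>R v) v"
    using a1 b1 by (simp add: \<phi>_def \<psi>_def)
  moreover have "norm (x + a *\<^sub>R u + b *\<^sub>R v - x) \<le> h * (norm u + norm v)"
    using near[of a b] a b by (simp add: add.assoc)
  ultimately show ?thesis by blast
qed

text \<open>If the two mixed derivatives differed at \<open>x\<close>, they would differ near \<open>x\<close> by continuity. But the same second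
  difference, which is symmetric in \<open>u\<close> and \<open>v\<close>, is a value of either of them.\<close>

lemma second_derivative_symmetric_real:
  fixes f :: "'a::real_normed_vector \<Rightarrow> real"
  assumes S: "open S" "x \<in> S" and f: "times_differentiable_on 2 S f"
  shows "frechet_derivative (\<lambda>y. frechet_derivative f (at y) u) (at x) v =
    frechet_derivative (\<lambda>y. frechet_derivative f (at y) v) (at x) u"
proof -
  define A where "A u v y = frechet_derivative (\<lambda>y. frechet_derivative f (at y) u) (at y) v" for u v y
  obtain r where r: "0 < r" "ball x r \<subseteq> S"
    using S openE by blast
  note f = f[unfolded numeral_2_eq_2]
  have d1: "(f has_derivative frechet_derivative f (at y)) (at y)" if "y \<in> ball x r" for y
    using times_differentiable_on_SucD(1)[OF f] r that by blast
  have d2: "((\<lambda>y. frechet_derivative f (at y) u) has_derivative (\<lambda>v. A u v y)) (at y)"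
    if "y \<in> ball x r" for y u
    using times_differentiable_on_SucD(1)[OF times_differentiable_on_SucD(2)[OF f]] r that
    by (auto simp: A_def)
  have c: "continuous_on S (A u v)" for u v
    using times_differentiable_on_SucD(2)[OF times_differentiable_on_SucD(2)[OF f]]
    by (simp add: A_def[abs_def])
  have "A u v x = A v u x"
  proof (rule ccontr)
    assume ne: "A u v x \<noteq> A v u x"
    define e where "e = \<bar>A u v x - A v u x\<bar> / 2"
    have e: "e > 0" using ne by (simp add: e_def)
    have "\<exists>d>0. \<forall>y\<in>ball x d. \<bar>A u v y - A u v x\<bar> < e" for u v
    proof -
      have "isCont (A u v) x"
        using c S by (simp add: continuous_on_eq_continuous_at)
      then show ?thesis
        using e unfolding continuous_at_eps_delta dist_real_def
        by (metis dist_commute mem_ball)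
    qed
    then obtain d1' d2' where d1': "d1' > 0" "\<And>y. y\<in>ball x d1' \<Longrightarrow> \<bar>A u v y - A u v x\<bar> < e"
      and d2': "d2' > 0" "\<And>y. y\<in>ball x d2' \<Longrightarrow> \<bar>A v u y - A v u x\<bar> < e"
      by metis
    define \<delta> where "\<delta> = Min {r, d1', d2'}"
    have \<delta>: "\<delta> > 0" "\<delta> \<le> r" "\<delta> \<le> d1'" "\<delta> \<le> d2'" using r d1' d2' by (auto simp: \<delta>_def)
    define N where "N = norm u + norm v + 1"
    define h where "h = \<delta> / (2 * N)"
    have np: "N > 0"
      by (simp add: N_def add_nonneg_pos)
    have h: "h > 0" using \<delta> np by (simp add: h_def)
    have "h * (norm u + norm v) < h * N" using h by (simp add: N_def)
    also have "h * N < \<delta>" using \<delta> np by (simp add: h_def)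
    finally have h2: "h * (norm u + norm v) < \<delta>" .
    obtain y where y: "norm (y - x) \<le> h * (norm u + norm v)"
      "f (x + h *\<^sub>R u + h *\<^sub>R v) - f (x + h *\<^sub>R u) - f (x + h *\<^sub>R v) + f x = h * h * A u v y"
      using second_difference_mean_value[OF d1 d2 h order_less_le_trans[OF h2 \<delta>(2)]] by blast
    have h3: "h * (norm v + norm u) < \<delta>" using h2 by (simp add: add.commute)
    obtain z where z: "norm (z - x) \<le> h * (norm v + norm u)"
      "f (x + h *\<^sub>R v + h *\<^sub>R u) - f (x + h *\<^sub>R v) - f (x + h *\<^sub>R u) + f x = h * h * A v u z"
      using second_difference_mean_value[OF d1 d2 h order_less_le_trans[OF h3 \<delta>(2)]] by blast
    have "h * h * A u v y = h * h * A v u z"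
      using y(2) z(2) by (simp add: algebra_simps)
    then have eq: "A u v y = A v u z" using h by simp
    have "y \<in> ball x \<delta>" "z \<in> ball x \<delta>"
      using y(1) z(1) h2 by (auto simp: dist_norm norm_minus_commute add.commute)
    then have "\<bar>A u v y - A u v x\<bar> < e" "\<bar>A v u z - A v u x\<bar> < e"
      using d1'(2) d2'(2) \<delta> by auto
    then show False using eq unfolding e_def by argo
  qed
  then show ?thesis by (simp add: A_def)
qed

lemma second_derivative_symmetric:
  fixes f :: "'a::real_normed_vector \<Rightarrow> 'b::euclidean_space"
  assumes S: "open S" "x \<in> S" and f: "times_differentiable_on 2 S f"
  shows "frechet_derivative (\<lambda>y. frechet_derivative f (at y) u) (at x) v =
    frechet_derivative (\<lambda>y. frechet_derivative f (at y) v) (at x) u"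
proof (rule euclidean_eqI)
  fix b :: 'b assume "b \<in> Basis"
  have bl: "bounded_linear (\<lambda>z. z \<bullet> b)" by (rule bounded_linear_inner_left)
  have fr: "frechet_derivative (\<lambda>y. g y \<bullet> b) (at y) w = frechet_derivative g (at y) w \<bullet> b"
    if "times_differentiable_on (Suc k) S g" "y \<in> S" for g k y w
    using frechet_derivative_at[OF has_derivative_inner_left[OF times_differentiable_on_SucD(1)[OF that], of b]]
    by (metis (no_types))
  note f2 = f[unfolded numeral_2_eq_2]
  have fr2: "frechet_derivative (\<lambda>y. frechet_derivative (\<lambda>y. f y \<bullet> b) (at y) u) (at x) v
    = frechet_derivative (\<lambda>y. frechet_derivative f (at y) u) (at x) v \<bullet> b" for u v
  proof -
    have 1: "((\<lambda>y. frechet_derivative f (at y) u \<bullet> b) has_derivative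
        (\<lambda>v. frechet_derivative (\<lambda>y. frechet_derivative f (at y) u) (at x) v \<bullet> b)) (at x)"
      using has_derivative_inner_left times_differentiable_on_SucD(1)[OF times_differentiable_on_SucD(2)[OF f2] S(2)]
      by blast
    have "((\<lambda>y. frechet_derivative (\<lambda>y. f y \<bullet> b) (at y) u) has_derivative
        (\<lambda>v. frechet_derivative (\<lambda>y. frechet_derivative f (at y) u) (at x) v \<bullet> b)) (at x)"
      by (rule has_derivative_transform_within_open[OF 1 S]) (simp add: fr[OF f2])
    then show ?thesis by (simp add: frechet_derivative_at[symmetric])
  qed
  show "frechet_derivative (\<lambda>y. frechet_derivative f (at y) u) (at x) v \<bullet> b =
    frechet_derivative (\<lambda>y. frechet_derivative f (at y) v) (at x) u \<bullet> b"
    using second_derivative_symmetric_real[OF S bounded_linear.times_differentiable_on[OF bl S(1) f], of u v]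
    by (simp add: fr2)
qed

section \<open>Smooth functions in charts\<close>

definition differentiable_in_chart :: "'m chart \<Rightarrow> ('m \<Rightarrow> 'b::real_normed_vector) \<Rightarrow> 'm \<Rightarrow> bool" where
  "differentiable_in_chart c f p \<longleftrightarrow> (f \<circ> chart_inv c) differentiable (at (coords c p))"

lemma is_chart_coords_image_open:
  assumes "is_chart c" "open U"
  shows "open (coords c ` (U \<inter> chart_dom c))"
proof -
  have h: "homeomorphism (chart_dom c) (coords c ` chart_dom c) (coords c) (chart_inv c)"
    and o: "open (chart_dom c)" "open (coords c ` chart_dom c)"
    using assms by (auto simp: is_chart_def)
  have "openin (top_of_set (chart_dom c)) (U \<inter> chart_dom c)"
    using assms by (auto simp: openin_open)
  from homeomorphism_imp_open_map[OF h this]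
  have "openin (top_of_set (coords c ` chart_dom c)) (coords c ` (U \<inter> chart_dom c))" .
  then show ?thesis using o openin_open_trans by blast
qed

lemma chart_inv_coords:
  assumes "is_chart c" "p \<in> chart_dom c"
  shows "chart_inv c (coords c p) = p"
  using assms unfolding is_chart_def homeomorphism_def by blast

lemma chart_deriv_has_derivative:
  assumes "differentiable_in_chart c f p"
  shows "((f \<circ> chart_inv c) has_derivative (\<lambda>X. chart_deriv c X f p)) (at (coords c p))"
  using assms by (simp add: differentiable_in_chart_def chart_deriv_def frechet_derivative_works)

lemma chart_deriv_eqI:
  assumes "((f \<circ> chart_inv c) has_derivative D) (at (coords c p))"
  shows "differentiable_in_chart c f p" "chart_deriv c X f p = D X"
  using assms by (auto simp: differentiable_in_chart_def chart_deriv_def differentiable_def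
      frechet_derivative_at[symmetric])

lemma linear_chart_deriv:
  assumes "differentiable_in_chart c f p"
  shows "linear (\<lambda>X. chart_deriv c X f p)"
  using chart_deriv_has_derivative[OF assms] by (rule has_derivative_linear)

lemma chart_deriv_const [simp]:
  "differentiable_in_chart c (\<lambda>q. k) p" "chart_deriv c X (\<lambda>q. k) p = 0"
proof -
  have "(((\<lambda>q. k) \<circ> chart_inv c) has_derivative (\<lambda>X. 0)) (at (coords c p))"
    by (simp add: o_def)
  from chart_deriv_eqI[OF this]
  show "differentiable_in_chart c (\<lambda>q. k) p" "chart_deriv c X (\<lambda>q. k) p = 0" by auto
qed

lemma chart_deriv_add:
  assumes "differentiable_in_chart c f p" "differentiable_in_chart c h p"
  shows "differentiable_in_chart c (\<lambda>q. f q + h q) p"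
    "chart_deriv c X (\<lambda>q. f q + h q) p = chart_deriv c X f p + chart_deriv c X h p"
proof -
  have "(((\<lambda>q. f q + h q) \<circ> chart_inv c) has_derivative
      (\<lambda>X. chart_deriv c X f p + chart_deriv c X h p)) (at (coords c p))"
    using has_derivative_add[OF assms[THEN chart_deriv_has_derivative]] by (simp add: o_def)
  from chart_deriv_eqI[OF this]
  show "differentiable_in_chart c (\<lambda>q. f q + h q) p"
    "chart_deriv c X (\<lambda>q. f q + h q) p = chart_deriv c X f p + chart_deriv c X h p" by auto
qed

lemma (in bounded_linear) chart_deriv:
  assumes "differentiable_in_chart c h p"
  shows "differentiable_in_chart c (\<lambda>q. f (h q)) p"
    "chart_deriv c X (\<lambda>q. f (h q)) p = f (chart_deriv c X h p)"
proof -
  have "(((\<lambda>q. f (h q)) \<circ> chart_inv c) has_derivative (\<lambda>X. f (chart_deriv c X h p))) (at (coords c p))"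
    using has_derivative[OF chart_deriv_has_derivative[OF assms]] by (simp add: o_def)
  from chart_deriv_eqI[OF this]
  show "differentiable_in_chart c (\<lambda>q. f (h q)) p"
    "chart_deriv c X (\<lambda>q. f (h q)) p = f (chart_deriv c X h p)" by auto
qed

lemma (in bounded_bilinear) chart_deriv:
  assumes "is_chart c" "p \<in> chart_dom c" "differentiable_in_chart c f p" "differentiable_in_chart c h p"
  shows "differentiable_in_chart c (\<lambda>q. prod (f q) (h q)) p"
    "chart_deriv c X (\<lambda>q. prod (f q) (h q)) p =
      prod (f p) (chart_deriv c X h p) + prod (chart_deriv c X f p) (h p)"
proof -
  have "(((\<lambda>q. prod (f q) (h q)) \<circ> chart_inv c) has_derivative
      (\<lambda>X. prod (f p) (chart_deriv c X h p) + prod (chart_deriv c X f p) (h p))) (at (coords c p))"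
    using FDERIV[OF assms(3,4)[THEN chart_deriv_has_derivative]]
    by (simp add: o_def chart_inv_coords[OF assms(1,2)])
  from chart_deriv_eqI[OF this]
  show "differentiable_in_chart c (\<lambda>q. prod (f q) (h q)) p"
    "chart_deriv c X (\<lambda>q. prod (f q) (h q)) p =
      prod (f p) (chart_deriv c X h p) + prod (chart_deriv c X f p) (h p)" by auto
qed

lemma chart_deriv_cong:
  assumes c: "is_chart c" and U: "open U" "p \<in> U \<inter> chart_dom c"
    and eq: "\<And>q. q \<in> U \<inter> chart_dom c \<Longrightarrow> f q = h q"
  shows "differentiable_in_chart c f p \<longleftrightarrow> differentiable_in_chart c h p"
    "chart_deriv c X f p = chart_deriv c X h p"
proof -
  let ?S = "coords c ` (U \<inter> chart_dom c)"
  have 1: "open ?S" "coords c p \<in> ?S"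
    using is_chart_coords_image_open[OF c U(1)] U by auto
  have 2: "(f \<circ> chart_inv c) x = (h \<circ> chart_inv c) x" if "x \<in> ?S" for x
    using that eq by (auto simp: chart_inv_coords[OF c])
  have 3: "((f \<circ> chart_inv c) has_derivative D) (at (coords c p)) \<longleftrightarrow>
    ((h \<circ> chart_inv c) has_derivative D) (at (coords c p))" for D
    using has_derivative_transform_within_open[OF _ 1, of "f \<circ> chart_inv c" D UNIV "h \<circ> chart_inv c"]
      has_derivative_transform_within_open[OF _ 1, of "h \<circ> chart_inv c" D UNIV "f \<circ> chart_inv c"] 2
    by (metis (no_types))
  show "differentiable_in_chart c f p \<longleftrightarrow> differentiable_in_chart c h p"
    unfolding differentiable_in_chart_def differentiable_def 3 ..
  show "chart_deriv c X f p = chart_deriv c X h p"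
    unfolding chart_deriv_def frechet_derivative_def 3 ..
qed

subsection \<open>Closure properties of smooth functions\<close>

lemma smooth_in_chart_differentiable:
  assumes "is_chart c" "open U" "smooth_in_chart c U f" "p \<in> U \<inter> chart_dom c"
  shows "differentiable_in_chart c f p"
proof -
  have "times_differentiable_on (Suc 0) (coords c ` (U \<inter> chart_dom c)) (f \<circ> chart_inv c)"
    using assms(3) unfolding smooth_in_chart_def smooth_on_def by blast
  then show ?thesis
    using assms(4) unfolding differentiable_in_chart_def times_differentiable_on.simps by blast
qed

lemma smooth_in_chart_subset:
  assumes "smooth_in_chart c U f" "V \<inter> chart_dom c \<subseteq> U"
  shows "smooth_in_chart c V f"
proof -
  have "coords c ` (V \<inter> chart_dom c) \<subseteq> coords c ` (U \<inter> chart_dom c)"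
    using assms(2) by auto
  from times_differentiable_on_subset[OF _ this] assms(1) show ?thesis
    unfolding smooth_in_chart_def smooth_on_def by blast
qed

lemma smooth_in_chart_const [simp]: "smooth_in_chart c U (\<lambda>q. k)"
  by (simp add: smooth_in_chart_def smooth_on_def o_def times_differentiable_on_const)

context
  fixes c :: "'m::topological_space chart" and U :: "'m set"
  assumes c: "is_chart c" and U: "open U"
begin

private lemma S: "open (coords c ` (U \<inter> chart_dom c))"
  by (rule is_chart_coords_image_open[OF c U])

lemma smooth_in_chart_cong:
  assumes "\<And>q. q \<in> U \<inter> chart_dom c \<Longrightarrow> f q = h q" "smooth_in_chart c U f"
  shows "smooth_in_chart c U h"
  unfolding smooth_in_chart_def smooth_on_def
proof
  fix k
  have "(f \<circ> chart_inv c) x = (h \<circ> chart_inv c) x" if "x \<in> coords c ` (U \<inter> chart_dom c)" for x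
    using that assms(1) by (auto simp: chart_inv_coords[OF c])
  then show "times_differentiable_on k (coords c ` (U \<inter> chart_dom c)) (h \<circ> chart_inv c)"
    by (rule times_differentiable_on_cong[OF S])
       (use assms(2) in \<open>auto simp only: smooth_in_chart_def smooth_on_def\<close>)
qed

lemma smooth_in_chart_add:
  "smooth_in_chart c U f \<Longrightarrow> smooth_in_chart c U h \<Longrightarrow> smooth_in_chart c U (\<lambda>q. f q + h q)"
  unfolding smooth_in_chart_def smooth_on_def o_def
  by (auto intro: times_differentiable_on_add[OF S])

lemma smooth_in_chart_linear:
  "bounded_linear L \<Longrightarrow> smooth_in_chart c U f \<Longrightarrow> smooth_in_chart c U (\<lambda>q. L (f q))"
  unfolding smooth_in_chart_def smooth_on_def o_def
  by (auto intro: bounded_linear.times_differentiable_on[OF _ S])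

lemma smooth_in_chart_bilinear:
  "bounded_bilinear B \<Longrightarrow> smooth_in_chart c U f \<Longrightarrow> smooth_in_chart c U h \<Longrightarrow>
    smooth_in_chart c U (\<lambda>q. B (f q) (h q))"
  unfolding smooth_in_chart_def smooth_on_def o_def
  by (auto intro: bounded_bilinear.times_differentiable_on[OF _ S])

lemma smooth_in_chart_powr:
  fixes f :: "'m \<Rightarrow> real"
  assumes "smooth_in_chart c U f" "\<And>q. q \<in> U \<inter> chart_dom c \<Longrightarrow> f q > 0"
  shows "smooth_in_chart c U (\<lambda>q. f q powr r)"
  using assms unfolding smooth_in_chart_def smooth_on_def o_def
  by (intro allI times_differentiable_on_powr[OF S]) (auto simp: chart_inv_coords[OF c])

lemma smooth_in_chart_deriv:
  assumes "smooth_in_chart c U f"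
  shows "smooth_in_chart c U (chart_deriv c X f)"
  unfolding smooth_in_chart_def smooth_on_def
proof
  fix k
  have "times_differentiable_on (Suc k) (coords c ` (U \<inter> chart_dom c)) (f \<circ> chart_inv c)"
    using assms by (simp add: smooth_in_chart_def smooth_on_def)
  then have "times_differentiable_on k (coords c ` (U \<inter> chart_dom c))
      (\<lambda>x. frechet_derivative (f \<circ> chart_inv c) (at x) X)"
    by simp
  then show "times_differentiable_on k (coords c ` (U \<inter> chart_dom c)) (chart_deriv c X f \<circ> chart_inv c)"
    by (rule times_differentiable_on_cong[OF S, rotated]) (auto simp: chart_deriv_def chart_inv_coords[OF c])
qed

lemma smooth_in_chart_mult:
  fixes f :: "'m \<Rightarrow> 'a::real_normed_algebra"
  shows "smooth_in_chart c U f \<Longrightarrow> smooth_in_chart c U h \<Longrightarrow> smooth_in_chart c U (\<lambda>q. f q * h q)"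
  by (rule smooth_in_chart_bilinear[OF bounded_bilinear_mult])

lemma smooth_in_chart_scaleR:
  "smooth_in_chart c U f \<Longrightarrow> smooth_in_chart c U h \<Longrightarrow> smooth_in_chart c U (\<lambda>q. f q *\<^sub>R h q)"
  by (rule smooth_in_chart_bilinear[OF bounded_bilinear_scaleR])

lemma smooth_in_chart_diff:
  assumes "smooth_in_chart c U f" "smooth_in_chart c U h"
  shows "smooth_in_chart c U (\<lambda>q. f q - h q)"
  using smooth_in_chart_add[OF assms(1) smooth_in_chart_linear[OF bounded_linear_minus[OF bounded_linear_ident] assms(2)]]
  by simp

lemma smooth_in_chart_sum:
  "(\<And>i. i \<in> I \<Longrightarrow> smooth_in_chart c U (f i)) \<Longrightarrow> smooth_in_chart c U (\<lambda>q. \<Sum>i\<in>I. f i q)"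
  by (induction I rule: infinite_finite_induct) (auto intro: smooth_in_chart_add)

lemma smooth_in_chart_prod:
  fixes f :: "'i \<Rightarrow> 'm \<Rightarrow> 'a::{real_normed_algebra, comm_ring_1}"
  shows "(\<And>i. i \<in> I \<Longrightarrow> smooth_in_chart c U (f i)) \<Longrightarrow> smooth_in_chart c U (\<lambda>q. \<Prod>i\<in>I. f i q)"
  by (induction I rule: infinite_finite_induct) (auto intro: smooth_in_chart_mult)

lemma smooth_in_chart_nth:
  "smooth_in_chart c U f \<Longrightarrow> smooth_in_chart c U (\<lambda>q. f q $ i)"
  by (rule smooth_in_chart_linear[OF bounded_linear_vec_nth])

lemma smooth_in_chart_vec:
  fixes f :: "'i::finite \<Rightarrow> 'm \<Rightarrow> 'a::real_normed_vector"
  assumes "\<And>i. smooth_in_chart c U (f i)"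
  shows "smooth_in_chart c U (\<lambda>q. \<chi> i. f i q)"
proof -
  have bl: "bounded_linear (\<lambda>x::'a. \<chi> j. if j = i then x else 0)" for i :: 'i
  proof (rule bounded_linear_intro[where K=1])
    fix x :: 'a
    have "norm (\<chi> j. if j = i then x else 0) = L2_set (\<lambda>j. norm (if j = i then x else 0)) UNIV"
      by (simp add: norm_vec_def)
    also have "\<dots> \<le> norm x"
      by (rule order_trans[OF L2_set_le_sum]) (auto simp: if_distrib cong: if_cong)
    finally show "norm (\<chi> j. if j = i then x else 0) \<le> norm x * 1" by simp
  qed (auto simp: vec_eq_iff)
  have e: "(\<chi> i. f i q) = (\<Sum>i\<in>UNIV. \<chi> j. if j = i then f i q else 0)" for q
    by (simp add: vec_eq_iff sum_component)
  show ?thesis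
    unfolding e by (rule smooth_in_chart_sum[OF smooth_in_chart_linear[OF bl assms]])
qed

lemma smooth_in_chart_inverse:
  fixes f :: "'m \<Rightarrow> real"
  assumes f: "smooth_in_chart c U f" and nz: "\<And>q. q \<in> U \<inter> chart_dom c \<Longrightarrow> f q \<noteq> 0"
  shows "smooth_in_chart c U (\<lambda>q. inverse (f q))"
proof -
  \<comment> \<open>powers with real exponents are smooth on positive functions only, so pass to the square\<close>
  have "smooth_in_chart c U (\<lambda>q. f q * (f q * f q) powr (- 1))"
    using nz by (intro smooth_in_chart_mult smooth_in_chart_powr f) (auto simp: zero_less_mult_iff neq_iff)
  then show ?thesis
    by (rule smooth_in_chart_cong[rotated]) (use nz in \<open>auto simp: powr_minus field_simps\<close>)
qed

lemma smooth_in_chart_det: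
  fixes f :: "'m \<Rightarrow> real ^ 'n ^ 'n"
  assumes "smooth_in_chart c U f"
  shows "smooth_in_chart c U (\<lambda>q. det (f q))"
  unfolding det_def
  by (intro smooth_in_chart_sum smooth_in_chart_mult smooth_in_chart_prod smooth_in_chart_const
      smooth_in_chart_nth assms)

end

lemma invertible_matrix_inv:
  fixes A :: "'a::semiring_1 ^ 'n ^ 'm"
  assumes "invertible A"
  shows "A ** matrix_inv A = mat 1" "matrix_inv A ** A = mat 1"
proof -
  have "A ** matrix_inv A = mat 1 \<and> matrix_inv A ** A = mat 1"
    using assms unfolding invertible_def matrix_inv_def by (rule someI_ex)
  then show "A ** matrix_inv A = mat 1" "matrix_inv A ** A = mat 1" by auto
qed

lemma matrix_inv_unique:
  fixes A :: "'a::semiring_1 ^ 'n ^ 'm"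
  assumes "A ** B = mat 1" "B ** A = mat 1"
  shows "matrix_inv A = B"
proof -
  have i: "invertible A" using assms by (auto simp: invertible_def)
  have "matrix_inv A = matrix_inv A ** (A ** B)" using assms by simp
  also have "\<dots> = B" by (simp add: matrix_mul_assoc invertible_matrix_inv[OF i])
  finally show ?thesis .
qed

text \<open>Determinants are polynomials in the entries, so that Cramer's rule reduces the smoothness of matrix
  inversion to that of products and of the scalar inverse.\<close>

lemma matrix_inv_cramer:
  fixes A :: "real ^ 'n ^ 'n"
  assumes "invertible A"
  shows "matrix_inv A $ k $ l = det (\<chi> i j. if j = k then axis l 1 $ i else A $ i $ j) / det A"
proof -
  have "A *v (matrix_inv A *v axis l 1) = axis l 1"
    by (simp add: matrix_vector_mul_assoc invertible_matrix_inv[OF assms])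
  then have "matrix_inv A *v axis l 1 = (\<chi> k. det (\<chi> i j. if j = k then axis l 1 $ i else A $ i $ j) / det A)"
    using assms by (subst (asm) cramer) (auto simp: invertible_det_nz)
  then show ?thesis
    by (simp add: matrix_vector_mult_basis column_def vec_eq_iff)
qed

lemma smooth_in_chart_matrix_inv:
  fixes f :: "'m::topological_space \<Rightarrow> real ^ 'n ^ 'n"
  assumes c: "is_chart c" and U: "open U" and f: "smooth_in_chart c U f"
    and inv: "\<And>q. q \<in> U \<inter> chart_dom c \<Longrightarrow> invertible (f q)"
  shows "smooth_in_chart c U (\<lambda>q. matrix_inv (f q))"
proof (rule smooth_in_chart_cong[OF c U])
  have comp: "smooth_in_chart c U (\<lambda>q. if j = k then axis l 1 $ i else f q $ i $ j)" for i j k l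
    by (cases "j = k") (auto intro!: smooth_in_chart_nth[OF c U] f)
  show "smooth_in_chart c U (\<lambda>q. \<chi> k l.
      det (\<chi> i j. if j = k then axis l 1 $ i else f q $ i $ j) * inverse (det (f q)))"
    by (intro smooth_in_chart_vec[OF c U] smooth_in_chart_mult[OF c U] smooth_in_chart_det[OF c U]
        smooth_in_chart_inverse[OF c U] f comp) (use inv in \<open>simp add: invertible_det_nz\<close>)
  show "(\<chi> k l. det (\<chi> i j. if j = k then axis l 1 $ i else f q $ i $ j) * inverse (det (f q))) =
      matrix_inv (f q)" if "q \<in> U \<inter> chart_dom c" for q
    by (simp add: vec_eq_iff matrix_inv_cramer[OF inv[OF that]] divide_inverse)
qed

subsection \<open>Matrix algebra\<close>

lemma matrix_mult_distrib:
  fixes A B C :: "real ^ 'n ^ 'n"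
  shows "A ** (B + C) = A ** B + A ** C" "(A + B) ** C = A ** C + B ** C"
    "A ** (B - C) = A ** B - A ** C" "(A - B) ** C = A ** C - B ** C"
    "A ** (- B) = - (A ** B)" "(- A) ** B = - (A ** B)"
    "A ** (r *\<^sub>R B) = r *\<^sub>R (A ** B)" "(r *\<^sub>R A) ** B = r *\<^sub>R (A ** B)"
  by (simp_all add: matrix_matrix_mult_def vec_eq_iff algebra_simps sum.distrib sum_subtractf sum_negf
      sum_distrib_left)

lemma matrix_vector_mult_neg:
  fixes A :: "real ^ 'n ^ 'n"
  shows "(- A) *v x = - (A *v x)" "A *v (- x) = - (A *v x)" "(r *\<^sub>R A) *v x = r *\<^sub>R (A *v x)"
  by (simp_all add: matrix_vector_mult_def vec_eq_iff sum_negf sum_distrib_left mult.assoc)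

lemma transpose_linear:
  fixes A B :: "real ^ 'n ^ 'n"
  shows "transpose (A + B) = transpose A + transpose B" "transpose (A - B) = transpose A - transpose B"
    "transpose (- A) = - transpose A" "transpose 0 = (0 :: real ^ 'n ^ 'n)"
  by (simp_all add: transpose_def vec_eq_iff)

lemma trace_linear:
  fixes A B :: "real ^ 'n ^ 'n"
  shows "trace (- A) = - trace A" "trace (r *\<^sub>R A) = r * trace A"
  by (simp_all add: trace_def sum_negf sum_distrib_left)

lemma inner_matrix_mult_transpose: "X \<bullet> (A *v Y) = (transpose A *v X) \<bullet> Y"
  for A :: "real ^ 'n ^ 'n"
  by (simp add: dot_lmul_matrix)

lemma axis_expansion: "(\<Sum>i\<in>UNIV. (x $ i) *\<^sub>R axis i 1) = (x :: real ^ 'n)"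
  using basis_expansion[of x] by (simp add: scalar_mult_eq_scaleR)

lemma bilinear_entry: "(transpose F ** A ** H) $ i $ j = (F *v axis i 1) \<bullet> (A *v (H *v axis j 1))"
  for F :: "real ^ 'n ^ 'n"
proof -
  have "(transpose F ** A ** H) $ i $ j = axis i 1 \<bullet> ((transpose F ** A ** H) *v axis j 1)"
    by (simp add: matrix_vector_mult_basis column_def inner_axis inner_axis')
  also have "\<dots> = axis i 1 \<bullet> (transpose F *v (A *v (H *v axis j 1)))"
    by (simp only: matrix_vector_mul_assoc matrix_mul_assoc)
  also have "\<dots> = (F *v axis i 1) \<bullet> (A *v (H *v axis j 1))"
    by (simp only: inner_matrix_mult_transpose[of "axis i 1" "transpose F"] transpose_transpose)
  finally show ?thesis .
qed

lemma bilinear_as_matrix: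
  fixes f :: "real ^ 'n \<Rightarrow> real ^ 'n \<Rightarrow> real"
  assumes bil: "bilinear f"
  shows "f x y = x \<bullet> ((\<chi> i j. f (axis i 1) (axis j 1)) *v y)"
proof -
  have "f x y = f (\<Sum>i\<in>UNIV. (x $ i) *\<^sub>R axis i 1) (\<Sum>j\<in>UNIV. (y $ j) *\<^sub>R axis j 1)"
    by (simp only: axis_expansion)
  also have "\<dots> = (\<Sum>i\<in>UNIV. \<Sum>j\<in>UNIV. x $ i * y $ j * f (axis i 1) (axis j 1))"
    by (simp add: bilinear_sum[OF bil] sum.cartesian_product bilinear_lmul[OF bil] bilinear_rmul[OF bil] mult_ac)
  finally show ?thesis
    by (simp add: inner_vec_def matrix_vector_mult_def sum_distrib_left mult_ac)
qed

lemma bounded_bilinear_matrix_mult: "bounded_bilinear (\<lambda>(A :: real ^ 'n ^ 'n) (B :: real ^ 'n ^ 'n). A ** B)"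
  unfolding bilinear_conv_bounded_bilinear[symmetric] bilinear_def
  by (auto intro!: linearI simp: matrix_mult_distrib)

lemma bounded_bilinear_matrix_vector_mult: "bounded_bilinear (\<lambda>(A :: real ^ 'n ^ 'n) x. A *v x)"
  unfolding bilinear_conv_bounded_bilinear[symmetric] bilinear_def
  by (auto intro!: linearI simp: matrix_vector_mult_neg algebra_simps)

lemma bounded_linear_transpose: "bounded_linear (transpose :: real ^ 'n ^ 'n \<Rightarrow> _)"
  unfolding linear_conv_bounded_linear[symmetric]
  by (auto intro!: linearI simp: transpose_linear transpose_scalar)

lemma bounded_linear_trace: "bounded_linear (trace :: real ^ 'n ^ 'n \<Rightarrow> real)"
  unfolding linear_conv_bounded_linear[symmetric]
  by (auto intro!: linearI simp: trace_add trace_linear)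

section \<open>Changes of charts\<close>

lemma second_chart_deriv_commute:
  fixes f :: "'m::topological_space \<Rightarrow> 'b::euclidean_space"
  assumes c: "is_chart c" and U: "open U" "p \<in> U \<inter> chart_dom c" and f: "smooth_in_chart c U f"
  shows "chart_deriv c X (chart_deriv c Y f) p = chart_deriv c Y (chart_deriv c X f) p"
proof -
  let ?S = "coords c ` (U \<inter> chart_dom c)" and ?f = "f \<circ> chart_inv c"
  have 1: "open ?S" "coords c p \<in> ?S"
    using is_chart_coords_image_open[OF c U(1)] U by auto
  have "times_differentiable_on 2 ?S ?f"
    using f unfolding smooth_in_chart_def smooth_on_def by blast
  note sym = second_derivative_symmetric[OF 1 this]
  have "chart_deriv c X (chart_deriv c Y f) p
      = frechet_derivative (\<lambda>x. frechet_derivative ?f (at x) Y) (at (coords c p)) X" for X Y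
  proof -
    have d: "((chart_deriv c Y f \<circ> chart_inv c) has_derivative (\<lambda>X. chart_deriv c X (chart_deriv c Y f) p)) (at (coords c p))"
      by (rule chart_deriv_has_derivative[OF smooth_in_chart_differentiable[OF c U(1)
            smooth_in_chart_deriv[OF c U(1) f] U(2)]])
    have "((\<lambda>x. frechet_derivative ?f (at x) Y) has_derivative
        (\<lambda>X. chart_deriv c X (chart_deriv c Y f) p)) (at (coords c p))"
      by (rule has_derivative_transform_within_open[OF d 1])
         (auto simp: chart_deriv_def chart_inv_coords[OF c])
    then show ?thesis by (simp add: frechet_derivative_at[symmetric])
  qed
  then show ?thesis using sym by simp
qed

locale oriented_manifold =
  fixes \<A> :: "'m::{t2_space, second_countable_topology} chart set"
  assumes atlas: "oriented_smooth_atlas \<A>"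
begin

lemma chart: "c \<in> \<A> \<Longrightarrow> is_chart c"
  using atlas by (simp add: oriented_smooth_atlas_def)

lemma open_chart_dom: "c \<in> \<A> \<Longrightarrow> open (chart_dom c)"
  using chart by (simp add: is_chart_def)

lemma smooth_coords: "c \<in> \<A> \<Longrightarrow> d \<in> \<A> \<Longrightarrow> smooth_in_chart c (chart_dom d) (coords d)"
  using atlas by (simp add: oriented_smooth_atlas_def)

lemma det_jacobian_pos:
  "c \<in> \<A> \<Longrightarrow> d \<in> \<A> \<Longrightarrow> p \<in> chart_dom c \<Longrightarrow> p \<in> chart_dom d \<Longrightarrow> det (jacobian c d p) > 0"
  using atlas by (simp add: oriented_smooth_atlas_def)

lemma differentiable_coords:
  assumes "c \<in> \<A>" "d \<in> \<A>" "p \<in> chart_dom c" "p \<in> chart_dom d"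
  shows "differentiable_in_chart c (coords d) p"
  using assms by (intro smooth_in_chart_differentiable[OF chart open_chart_dom smooth_coords]) auto

lemma jacobian_mult_vec:
  assumes "c \<in> \<A>" "d \<in> \<A>" "p \<in> chart_dom c" "p \<in> chart_dom d"
  shows "jacobian c d p *v X = chart_deriv c X (coords d) p"
  unfolding jacobian_def
  using matrix_vector_mul(2)[OF linear_chart_deriv[OF differentiable_coords[OF assms]]] by metis

lemma chart_deriv_change:
  assumes cd: "c \<in> \<A>" "d \<in> \<A>" "p \<in> chart_dom c" "p \<in> chart_dom d"
    and f: "differentiable_in_chart d f p"
  shows "differentiable_in_chart c f p" "chart_deriv c X f p = chart_deriv d (jacobian c d p *v X) f p"
proof -
  let ?S = "coords c ` (chart_dom d \<inter> chart_dom c)"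
  have 1: "open ?S" "coords c p \<in> ?S"
    using is_chart_coords_image_open[OF chart open_chart_dom] cd by auto
  note inv = chart_inv_coords[OF chart]
  have 2: "((coords d \<circ> chart_inv c) has_derivative (\<lambda>X. jacobian c d p *v X)) (at (coords c p))"
    using chart_deriv_has_derivative[OF differentiable_coords[OF cd]]
    by (simp add: jacobian_mult_vec[OF cd])
  have 3: "((f \<circ> chart_inv d) has_derivative (\<lambda>X. chart_deriv d X f p)) (at ((coords d \<circ> chart_inv c) (coords c p)))"
    using chart_deriv_has_derivative[OF f] cd by (simp add: inv)
  have "((\<lambda>x. (f \<circ> chart_inv d) ((coords d \<circ> chart_inv c) x)) has_derivative
      (\<lambda>X. chart_deriv d (jacobian c d p *v X) f p)) (at (coords c p))"
    by (rule has_derivative_compose[OF 2 3])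
  then have "((f \<circ> chart_inv c) has_derivative (\<lambda>X. chart_deriv d (jacobian c d p *v X) f p)) (at (coords c p))"
    by (rule has_derivative_transform_within_open[OF _ 1]) (use cd in \<open>auto simp: inv\<close>)
  from chart_deriv_eqI[OF this] show "differentiable_in_chart c f p"
    "chart_deriv c X f p = chart_deriv d (jacobian c d p *v X) f p" by auto
qed

lemma jacobian_self:
  assumes "c \<in> \<A>" "p \<in> chart_dom c"
  shows "jacobian c c p = mat 1"
proof -
  let ?S = "coords c ` (UNIV \<inter> chart_dom c)"
  have 1: "open ?S" "coords c p \<in> ?S"
    using is_chart_coords_image_open[OF chart open_UNIV] assms by auto
  have "((\<lambda>x. x) has_derivative (\<lambda>x. x)) (at (coords c p))" by (rule has_derivative_ident)
  then have "((coords c \<circ> chart_inv c) has_derivative (\<lambda>x. x)) (at (coords c p))"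
    by (rule has_derivative_transform_within_open[OF _ 1])
       (use assms in \<open>auto simp: chart_inv_coords[OF chart]\<close>)
  from chart_deriv_eqI(2)[OF this] show ?thesis
    by (simp add: matrix_eq jacobian_mult_vec[OF assms(1,1,2,2)])
qed

lemma jacobian_compose:
  assumes "c \<in> \<A>" "d \<in> \<A>" "e \<in> \<A>" "p \<in> chart_dom c" "p \<in> chart_dom d" "p \<in> chart_dom e"
  shows "jacobian d e p ** jacobian c d p = jacobian c e p"
  using assms chart_deriv_change[OF assms(1,2,4,5) differentiable_coords[OF assms(2,3,5,6)]]
  by (simp add: matrix_eq matrix_vector_mul_assoc[symmetric] jacobian_mult_vec)

lemma jacobian_inverse:
  assumes "c \<in> \<A>" "d \<in> \<A>" "p \<in> chart_dom c" "p \<in> chart_dom d"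
  shows "jacobian d c p ** jacobian c d p = mat 1"
  using assms by (simp add: jacobian_compose jacobian_self)

lemma invertible_jacobian:
  assumes "c \<in> \<A>" "d \<in> \<A>" "p \<in> chart_dom c" "p \<in> chart_dom d"
  shows "invertible (jacobian c d p)" "matrix_inv (jacobian c d p) = jacobian d c p"
  using jacobian_inverse[of c d p] jacobian_inverse[of d c p] assms
  by (auto simp: invertible_def intro!: matrix_inv_unique)

lemma smooth_jacobian:
  assumes "c \<in> \<A>" "d \<in> \<A>"
  shows "smooth_in_chart c (chart_dom d) (jacobian c d)"
proof -
  note cd = chart[OF assms(1)] open_chart_dom[OF assms(2)]
  have "smooth_in_chart c (chart_dom d) (\<lambda>p. \<chi> i j. chart_deriv c (axis j 1) (coords d) p $ i)"
    by (intro smooth_in_chart_vec[OF cd] smooth_in_chart_nth[OF cd] smooth_in_chart_deriv[OF cd]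
        smooth_coords assms)
  then show ?thesis by (simp add: jacobian_def[abs_def] matrix_def)
qed

lemma differentiable_jacobian:
  assumes "c \<in> \<A>" "d \<in> \<A>" "p \<in> chart_dom c" "p \<in> chart_dom d"
  shows "differentiable_in_chart c (jacobian c d) p"
  using assms by (intro smooth_in_chart_differentiable[OF chart open_chart_dom smooth_jacobian]) auto

text \<open>This symmetry of the second derivatives of a transition map is the reason why the inhomogeneous
  term in the transformation law of a connection does not affect the torsion.\<close>

lemma jacobian_deriv_symmetric:
  assumes cd: "c \<in> \<A>" "d \<in> \<A>" "p \<in> chart_dom c" "p \<in> chart_dom d"
  shows "chart_deriv c X (jacobian c d) p *v Y = chart_deriv c Y (jacobian c d) p *v X"
proof -
  have p: "p \<in> chart_dom d \<inter> chart_dom c" using cd by auto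
  have "chart_deriv c X (jacobian c d) p *v Y = chart_deriv c X (chart_deriv c Y (coords d)) p" for X Y
  proof -
    have "chart_deriv c X (\<lambda>q. jacobian c d q *v Y) p = chart_deriv c X (jacobian c d) p *v Y"
      by (rule bounded_linear.chart_deriv(2)[OF
            bounded_bilinear.bounded_linear_left[OF bounded_bilinear_matrix_vector_mult]
            differentiable_jacobian[OF cd]])
    moreover have "chart_deriv c X (\<lambda>q. jacobian c d q *v Y) p = chart_deriv c X (chart_deriv c Y (coords d)) p"
      by (rule chart_deriv_cong(2)[OF chart[OF cd(1)] open_chart_dom[OF cd(2)] p])
         (use cd in \<open>auto simp: jacobian_mult_vec\<close>)
    ultimately show ?thesis by simp
  qed
  then show ?thesis
    using second_chart_deriv_commute[OF chart[OF cd(1)] open_chart_dom[OF cd(2)] p smooth_coords[OF cd(1,2)]]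
    by simp
qed

end

section \<open>Linear connections\<close>

lemma matrix_eqI_inner:
  fixes A B :: "real ^ 'n ^ 'n"
  assumes "\<And>X Y. X \<bullet> (A *v Y) = X \<bullet> (B *v Y)"
  shows "A = B"
proof -
  have "A *v Y = B *v Y" for Y
    using assms[of "A *v Y - B *v Y" Y] inner_eq_zero_iff[of "A *v Y - B *v Y"]
    by (simp add: inner_diff_right)
  then show ?thesis by (simp add: matrix_eq)
qed

lemma symmetric_matrix_inner:
  fixes A :: "real ^ 'n ^ 'n"
  assumes "transpose A = A"
  shows "X \<bullet> (A *v Y) = Y \<bullet> (A *v X)"
  using inner_matrix_mult_transpose[of X A Y] assms by (simp add: inner_commute)

lemma skew_form_antisymmetric:
  fixes A :: "real ^ 'n ^ 'n"
  assumes "transpose A ** G = - (G ** A)" and "transpose G = G"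
  shows "X \<bullet> (G *v (A *v Y)) = - (Y \<bullet> (G *v (A *v X)))"
proof -
  have "Y \<bullet> ((transpose A ** G) *v X) = - (Y \<bullet> (G *v (A *v X)))"
    by (simp add: assms(1) matrix_vector_mult_neg matrix_vector_mul_assoc)
  also have "Y \<bullet> ((transpose A ** G) *v X) = (A *v Y) \<bullet> (G *v X)"
    unfolding matrix_vector_mul_assoc[symmetric] inner_matrix_mult_transpose[of Y "transpose A"]
    by simp
  also have "\<dots> = X \<bullet> (G *v (A *v Y))"
    by (rule symmetric_matrix_inner[OF assms(2)])
  finally show ?thesis .
qed

text \<open>A torsion-free connection is determined by the covariant derivative of a metric:
  for the difference \<open>D\<close> of two of them, \<open>G(D\<^sub>X Y, Z)\<close> is symmetric in \<open>X, Y\<close> and skew in \<open>Y, Z\<close>, and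
  such a tensor vanishes.\<close>

lemma torsion_free_metric_unique:
  fixes G :: "real ^ 4 ^ 4" and \<Gamma> \<Gamma>' :: "real ^ 4 \<Rightarrow> real ^ 4 ^ 4"
  assumes G: "transpose G = G" "invertible G"
    and tf: "\<And>X Y. \<Gamma> X *v Y = \<Gamma> Y *v X" "\<And>X Y. \<Gamma>' X *v Y = \<Gamma>' Y *v X"
    and met: "\<And>X. transpose (\<Gamma> X) ** G + G ** \<Gamma> X = transpose (\<Gamma>' X) ** G + G ** \<Gamma>' X"
  shows "\<Gamma> X = \<Gamma>' X"
proof -
  define D where "D X = \<Gamma> X - \<Gamma>' X" for X
  have sym: "D X *v Y = D Y *v X" for X Y
    using tf[of X Y] by (simp add: D_def matrix_vector_mult_diff_rdistrib)
  have "transpose (D X) ** G = - (G ** D X)" for X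
    using met[of X] by (simp add: D_def transpose_linear matrix_mult_distrib algebra_simps)
  note skew = skew_form_antisymmetric[OF this G(1)]
  have "Z \<bullet> (G *v (D X *v Y)) = 0" for X Y Z
    using skew[of Z X Y] skew[of X Y Z] skew[of Y Z X]
    by (simp add: sym[of X Y] sym[of X Z] sym[of Y Z])
  then have "Z \<bullet> ((G ** D X) *v Y) = Z \<bullet> (0 *v Y)" for X Y Z
    by (simp add: matrix_vector_mul_assoc)
  then have "G ** D X = 0" by (rule matrix_eqI_inner)
  then have "matrix_inv G ** G ** D X = 0" by (simp add: matrix_mul_assoc[symmetric])
  then show ?thesis by (simp add: invertible_matrix_inv[OF G(2)] D_def)
qed

context oriented_manifold
begin

lemma linear_connection_linear:
  "linear_connection \<A> \<Gamma> \<Longrightarrow> c \<in> \<A> \<Longrightarrow> p \<in> chart_dom c \<Longrightarrow> linear (\<Gamma> c p)"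
  by (simp add: linear_connection_def)

lemma linear_connection_smooth:
  "linear_connection \<A> \<Gamma> \<Longrightarrow> c \<in> \<A> \<Longrightarrow> smooth_in_chart c (chart_dom c) (\<lambda>p. \<Gamma> c p X)"
  by (simp add: linear_connection_def)

lemma linear_connection_differentiable:
  assumes "linear_connection \<A> \<Gamma>" "c \<in> \<A>" "p \<in> chart_dom c"
  shows "differentiable_in_chart c (\<lambda>p. \<Gamma> c p X) p"
  using assms
  by (intro smooth_in_chart_differentiable[OF chart open_chart_dom linear_connection_smooth]) auto

lemma curvature_skew: "curvature \<Gamma> c p X Y = - curvature \<Gamma> c p Y X"
  by (simp add: curvature_def)

lemma linear_curvature:
  assumes \<Gamma>: "linear_connection \<A> \<Gamma>" and c: "c \<in> \<A>" "p \<in> chart_dom c"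
  shows "linear (\<lambda>X. curvature \<Gamma> c p X Y)"
proof -
  have p: "p \<in> chart_dom c \<inter> chart_dom c" using c by auto
  note lin = linear_connection_linear[OF \<Gamma> c(1)]
  note d = linear_connection_differentiable[OF \<Gamma> c]
  have add: "chart_deriv c X (\<lambda>q. \<Gamma> c q (Y + Z)) p =
    chart_deriv c X (\<lambda>q. \<Gamma> c q Y) p + chart_deriv c X (\<lambda>q. \<Gamma> c q Z) p" for X Y Z
    unfolding chart_deriv_add(2)[OF d d, symmetric]
    by (rule chart_deriv_cong(2)[OF chart[OF c(1)] open_chart_dom[OF c(1)] p])
       (simp add: linear_add[OF lin])
  have scale: "chart_deriv c X (\<lambda>q. \<Gamma> c q (r *\<^sub>R Y)) p = r *\<^sub>R chart_deriv c X (\<lambda>q. \<Gamma> c q Y) p" for X Y r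
    unfolding bounded_linear.chart_deriv(2)[OF bounded_linear_scaleR_right d, symmetric]
    by (rule chart_deriv_cong(2)[OF chart[OF c(1)] open_chart_dom[OF c(1)] p])
       (simp add: linear_scale[OF lin])
  have 1: "linear (\<lambda>Y. curvature \<Gamma> c p X Y)" for X
    by (rule linearI) (simp_all add: curvature_def add scale linear_add[OF lin[OF c(2)]]
      linear_scale[OF lin[OF c(2)]] linear_add[OF linear_chart_deriv[OF d]]
      linear_scale[OF linear_chart_deriv[OF d]] matrix_mult_distrib algebra_simps)
  show "linear (\<lambda>X. curvature \<Gamma> c p X Y)"
    unfolding curvature_skew[of \<Gamma> c p _ Y] by (rule linear_compose_neg[OF 1])
qed

end

section \<open>The Levi-Civita connection\<close>

abbreviation eta :: "real ^ 4 ^ 4" where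
  "eta \<equiv> (\<chi> i j. if i = j then (if i = 1 \<or> i = 2 then 1 else - 1) else 0)"

lemma prod_4: "prod f (UNIV :: 4 set) = f 1 * f 2 * f 3 * f 4"
  for f :: "4 \<Rightarrow> 'a::comm_monoid_mult"
  unfolding UNIV_4 by (simp add: mult.assoc)

lemma det_eta: "det eta = 1"
proof -
  have "det eta = (\<Prod>i\<in>UNIV. eta $ i $ i)"
    by (rule det_diagonal) simp
  also have "\<dots> = eta $ 1 $ 1 * eta $ 2 $ 2 * eta $ 3 $ 3 * eta $ 4 $ 4"
    by (rule prod_4)
  also have "\<dots> = 1" by simp
  finally show ?thesis .
qed

lemma neutral_signature_invertible:
  assumes "neutral_signature G"
  shows "invertible G"
proof -
  obtain E :: "real ^ 4 ^ 4" where "transpose E ** G ** E = eta"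
    using assms by (auto simp: neutral_signature_def)
  then have "det (transpose E ** G ** E) = det eta" by (rule arg_cong)
  then show ?thesis unfolding det_eta det_mul invertible_det_nz by auto
qed

locale neutral_manifold = oriented_manifold \<A>
  for \<A> :: "'m::{t2_space, second_countable_topology} chart set" +
  fixes g :: "'m matrix_field"
  assumes metric: "neutral_metric \<A> g"
begin

lemma metric_signature: "c \<in> \<A> \<Longrightarrow> p \<in> chart_dom c \<Longrightarrow> neutral_signature (g c p)"
  using metric unfolding neutral_metric_def by blast

lemma metric_symmetric: "c \<in> \<A> \<Longrightarrow> p \<in> chart_dom c \<Longrightarrow> transpose (g c p) = g c p"
  using metric_signature by (simp add: neutral_signature_def)

lemma metric_invertible: "c \<in> \<A> \<Longrightarrow> p \<in> chart_dom c \<Longrightarrow> invertible (g c p)"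
  using metric_signature neutral_signature_invertible by blast

lemma metric_smooth: "c \<in> \<A> \<Longrightarrow> smooth_in_chart c (chart_dom c) (g c)"
  using metric unfolding neutral_metric_def by blast

lemma metric_change:
  "c \<in> \<A> \<Longrightarrow> d \<in> \<A> \<Longrightarrow> p \<in> chart_dom c \<Longrightarrow> p \<in> chart_dom d \<Longrightarrow>
    g c p = transpose (jacobian c d p) ** g d p ** jacobian c d p"
  using metric unfolding neutral_metric_def by blast

lemma metric_differentiable:
  assumes "c \<in> \<A>" "p \<in> chart_dom c" shows "differentiable_in_chart c (g c) p"
  using assms by (intro smooth_in_chart_differentiable[OF chart open_chart_dom metric_smooth]) auto

lemma metric_deriv_symmetric:
  assumes c: "c \<in> \<A>" "p \<in> chart_dom c"
  shows "transpose (chart_deriv c X (g c) p) = chart_deriv c X (g c) p"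
proof -
  have "chart_deriv c X (\<lambda>q. transpose (g c q)) p = transpose (chart_deriv c X (g c) p)"
    by (rule bounded_linear.chart_deriv(2)[OF bounded_linear_transpose metric_differentiable[OF c]])
  moreover have "chart_deriv c X (\<lambda>q. transpose (g c q)) p = chart_deriv c X (g c) p"
    by (rule chart_deriv_cong(2)[OF chart[OF c(1)] open_chart_dom[OF c(1)]])
       (use c metric_symmetric in auto)
  ultimately show ?thesis by simp
qed

lemma bounded_linear_inner_matrix: "bounded_linear (\<lambda>A :: real ^ 4 ^ 4. X \<bullet> (A *v Y))"
  by (rule bounded_linear_compose[OF bounded_linear_inner_right
        bounded_bilinear.bounded_linear_left[OF bounded_bilinear_matrix_vector_mult]])

lemma koszul_eq:
  assumes c: "c \<in> \<A>" "p \<in> chart_dom c"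
  shows "koszul g c p X Y Z = (Y \<bullet> (chart_deriv c X (g c) p *v Z) + X \<bullet> (chart_deriv c Y (g c) p *v Z)
    - X \<bullet> (chart_deriv c Z (g c) p *v Y)) / 2"
  unfolding koszul_def
  by (simp add: bounded_linear.chart_deriv(2)[OF bounded_linear_inner_matrix metric_differentiable[OF c]])

lemma linear_metric_deriv: "c \<in> \<A> \<Longrightarrow> p \<in> chart_dom c \<Longrightarrow> linear (\<lambda>X. chart_deriv c X (g c) p)"
  by (rule linear_chart_deriv[OF metric_differentiable])

lemma levi_civita_inner:
  assumes c: "c \<in> \<A>" "p \<in> chart_dom c"
  shows "Z \<bullet> (g c p *v (levi_civita g c p X *v Y)) = koszul g c p X Y Z"
proof -
  define K where "K = (\<chi> l j. koszul g c p X (axis j 1) (axis l 1))"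
  note lin = linear_metric_deriv[OF c]
  have bil: "bilinear (\<lambda>Z Y. koszul g c p X Y Z)"
    unfolding bilinear_def koszul_eq[OF c]
    by (auto intro!: linearI simp: linear_add[OF lin] linear_scale[OF lin] algebra_simps inner_add_left
       inner_add_right matrix_vector_mult_neg add_divide_distrib diff_divide_distrib)
  have "g c p *v (levi_civita g c p X *v Y) = K *v Y"
    by (simp add: levi_civita_def K_def matrix_vector_mul_assoc matrix_mul_assoc
      invertible_matrix_inv[OF metric_invertible[OF c]])
  then show ?thesis
    using bilinear_as_matrix[where x = Z and y = Y, OF bil] by (simp add: K_def)
qed

lemma levi_civita_torsion_free:
  assumes c: "c \<in> \<A>" "p \<in> chart_dom c"
  shows "levi_civita g c p X *v Y = levi_civita g c p Y *v X"
proof -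
  note sym = symmetric_matrix_inner[OF metric_deriv_symmetric[OF c]]
  have "Z \<bullet> (g c p *v (levi_civita g c p X *v Y)) = Z \<bullet> (g c p *v (levi_civita g c p Y *v X))" for Z
    unfolding levi_civita_inner[OF c] koszul_eq[OF c] using sym[of X Z Y] by simp
  then have "g c p *v (levi_civita g c p X *v Y) = g c p *v (levi_civita g c p Y *v X)"
    by (metis vector_eq_rdot inner_commute)
  then have "(matrix_inv (g c p) ** g c p) *v (levi_civita g c p X *v Y) =
      (matrix_inv (g c p) ** g c p) *v (levi_civita g c p Y *v X)"
    by (metis matrix_vector_mul_assoc)
  then show ?thesis
    by (simp add: invertible_matrix_inv[OF metric_invertible[OF c]])
qed

lemma levi_civita_metric:
  assumes c: "c \<in> \<A>" "p \<in> chart_dom c"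
  shows "transpose (levi_civita g c p X) ** g c p + g c p ** levi_civita g c p X = chart_deriv c X (g c) p"
proof (rule matrix_eqI_inner)
  fix Y Z
  let ?L = "levi_civita g c p X" and ?G = "g c p"
  note sym = symmetric_matrix_inner[OF metric_deriv_symmetric[OF c]]
  have "Y \<bullet> ((transpose ?L ** ?G + ?G ** ?L) *v Z) = (?L *v Y) \<bullet> (?G *v Z) + Y \<bullet> (?G *v (?L *v Z))"
    by (simp add: matrix_vector_mult_add_rdistrib inner_add_right matrix_vector_mul_assoc[symmetric]
        inner_matrix_mult_transpose[of Y "transpose ?L"] del: transpose_matrix_vector)
  also have "(?L *v Y) \<bullet> (?G *v Z) = Z \<bullet> (?G *v (?L *v Y))"
    by (rule symmetric_matrix_inner[OF metric_symmetric[OF c]])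
  finally show "Y \<bullet> ((transpose ?L ** ?G + ?G ** ?L) *v Z) = Y \<bullet> (chart_deriv c X (g c) p *v Z)"
    unfolding levi_civita_inner[OF c] koszul_eq[OF c] using sym[of Z X Y] by (simp add: field_simps)
qed

lemma linear_levi_civita:
  assumes c: "c \<in> \<A>" "p \<in> chart_dom c"
  shows "linear (levi_civita g c p)"
proof (rule linearI)
  note tf = levi_civita_torsion_free[OF c]
  show "levi_civita g c p (X + Y) = levi_civita g c p X + levi_civita g c p Y" for X Y
    by (simp add: matrix_eq tf[of "X + Y"] tf[of X] tf[of Y] algebra_simps)
  show "levi_civita g c p (r *\<^sub>R X) = r *\<^sub>R levi_civita g c p X" for r X
    by (simp add: matrix_eq tf[of "r *\<^sub>R X"] tf[of X] matrix_vector_mult_neg algebra_simps)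
qed

lemma smooth_levi_civita:
  assumes c: "c \<in> \<A>"
  shows "smooth_in_chart c (chart_dom c) (\<lambda>p. levi_civita g c p X)"
proof -
  note cU = chart[OF c] open_chart_dom[OF c]
  have s: "smooth_in_chart c (chart_dom c) (\<lambda>q. Y \<bullet> (g c q *v Z))" for Y Z
    by (rule smooth_in_chart_linear[OF cU bounded_linear_inner_matrix metric_smooth[OF c]])
  show ?thesis
    unfolding levi_civita_def koszul_def divide_inverse
    by (intro smooth_in_chart_bilinear[OF cU bounded_bilinear_matrix_mult]
        smooth_in_chart_matrix_inv[OF cU] metric_smooth[OF c] smooth_in_chart_vec[OF cU]
        smooth_in_chart_mult[OF cU] smooth_in_chart_add[OF cU]
        smooth_in_chart_diff[OF cU] smooth_in_chart_deriv[OF cU] smooth_in_chart_const s metric_invertible[OF c]) auto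
qed

text \<open>The transformation law: pulling back the connection form from the chart \<open>d\<close> gives a
  torsion-free connection form for the pulled back metric, so that uniqueness applies.\<close>

lemma levi_civita_change:
  assumes cd: "c \<in> \<A>" "d \<in> \<A>" "p \<in> chart_dom c" "p \<in> chart_dom d"
  shows "jacobian c d p ** levi_civita g c p X =
        levi_civita g d p (jacobian c d p *v X) ** jacobian c d p + chart_deriv c X (jacobian c d) p"
proof -
  note c = cd(1,3) and d = cd(2,4)
  define Q where "Q = jacobian c d p"
  define dQ where "dQ X = chart_deriv c X (jacobian c d) p" for X
  define L where "L X = levi_civita g d p (Q *v X)" for X
  define \<Gamma> where "\<Gamma> X = matrix_inv Q ** (L X ** Q + dQ X)" for X
  have Q: "Q ** \<Gamma> X = L X ** Q + dQ X" for X
    by (simp add: \<Gamma>_def matrix_mul_assoc invertible_matrix_inv[OF invertible_jacobian(1)[OF cd], folded Q_def])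
  have tf: "\<Gamma> X *v Y = \<Gamma> Y *v X" for X Y
  proof -
    have "L X *v (Q *v Y) = L Y *v (Q *v X)"
      unfolding L_def by (rule levi_civita_torsion_free[OF d])
    moreover have "dQ X *v Y = dQ Y *v X"
      unfolding dQ_def by (rule jacobian_deriv_symmetric[OF cd])
    ultimately show ?thesis
      by (simp add: \<Gamma>_def matrix_vector_mul_assoc[symmetric] matrix_vector_mult_add_rdistrib)
  qed
  have met: "transpose (\<Gamma> X) ** g c p + g c p ** \<Gamma> X = chart_deriv c X (g c) p" for X
  proof -
    note gd = chart_deriv_change[OF cd metric_differentiable[OF d], folded Q_def]
    note J = differentiable_jacobian[OF cd]
    note pr = bounded_bilinear.chart_deriv[OF bounded_bilinear_matrix_mult chart[OF cd(1)] cd(3)]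
    note tr = bounded_linear.chart_deriv[OF bounded_linear_transpose]
    have "chart_deriv c X (g c) p = chart_deriv c X (\<lambda>q. transpose (jacobian c d q) ** g d q ** jacobian c d q) p"
      by (rule chart_deriv_cong(2)[OF chart[OF cd(1)] open_chart_dom[OF cd(2)]])
         (use cd in \<open>auto intro!: metric_change\<close>)
    also have "\<dots> = transpose Q ** g d p ** dQ X +
      (transpose Q ** chart_deriv d (Q *v X) (g d) p + transpose (dQ X) ** g d p) ** Q"
      by (simp add: pr(2)[OF pr(1)[OF tr(1)[OF J] gd(1)] J] pr(2)[OF tr(1)[OF J] gd(1)]
          tr(2)[OF J] gd(2) Q_def dQ_def)
    also have "\<dots> = transpose Q ** g d p ** (L X ** Q + dQ X) +
        transpose (L X ** Q + dQ X) ** g d p ** Q"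
      by (simp add: levi_civita_metric[OF d, symmetric] L_def matrix_mult_distrib matrix_mul_assoc
          matrix_transpose_mul transpose_linear)
    also have "\<dots> = transpose (\<Gamma> X) ** g c p + g c p ** \<Gamma> X"
      by (simp add: Q[symmetric] metric_change[OF cd, folded Q_def] matrix_transpose_mul matrix_mul_assoc)
    finally show ?thesis by simp
  qed
  have "\<Gamma> X = levi_civita g c p X"
    by (rule torsion_free_metric_unique[OF metric_symmetric[OF c] metric_invertible[OF c] tf
          levi_civita_torsion_free[OF c]]) (simp only: met levi_civita_metric[OF c])
  with Q[of X] show ?thesis by (simp add: Q_def L_def dQ_def)
qed

lemma linear_connection_levi_civita: "linear_connection \<A> (levi_civita g)"
  unfolding linear_connection_def
  using linear_levi_civita smooth_levi_civita levi_civita_change by auto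

subsection \<open>Symmetries of the curvature tensor\<close>

text \<open>The derivatives of the connection form cancel in the cyclic sum because \<open>\<Gamma>\<^sub>X Y\<close> is symmetric in
  \<open>X\<close> and \<open>Y\<close>, and the quadratic terms cancel for the same reason.\<close>

lemma levi_civita_curvature_bianchi:
  assumes c: "c \<in> \<A>" "p \<in> chart_dom c"
  shows "curvature (levi_civita g) c p X Y *v Z + curvature (levi_civita g) c p Y Z *v X
    + curvature (levi_civita g) c p Z X *v Y = 0"
proof -
  let ?L = "levi_civita g"
  note diff = linear_connection_differentiable[OF linear_connection_levi_civita c]
  note tf = levi_civita_torsion_free[OF c]
  have "chart_deriv c X (\<lambda>q. ?L c q Y) p *v Z = chart_deriv c X (\<lambda>q. ?L c q Z) p *v Y" for X Y Z
    unfolding bounded_linear.chart_deriv(2)[OF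
            bounded_bilinear.bounded_linear_left[OF bounded_bilinear_matrix_vector_mult] diff, symmetric]
    by (rule chart_deriv_cong(2)[OF chart[OF c(1)] open_chart_dom[OF c(1)]])
       (use c levi_civita_torsion_free in auto)
  note 1 = this[of X Y Z] this[of Y Z X] this[of Z X Y]
  show ?thesis
    by (simp add: curvature_def matrix_vector_mult_diff_rdistrib matrix_vector_mult_add_rdistrib
        matrix_vector_mul_assoc[symmetric] 1 tf[of X Y] tf[of Y Z] tf[of X Z])
qed

text \<open>The equation \<open>\<nabla>g = 0\<close> expresses the first derivatives of the metric by the connection form. The second
  derivatives of the metric commute, and the difference of the resulting expressions for the two
  orders is the action of the curvature on \<open>g\<close>.\<close>

lemma levi_civita_curvature_skew_endo:
  assumes c: "c \<in> \<A>" "p \<in> chart_dom c"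
  shows "transpose (curvature (levi_civita g) c p X Y) ** g c p =
    - (g c p ** curvature (levi_civita g) c p X Y)"
proof -
  let ?L = "levi_civita g" and ?G = "g c p"
  note diff = linear_connection_differentiable[OF linear_connection_levi_civita c]
  note met = levi_civita_metric[OF c, symmetric]
  note pr = bounded_bilinear.chart_deriv[OF bounded_bilinear_matrix_mult chart[OF c(1)] c(2)]
  note tr = bounded_linear.chart_deriv[OF bounded_linear_transpose]
  note dg = metric_differentiable[OF c]
  have "chart_deriv c X (chart_deriv c Y (g c)) p =
     transpose (?L c p Y) ** chart_deriv c X (g c) p + transpose (chart_deriv c X (\<lambda>q. ?L c q Y) p) ** ?G
     + (?G ** chart_deriv c X (\<lambda>q. ?L c q Y) p + chart_deriv c X (g c) p ** ?L c p Y)" for X Y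
  proof -
    have "chart_deriv c X (chart_deriv c Y (g c)) p =
      chart_deriv c X (\<lambda>q. transpose (?L c q Y) ** g c q + g c q ** ?L c q Y) p"
      by (rule chart_deriv_cong(2)[OF chart[OF c(1)] open_chart_dom[OF c(1)]])
         (use c levi_civita_metric in auto)
    then show ?thesis
      by (simp add: chart_deriv_add[OF pr(1)[OF tr(1)[OF diff] dg] pr(1)[OF dg diff]]
        pr(2)[OF tr(1)[OF diff] dg] pr(2)[OF dg diff] tr(2)[OF diff])
  qed
  note 2 = this[of X Y] this[of Y X]
  have "chart_deriv c X (chart_deriv c Y (g c)) p = chart_deriv c Y (chart_deriv c X (g c)) p"
    using second_chart_deriv_commute[OF chart[OF c(1)] open_chart_dom[OF c(1)] _ metric_smooth[OF c(1)]] c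
    by auto
  then show ?thesis
    unfolding 2
    by (simp add: curvature_def met transpose_linear matrix_transpose_mul matrix_mult_distrib
      matrix_mul_assoc algebra_simps)
qed

end

section \<open>Para-quaternionic linear algebra\<close>

locale pq_triple =
  fixes J1 J2 J3 :: "real ^ 4 ^ 4"
  assumes J11: "J1 ** J1 = mat 1" and J22: "J2 ** J2 = mat 1" and J33: "J3 ** J3 = - mat 1"
    and J12: "J1 ** J2 = J3" and J21: "J2 ** J1 = - J3"
begin

lemma J13: "J1 ** J3 = J2" and J31: "J3 ** J1 = - J2"
  and J23: "J2 ** J3 = - J1" and J32: "J3 ** J2 = J1"
proof -
  have "J1 ** (J1 ** J2) = J2" by (simp add: matrix_mul_assoc J11)
  then show "J1 ** J3 = J2" by (simp add: J12)
  have "(J2 ** J1) ** J1 = J2" by (simp add: matrix_mul_assoc[symmetric] J11)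
  then show "J3 ** J1 = - J2" by (simp add: J21 matrix_mult_distrib) (metis minus_minus)
  have "J2 ** (J2 ** J1) = J1" by (simp add: matrix_mul_assoc J22)
  then show "J2 ** J3 = - J1" by (simp add: J21 matrix_mult_distrib) (metis minus_minus)
  have "(J1 ** J2) ** J2 = J1" by (simp add: matrix_mul_assoc[symmetric] J22)
  then show "J3 ** J2 = J1" by (simp add: J12)
qed

lemmas J_mult = J11 J22 J33 J12 J21 J13 J31 J23 J32

lemma J_vec:
  "J1 *v (J1 *v X) = X" "J2 *v (J2 *v X) = X" "J3 *v (J3 *v X) = - X"
  "J1 *v (J2 *v X) = J3 *v X" "J2 *v (J1 *v X) = - (J3 *v X)"
  "J1 *v (J3 *v X) = J2 *v X" "J3 *v (J1 *v X) = - (J2 *v X)"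
  "J2 *v (J3 *v X) = - (J1 *v X)" "J3 *v (J2 *v X) = J1 *v X"
  by (simp_all add: matrix_vector_mul_assoc J_mult matrix_vector_mult_neg)

lemma trace_J: "trace J1 = 0" "trace J2 = 0" "trace J3 = 0"
  using trace_mul_sym[of J2 J3] trace_mul_sym[of J1 J3] trace_mul_sym[of J1 J2]
  by (simp_all add: J_mult trace_linear)

lemma in_span_J: "A \<in> span {J1, J2, J3} \<longleftrightarrow> (\<exists>x y z. A = x *\<^sub>R J1 + y *\<^sub>R J2 + z *\<^sub>R J3)"
  by (auto simp: span_breakdown_eq algebra_simps)

text \<open>The condition on the Ricci forms for the three cyclic permutations, stated for the traces
  \<open>t a\<close> of \<open>J\<^sub>a R\<close>; the factors \<open>\<epsilon>\<^sub>a / 2\<close> by which these differ from the Ricci forms change the signs.\<close>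

definition ricci_identity ::
    "(nat \<Rightarrow> real ^ 4 \<Rightarrow> real ^ 4 \<Rightarrow> real) \<Rightarrow> bool" where
  "ricci_identity t \<longleftrightarrow> (\<forall>X Y.
     t 1 (J2 *v X) (J2 *v Y) + t 1 X Y - (t 3 (J2 *v X) Y + t 3 X (J2 *v Y)) = 0 \<and>
     t 2 (J3 *v X) (J3 *v Y) - t 2 X Y + (t 1 (J3 *v X) Y + t 1 X (J3 *v Y)) = 0 \<and>
     t 3 (J1 *v X) (J1 *v Y) + t 3 X Y + (t 2 (J1 *v X) Y + t 2 X (J1 *v Y)) = 0)"

definition J :: "nat \<Rightarrow> real ^ 4 ^ 4" where
  "J a = (if a = 1 then J1 else if a = 2 then J2 else J3)"

lemma J_simps [simp]: "J 1 = J1" "J (Suc 0) = J1" "J 2 = J2" "J 3 = J3"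
  by (auto simp: J_def)

lemma ricci_identity_cong:
  assumes "\<And>a X Y. a \<in> {1, 2, 3} \<Longrightarrow> s a X Y = t a X Y"
  shows "ricci_identity s \<longleftrightarrow> ricci_identity t"
  unfolding ricci_identity_def by (simp add: assms)

lemma ricci_identity_add_iff:
  assumes "ricci_identity s"
  shows "ricci_identity (\<lambda>a X Y. t a X Y + s a X Y) \<longleftrightarrow> ricci_identity t"
proof -
  have "s 1 (J2 *v X) (J2 *v Y) + s 1 X Y - (s 3 (J2 *v X) Y + s 3 X (J2 *v Y)) = 0"
     "s 2 (J3 *v X) (J3 *v Y) - s 2 X Y + (s 1 (J3 *v X) Y + s 1 X (J3 *v Y)) = 0"
     "s 3 (J1 *v X) (J1 *v Y) + s 3 X Y + (s 2 (J1 *v X) Y + s 2 X (J1 *v Y)) = 0" for X Y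
    using assms unfolding ricci_identity_def by blast+
  note s = this
  have "(t 1 (J2 *v X) (J2 *v Y) + s 1 (J2 *v X) (J2 *v Y) + (t 1 X Y + s 1 X Y) -
          (t 3 (J2 *v X) Y + s 3 (J2 *v X) Y + (t 3 X (J2 *v Y) + s 3 X (J2 *v Y))) = 0) =
        (t 1 (J2 *v X) (J2 *v Y) + t 1 X Y - (t 3 (J2 *v X) Y + t 3 X (J2 *v Y)) = 0)"
       "(t 2 (J3 *v X) (J3 *v Y) + s 2 (J3 *v X) (J3 *v Y) - (t 2 X Y + s 2 X Y) +
          (t 1 (J3 *v X) Y + s 1 (J3 *v X) Y + (t 1 X (J3 *v Y) + s 1 X (J3 *v Y))) = 0) =
        (t 2 (J3 *v X) (J3 *v Y) - t 2 X Y + (t 1 (J3 *v X) Y + t 1 X (J3 *v Y)) = 0)"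
       "(t 3 (J1 *v X) (J1 *v Y) + s 3 (J1 *v X) (J1 *v Y) + (t 3 X Y + s 3 X Y) +
          (t 2 (J1 *v X) Y + s 2 (J1 *v X) Y + (t 2 X (J1 *v Y) + s 2 X (J1 *v Y))) = 0) =
        (t 3 (J1 *v X) (J1 *v Y) + t 3 X Y + (t 2 (J1 *v X) Y + t 2 X (J1 *v Y)) = 0)" for X Y
    using s[of X Y] by linarith+
  then show ?thesis unfolding ricci_identity_def by presburger
qed

text \<open>The products \<open>J\<^sub>a J\<^sub>b = \<plusminus> J\<^sub>c\<close> make the terms of each of the three equations cancel in pairs.\<close>

lemma ricci_identity_bilinear:
  assumes "bilinear b"
  shows "ricci_identity (\<lambda>a X Y. b X (J a *v Y) - b Y (J a *v X))"
  unfolding ricci_identity_def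
  by (simp add: J_vec bilinear_lneg[OF assms] bilinear_rneg[OF assms])

text \<open>The contribution of \<open>[S\<^sub>X, S\<^sub>Y]\<close> to the curvature of a changed connection, when the component of \<open>S\<^sub>X\<close>
  in the span is determined by the one-form \<open>f\<close>: it is a combination of products \<open>f(J\<^sub>b X) f(J\<^sub>c Y)\<close>
  that are permuted, up to sign, under the substitutions in the Ricci identity.\<close>

lemma ricci_identity_quadratic:
  assumes "linear f"
    and S: "\<And>a X. a \<in> {1, 2, 3} \<Longrightarrow> J a ** S X - S X ** J a =
      (f (J1 *v X) / 4) *\<^sub>R (J a ** J1 - J1 ** J a) + (f (J2 *v X) / 4) *\<^sub>R (J a ** J2 - J2 ** J a)
      - (f (J3 *v X) / 4) *\<^sub>R (J a ** J3 - J3 ** J a)"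
  shows "ricci_identity (\<lambda>a X Y. f ((J a ** S X - S X ** J a) *v Y))"
proof -
  have 1: "J1 ** S X - S X ** J1 = (f (J2 *v X) / 2) *\<^sub>R J3 - (f (J3 *v X) / 2) *\<^sub>R J2" for X
    using S[of 1 X] by (simp add: J_mult vec_eq_iff field_simps)
  have 2: "J2 ** S X - S X ** J2 = - (f (J1 *v X) / 2) *\<^sub>R J3 + (f (J3 *v X) / 2) *\<^sub>R J1" for X
    using S[of 2 X] by (simp add: J_mult vec_eq_iff field_simps)
  have 3: "J3 ** S X - S X ** J3 = - (f (J1 *v X) / 2) *\<^sub>R J2 + (f (J2 *v X) / 2) *\<^sub>R J1" for X
    using S[of 3 X] by (simp add: J_mult vec_eq_iff field_simps)
  show ?thesis
    unfolding ricci_identity_def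
    by (simp add: 1 2 3 J_vec linear_neg[OF assms(1)] linear_add[OF assms(1)] linear_diff[OF assms(1)]
       linear_scale[OF assms(1)] matrix_vector_mult_neg
       matrix_vector_mult_add_rdistrib matrix_vector_mult_diff_rdistrib algebra_simps)
qed

text \<open>An endomorphism that normalises the span of the \<open>J\<^sub>a\<close> differs from its
  component in the span, computed by traces, by an endomorphism that commutes with all \<open>J\<^sub>a\<close>.\<close>

definition pq_part :: "real ^ 4 ^ 4 \<Rightarrow> real ^ 4 ^ 4" where
  "pq_part M = (trace (J1 ** M) / 4) *\<^sub>R J1 + (trace (J2 ** M) / 4) *\<^sub>R J2 - (trace (J3 ** M) / 4) *\<^sub>R J3"

lemma trace_J_pq_part:
  "trace (J1 ** pq_part M) = trace (J1 ** M)"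
  "trace (J2 ** pq_part M) = trace (J2 ** M)"
  "trace (J3 ** pq_part M) = trace (J3 ** M)"
  by (simp_all add: pq_part_def matrix_mult_distrib J_mult trace_add trace_linear trace_J trace_sub trace_I)

lemma span_zeroI:
  assumes "A \<in> span {J1, J2, J3}" "trace (J1 ** A) = 0" "trace (J2 ** A) = 0" "trace (J3 ** A) = 0"
  shows "A = 0"
proof -
  obtain x y z where A: "A = x *\<^sub>R J1 + y *\<^sub>R J2 + z *\<^sub>R J3"
    using assms(1) in_span_J by blast
  show ?thesis
    using assms(2-4) by (simp add: A matrix_mult_distrib J_mult trace_add trace_sub trace_linear trace_J trace_I)
qed

lemma pq_part_span:
  assumes "A \<in> span {J1, J2, J3}" shows "pq_part A = A"
proof -
  obtain x y z where A: "A = x *\<^sub>R J1 + y *\<^sub>R J2 + z *\<^sub>R J3"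
    using assms in_span_J by blast
  show ?thesis
    by (simp add: A pq_part_def matrix_mult_distrib J_mult trace_add trace_sub trace_linear trace_J trace_I)
qed

lemma commutator_in_span:
  assumes "A \<in> span {J1, J2, J3}" "B \<in> span {J1, J2, J3}"
  shows "A ** B - B ** A \<in> span {J1, J2, J3}"
proof -
  obtain x y z where A: "A = x *\<^sub>R J1 + y *\<^sub>R J2 + z *\<^sub>R J3"
    using assms(1) in_span_J by blast
  obtain x' y' z' where B: "B = x' *\<^sub>R J1 + y' *\<^sub>R J2 + z' *\<^sub>R J3"
    using assms(2) in_span_J by blast
  have "A ** B - B ** A = (2 * (z * y' - y * z')) *\<^sub>R J1 + (2 * (x * z' - z * x')) *\<^sub>R J2
      + (2 * (x * y' - y * x')) *\<^sub>R J3"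
    unfolding A B by (simp add: matrix_mult_distrib J_mult vec_eq_iff algebra_simps)
  then show ?thesis using in_span_J by blast
qed

lemma pq_part_in_span: "pq_part M \<in> span {J1, J2, J3}"
  unfolding pq_part_def in_span_J
  by (intro exI[of _ "trace (J1 ** M) / 4"] exI[of _ "trace (J2 ** M) / 4"] exI[of _ "- (trace (J3 ** M) / 4)"]) simp

lemma J_in_span: "a \<in> {1,2,3} \<Longrightarrow> J a \<in> span {J1, J2, J3}"
  by (auto intro: span_base)

lemma commutator_pq_part:
  assumes "J a ** M - M ** J a \<in> span {J1, J2, J3}" and a: "a \<in> {1,2,3}"
  shows "J a ** M - M ** J a = J a ** pq_part M - pq_part M ** J a"
proof -
  define N where "N = M - pq_part M"
  have N: "trace (J1 ** N) = 0" "trace (J2 ** N) = 0" "trace (J3 ** N) = 0"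
    by (simp_all add: N_def matrix_mult_distrib trace_sub trace_J_pq_part)
  have "J a ** N - N ** J a = (J a ** M - M ** J a) - (J a ** pq_part M - pq_part M ** J a)"
    by (simp add: N_def matrix_mult_distrib)
  then have "J a ** N - N ** J a \<in> span {J1, J2, J3}"
    using span_diff[OF assms(1) commutator_in_span[OF J_in_span[OF a] pq_part_in_span]] by simp
  moreover have "trace (J b ** (J a ** N - N ** J a)) = 0" if b: "b \<in> {1,2,3}" for b
  proof -
    have "trace (J b ** (J a ** N - N ** J a)) = trace (J b ** J a ** N) - trace (J b ** (N ** J a))"
      by (simp add: matrix_mult_distrib trace_sub matrix_mul_assoc)
    also have "trace (J b ** (N ** J a)) = trace (J a ** J b ** N)"
      using trace_mul_sym[of "J b ** N" "J a"] by (simp add: matrix_mul_assoc)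
    finally show ?thesis
      using a b N by (auto simp: J_mult matrix_mult_distrib trace_linear)
  qed
  from this[of 1] this[of 2] this[of 3]
  have "trace (J1 ** (J a ** N - N ** J a)) = 0" "trace (J2 ** (J a ** N - N ** J a)) = 0"
    "trace (J3 ** (J a ** N - N ** J a)) = 0" by auto
  ultimately have "J a ** N - N ** J a = 0" by (rule span_zeroI)
  then show ?thesis by (simp add: N_def matrix_mult_distrib algebra_simps)
qed

end

subsection \<open>Compatible metrics and the torsion condition\<close>

locale pq_metric = pq_triple +
  fixes G :: "real ^ 4 ^ 4"
  assumes G_sym: "transpose G = G" and G_inv: "invertible G"
    and J1_skew: "transpose J1 ** G = - (G ** J1)" and J2_skew: "transpose J2 ** G = - (G ** J2)"
    and J3_skew: "transpose J3 ** G = - (G ** J3)"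
begin

lemma skew_inner:
  assumes "transpose A ** G = - (G ** A)"
  shows "(A *v X) \<bullet> (G *v Y) = - (X \<bullet> (G *v (A *v Y)))"
  using skew_form_antisymmetric[OF assms G_sym, of X Y] symmetric_matrix_inner[OF G_sym, of "A *v X" Y]
  by simp

lemmas J_inner = skew_inner[OF J1_skew] skew_inner[OF J2_skew] skew_inner[OF J3_skew]

lemma skew_inner_self:
  assumes "transpose A ** G = - (G ** A)"
  shows "X \<bullet> (G *v (A *v X)) = 0"
  using skew_form_antisymmetric[OF assms G_sym, of X X] by simp

lemmas J_inner_self = skew_inner_self[OF J1_skew] skew_inner_self[OF J2_skew] skew_inner_self[OF J3_skew]

lemma exists_unit_vector: "\<exists>v. v \<bullet> (G *v v) = 1"
proof -
  have "\<exists>v. v \<bullet> (G *v v) \<noteq> 0"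
  proof (rule ccontr)
    assume "\<not> ?thesis"
    then have z: "v \<bullet> (G *v v) = 0" for v by blast
    have "X \<bullet> (G *v Y) = X \<bullet> (0 *v Y)" for X Y
      using z[of "X + Y"] z[of X] z[of Y] symmetric_matrix_inner[OF G_sym, of X Y]
      by (simp add: algebra_simps inner_add_left inner_add_right)
    then have "G = 0" by (rule matrix_eqI_inner)
    with G_inv invertible_matrix_inv(1)[of G] have "mat 1 = (0 :: real ^ 4 ^ 4)" by simp
    then have "trace (mat 1 :: real ^ 4 ^ 4) = trace (0 :: real ^ 4 ^ 4)" by (rule arg_cong)
    then show False by (simp add: trace_I) (simp add: trace_def)
  qed
  then obtain v where v: "v \<bullet> (G *v v) \<noteq> 0" by blast
  \<comment> \<open>\<open>J1\<close> is an anti-isometry, so one of \<open>v\<close> and \<open>J1 v\<close> is positive\<close>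
  have "(J1 *v v) \<bullet> (G *v (J1 *v v)) = - (v \<bullet> (G *v v))"
    by (simp add: J_inner J_vec)
  with v have "v \<bullet> (G *v v) > 0 \<or> (J1 *v v) \<bullet> (G *v (J1 *v v)) > 0" by linarith
  then obtain w where w: "w \<bullet> (G *v w) > 0" by blast
  have "((1 / sqrt (w \<bullet> (G *v w))) *\<^sub>R w) \<bullet> (G *v ((1 / sqrt (w \<bullet> (G *v w))) *\<^sub>R w)) = 1"
    using w by (simp add: matrix_vector_mult_scaleR power2_eq_square[symmetric])
  then show ?thesis by blast
qed

text \<open>The order matters: \<open>J\<^sub>3\<close> is an isometry and \<open>J\<^sub>1, J\<^sub>2\<close> are anti-isometries, so that for a unit vector
  \<open>v\<close> the Gram matrix of this frame is \<open>eta\<close>.\<close>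

definition frame :: "real ^ 4 \<Rightarrow> real ^ 4 ^ 4" where
  "frame v = transpose (vector [v, J3 *v v, J1 *v v, J2 *v v])"

lemma frame_axis:
  "frame v *v axis 1 1 = v" "frame v *v axis 2 1 = J3 *v v"
  "frame v *v axis 3 1 = J1 *v v" "frame v *v axis 4 1 = J2 *v v"
  by (simp_all add: frame_def matrix_vector_mult_basis column_def transpose_def vec_eq_iff vector_def)

lemma frame_orthonormal:
  assumes "v \<bullet> (G *v v) = 1"
  shows "transpose (frame v) ** G ** frame v = eta"
proof -
  have "\<forall>i j. (frame v *v axis i 1) \<bullet> (G *v (frame v *v axis j 1)) = eta $ i $ j"
    unfolding forall_4 frame_axis by (simp add: J_inner J_vec J_inner_self matrix_vector_mult_neg assms)
  then show ?thesis unfolding bilinear_entry[symmetric] vec_eq_iff .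
qed

lemma frame_invertible:
  assumes "v \<bullet> (G *v v) = 1"
  shows "invertible (frame v)"
proof -
  have "det (transpose (frame v) ** G ** frame v) = det eta"
    by (rule arg_cong[OF frame_orthonormal[OF assms]])
  then show ?thesis unfolding det_eta det_mul invertible_det_nz by auto
qed

lemma frame_expansion:
  assumes "v \<bullet> (G *v v) = 1"
  obtains a b c d where "X = a *\<^sub>R v + b *\<^sub>R (J3 *v v) + c *\<^sub>R (J1 *v v) + d *\<^sub>R (J2 *v v)"
proof -
  define y where "y = matrix_inv (frame v) *v X"
  have "X = frame v *v y"
    by (simp add: y_def matrix_vector_mul_assoc invertible_matrix_inv[OF frame_invertible[OF assms]])
  also have "\<dots> = frame v *v (\<Sum>i\<in>UNIV. (y $ i) *\<^sub>R axis i 1)" by (simp only: axis_expansion)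
  also have "\<dots> = (y $ 1) *\<^sub>R v + (y $ 2) *\<^sub>R (J3 *v v) + (y $ 3) *\<^sub>R (J1 *v v) + (y $ 4) *\<^sub>R (J2 *v v)"
    unfolding sum_4 matrix_vector_right_distrib matrix_vector_mult_scaleR frame_axis ..
  finally show ?thesis by (rule that)
qed

lemma frame_independent:
  assumes v: "v \<bullet> (G *v v) = 1"
    and z: "a *\<^sub>R v + b *\<^sub>R (J3 *v v) + c *\<^sub>R (J1 *v v) + d *\<^sub>R (J2 *v v) = 0"
  shows "a = 0 \<and> b = 0 \<and> c = 0 \<and> d = 0"
proof -
  let ?w = "a *\<^sub>R v + b *\<^sub>R (J3 *v v) + c *\<^sub>R (J1 *v v) + d *\<^sub>R (J2 *v v)"
  have "v \<bullet> (G *v ?w) = 0" "(J3 *v v) \<bullet> (G *v ?w) = 0" "(J1 *v v) \<bullet> (G *v ?w) = 0" "(J2 *v v) \<bullet> (G *v ?w) = 0"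
    unfolding z by simp_all
  then show ?thesis
    by (simp add: matrix_vector_right_distrib matrix_vector_mult_scaleR inner_add_right J_inner J_vec
        J_inner_self v matrix_vector_mult_neg)
qed

text \<open>The part of \<open>S\<close> that commutes with \<open>J\<^sub>1\<close> cancels in the \<open>(0,2)\<close>-part of the torsion. What is left says
  that \<open>h(X) J\<^sub>2 Y - h(J\<^sub>1 X) J\<^sub>3 Y\<close> is symmetric in \<open>X\<close> and \<open>Y\<close>, where \<open>h\<close> is the one-form below. For
  \<open>X = v\<close> and \<open>Y = J\<^sub>2 v\<close> this is a linear relation between the vectors of the frame of \<open>v\<close>, whose
  coefficients are the values of \<open>h\<close> on that frame.\<close>

lemma part02_vanishes_J1:
  fixes S :: "real ^ 4 \<Rightarrow> real ^ 4 ^ 4"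
  assumes S: "linear S"
    and norm: "\<And>a X. a \<in> {1, 2, 3} \<Longrightarrow> J a ** S X - S X ** J a \<in> span {J1, J2, J3}"
    and T: "\<And>X Y. part02 1 J1 (\<lambda>X Y. S X *v Y - S Y *v X) X Y = 0"
  shows "trace (J2 ** S X) = - trace (J3 ** S (J1 *v X))"
proof -
  define h where "h X = (trace (J2 ** S X) + trace (J3 ** S (J1 *v X))) / 2" for X
  have comm: "J1 ** S X = S X ** J1 + (J1 ** pq_part (S X) - pq_part (S X) ** J1)" for X
    using commutator_pq_part[OF norm[of 1 X]] by (simp add: algebra_simps)
  have comm': "J1 *v (S X *v Y) = S X *v (J1 *v Y) + (trace (J2 ** S X) / 2) *\<^sub>R (J3 *v Y)
     - (trace (J3 ** S X) / 2) *\<^sub>R (J2 *v Y)" for X Y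
  proof -
    have c: "J1 ** pq_part (S X) - pq_part (S X) ** J1 =
        (trace (J2 ** S X) / 2) *\<^sub>R J3 - (trace (J3 ** S X) / 2) *\<^sub>R J2"
      by (simp add: pq_part_def matrix_mult_distrib J_mult vec_eq_iff field_simps)
    then show ?thesis
      unfolding matrix_vector_mul_assoc comm c by (simp add: algebra_simps matrix_vector_mult_neg)
  qed
  have lin: "linear h"
    unfolding h_def by (auto intro!: linearI simp: linear_add[OF S] linear_scale[OF S]
      matrix_vector_right_distrib matrix_vector_mult_scaleR matrix_mult_distrib trace_add trace_linear
      algebra_simps add_divide_distrib)
  have key: "h X *\<^sub>R (J2 *v Y) - h (J1 *v X) *\<^sub>R (J3 *v Y) = h Y *\<^sub>R (J2 *v X) - h (J1 *v Y) *\<^sub>R (J3 *v X)" for X Y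
  proof -
    have "(S X *v Y - S Y *v X) + (S (J1 *v X) *v (J1 *v Y) - S (J1 *v Y) *v (J1 *v X))
      - J1 *v (S (J1 *v X) *v Y - S Y *v (J1 *v X)) - J1 *v (S X *v (J1 *v Y) - S (J1 *v Y) *v X) = 0"
      using T[of X Y] by (simp add: part02_def)
    moreover have "(S X *v Y - S Y *v X) + (S (J1 *v X) *v (J1 *v Y) - S (J1 *v Y) *v (J1 *v X))
      - J1 *v (S (J1 *v X) *v Y - S Y *v (J1 *v X)) - J1 *v (S X *v (J1 *v Y) - S (J1 *v Y) *v X)
      = h X *\<^sub>R (J2 *v Y) - h (J1 *v X) *\<^sub>R (J3 *v Y) - (h Y *\<^sub>R (J2 *v X) - h (J1 *v Y) *\<^sub>R (J3 *v X))"
      unfolding matrix_vector_mult_diff_distrib comm'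
      by (simp add: J_vec h_def vec_eq_iff matrix_vector_mult_neg field_simps)
    ultimately show ?thesis by simp
  qed
  obtain v where v: "v \<bullet> (G *v v) = 1" using exists_unit_vector by blast
  have "h v *\<^sub>R v + h (J3 *v v) *\<^sub>R (J3 *v v) + (- h (J1 *v v)) *\<^sub>R (J1 *v v) + (- h (J2 *v v)) *\<^sub>R (J2 *v v) = 0"
    using key[of v "J2 *v v"] by (simp add: J_vec) (simp add: algebra_simps)
  from frame_independent[OF v this] have z: "h v = 0" "h (J3 *v v) = 0" "h (J1 *v v) = 0" "h (J2 *v v) = 0"
    by auto
  obtain a b c d where "X = a *\<^sub>R v + b *\<^sub>R (J3 *v v) + c *\<^sub>R (J1 *v v) + d *\<^sub>R (J2 *v v)"
    by (rule frame_expansion[OF v])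
  then have "h X = 0"
    by (simp add: linear_add[OF lin] linear_scale[OF lin] z)
  then show ?thesis by (simp add: h_def)
qed

end

text \<open>By this symmetry, what is proved for \<open>J\<^sub>1\<close> holds for \<open>J\<^sub>2\<close>.\<close>

lemma (in pq_metric) swap: "pq_metric J2 J1 (- J3) G"
  by unfold_locales (simp_all add: J_mult matrix_mult_distrib J1_skew J2_skew J3_skew G_sym G_inv transpose_linear)

context pq_metric
begin

text \<open>For \<open>A = J\<^sub>3\<close> the equation is trivial, and for \<open>J\<^sub>2\<close> and \<open>J\<^sub>1\<close> it is the preceding lemma, applied to the
  triple and to the swapped triple. It says that \<open>tr (A S\<^sub>X) = \<alpha>(A X)\<close> with \<open>\<alpha>(X) = - tr (J\<^sub>3 S\<^bsub>J\<^sub>3 X\<^esub>)\<close>.\<close>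

lemma part02_vanishes_trace:
  fixes S :: "real ^ 4 \<Rightarrow> real ^ 4 ^ 4"
  assumes S: "linear S"
    and norm: "\<And>a X. a \<in> {1, 2, 3} \<Longrightarrow> J a ** S X - S X ** J a \<in> span {J1, J2, J3}"
    and T: "\<And>X Y. part02 1 J1 (\<lambda>X Y. S X *v Y - S Y *v X) X Y = 0"
       "\<And>X Y. part02 1 J2 (\<lambda>X Y. S X *v Y - S Y *v X) X Y = 0"
    and A: "A \<in> span {J1, J2, J3}"
  shows "trace (A ** S X) = - trace (J3 ** S (J3 *v (A *v X)))"
proof -
  interpret s: pq_metric J2 J1 "- J3" G by (rule swap)
  have span_eq: "span {J2, J1, - J3} = span {J1, J2, J3}"
  proof -
    have "(\<exists>x y z. A = x *\<^sub>R J2 + y *\<^sub>R J1 + z *\<^sub>R - J3) = (\<exists>x y z. A = x *\<^sub>R J1 + y *\<^sub>R J2 + z *\<^sub>R J3)" for A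
      by (metis (no_types, lifting) add.commute minus_minus scaleR_minus_left scaleR_minus_right)
    then show ?thesis unfolding set_eq_iff in_span_J s.in_span_J by blast
  qed
  have 1: "trace (J2 ** S X) = - trace (J3 ** S (J1 *v X))" for X
    by (rule part02_vanishes_J1[OF S norm T(1)])
  have nn: "s.J a ** S X - S X ** s.J a \<in> span {J2, J1, - J3}" if "a \<in> {1, 2, 3}" for a X
    using that norm[of 1 X] norm[of 2 X] span_neg[OF norm[of 3 X]] unfolding span_eq
    by (auto simp: matrix_mult_distrib)
  have 2: "trace (J1 ** S X) = trace (J3 ** S (J2 *v X))" for X
    using s.part02_vanishes_J1[OF S nn T(2)] by (simp add: matrix_mult_distrib trace_linear)
  obtain x y z where "A = x *\<^sub>R J1 + y *\<^sub>R J2 + z *\<^sub>R J3"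
    using A in_span_J by blast
  then show ?thesis
    by (simp add: matrix_mult_distrib trace_add trace_sub trace_linear 1 2 matrix_vector_mult_add_rdistrib
       matrix_vector_mult_neg matrix_vector_right_distrib matrix_vector_mult_scaleR J_vec
       linear_add[OF S] linear_scale[OF S] linear_neg[OF S] linear_diff[OF S])
qed

end

section \<open>Algebraic curvature tensors\<close>

lemma eta_square: "eta ** eta = mat 1"
  by (simp add: matrix_matrix_mult_def mat_def vec_eq_iff forall_4 sum_4)

lemma orthonormal_frame_inverse:
  fixes F G :: "real ^ 4 ^ 4"
  assumes "transpose F ** G ** F = eta"
  shows "(eta ** transpose F ** G) ** F = mat 1" "F ** (eta ** transpose F ** G) = mat 1"
proof -
  have "(eta ** transpose F ** G) ** F = eta ** (transpose F ** G ** F)"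
    by (simp only: matrix_mul_assoc)
  then show 1: "(eta ** transpose F ** G) ** F = mat 1"
    unfolding assms eta_square .
  show "F ** (eta ** transpose F ** G) = mat 1"
    using 1 matrix_left_right_inverse by blast
qed

lemma trace_eta: "trace (eta ** A) = A $ 1 $ 1 + A $ 2 $ 2 - A $ 3 $ 3 - A $ 4 $ 4"
  by (simp add: trace_def matrix_matrix_mult_def sum_4)

lemma trace_orthonormal_frame:
  fixes F G A :: "real ^ 4 ^ 4"
  assumes "transpose F ** G ** F = eta"
  defines "q \<equiv> \<lambda>i. (F *v axis i 1) \<bullet> (G *v (A *v (F *v axis i 1)))"
  shows "trace A = q 1 + q 2 - q 3 - q 4"
proof -
  note inv = orthonormal_frame_inverse[OF assms(1)]
  have "trace A = trace (A ** (F ** (eta ** transpose F ** G)))"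
    by (simp only: inv matrix_mul_rid)
  also have "\<dots> = trace (eta ** (transpose F ** G ** (A ** F)))"
    using trace_mul_sym[of "A ** F" "eta ** transpose F ** G"] by (simp only: matrix_mul_assoc)
  finally show ?thesis
    by (simp only: trace_eta bilinear_entry q_def matrix_vector_mul_assoc)
qed

lemma trace_inverse_orthonormal_frame:
  fixes F G A :: "real ^ 4 ^ 4"
  assumes "transpose F ** G ** F = eta" "invertible G"
  defines "q \<equiv> \<lambda>i. (F *v axis i 1) \<bullet> (A *v (F *v axis i 1))"
  shows "trace (matrix_inv G ** A) = q 1 + q 2 - q 3 - q 4"
proof -
  have GG: "G ** (matrix_inv G ** A) = A"
    by (simp add: matrix_mul_assoc invertible_matrix_inv[OF assms(2)])
  have "matrix_inv G ** A = (F ** (eta ** transpose F ** G)) ** (matrix_inv G ** A)"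
    by (simp only: orthonormal_frame_inverse(2)[OF assms(1)] matrix_mul_lid)
  also have "\<dots> = F ** (eta ** transpose F ** A)"
    by (simp only: matrix_mul_assoc[symmetric] GG)
  finally have "matrix_inv G ** A = F ** (eta ** transpose F ** A)" .
  then have "trace (matrix_inv G ** A) = trace (eta ** (transpose F ** A ** F))"
    using trace_mul_sym[of F "eta ** transpose F ** A"] by (simp only: matrix_mul_assoc)
  then show ?thesis
    by (simp only: trace_eta bilinear_entry q_def)
qed

text \<open>Contractions of a tensor \<open>R\<close> of curvature type, with the sign conventions of \<open>ricci\<close> and
  \<open>scalar_curvature\<close>.\<close>

definition ricci_contraction :: "(real ^ 4 \<Rightarrow> real ^ 4 \<Rightarrow> real ^ 4 ^ 4) \<Rightarrow> real ^ 4 \<Rightarrow> real ^ 4 \<Rightarrow> real" where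
  "ricci_contraction R Y Z = trace (matrix (\<lambda>X. R X Y *v Z))"

definition scalar_contraction :: "real ^ 4 ^ 4 \<Rightarrow> (real ^ 4 \<Rightarrow> real ^ 4 \<Rightarrow> real ^ 4 ^ 4) \<Rightarrow> real" where
  "scalar_contraction G R = trace (matrix_inv G ** (\<chi> i j. ricci_contraction R (axis i 1) (axis j 1)))"

locale algebraic_curvature =
  fixes G :: "real ^ 4 ^ 4" and R :: "real ^ 4 \<Rightarrow> real ^ 4 \<Rightarrow> real ^ 4 ^ 4"
  assumes G_symmetric: "transpose G = G" and G_invertible: "invertible G"
    and R_linear: "linear (\<lambda>X. R X Y)"
    and R_skew: "R X Y = - R Y X"
    and R_skew_endo: "transpose (R X Y) ** G = - (G ** R X Y)"
    and R_bianchi: "R X Y *v Z + R Y Z *v X + R Z X *v Y = 0"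
begin

definition Rm :: "real ^ 4 \<Rightarrow> real ^ 4 \<Rightarrow> real ^ 4 \<Rightarrow> real ^ 4 \<Rightarrow> real" where
  "Rm X Y Z V = V \<bullet> (G *v (R X Y *v Z))"

lemma R_linear': "linear (\<lambda>Y. R X Y)"
  by (subst R_skew) (rule linear_compose_neg[OF R_linear])

lemma Rm_skew: "Rm X Y Z V = - Rm Y X Z V"
  unfolding Rm_def by (subst R_skew) (simp add: matrix_vector_mult_neg)

lemma Rm_skew': "Rm X Y Z V = - Rm X Y V Z"
  unfolding Rm_def by (rule skew_form_antisymmetric[OF R_skew_endo G_symmetric])

lemma Rm_bianchi: "Rm X Y Z V + Rm Y Z X V + Rm Z X Y V = 0"
proof -
  have "V \<bullet> (G *v (R X Y *v Z + R Y Z *v X + R Z X *v Y)) = 0"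
    by (simp add: R_bianchi)
  then show ?thesis by (simp add: Rm_def matrix_vector_right_distrib inner_add_right)
qed

lemma Rm_pair: "Rm X Y Z V = Rm Z V X Y"
proof -
  have "Rm Y Z V X = - Rm Y Z X V" "Rm Z V Y X = - Rm Z V X Y" "Rm V Y Z X = - Rm Y V Z X"
    "Rm V X Z Y = Rm X V Y Z" "Rm X Z V Y = Rm Z X Y V" "Rm V X Y Z = - Rm X V Y Z"
    "Rm X Y V Z = - Rm X Y Z V" "Rm Y V X Z = - Rm Y V Z X"
    using Rm_skew'[of Y Z V X] Rm_skew'[of Z V Y X] Rm_skew[of V Y Z X] Rm_skew[of V X Z Y]
      Rm_skew'[of X V Z Y] Rm_skew[of X Z V Y] Rm_skew'[of Z X V Y] Rm_skew[of V X Y Z]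
      Rm_skew'[of X Y V Z] Rm_skew'[of Y V X Z] by simp_all
  then show ?thesis
    using Rm_bianchi[of X Y Z V] Rm_bianchi[of Y Z V X] Rm_bianchi[of Z V X Y] Rm_bianchi[of V X Y Z]
    by linarith
qed

lemma bilinear_ricci_contraction: "bilinear (ricci_contraction R)"
  unfolding bilinear_def ricci_contraction_def trace_def matrix_def
  by (auto intro!: linearI simp: linear_add[OF R_linear'] linear_scale[OF R_linear']
     matrix_vector_mult_add_rdistrib matrix_vector_right_distrib matrix_vector_mult_scaleR
     matrix_vector_mult_neg sum.distrib sum_distrib_left)

lemma ricci_frame:
  assumes "transpose F ** G ** F = eta"
  defines "e \<equiv> \<lambda>i. F *v axis i 1"
  shows "ricci_contraction R Y Z = Rm (e 1) Y Z (e 1) + Rm (e 2) Y Z (e 2) - Rm (e 3) Y Z (e 3) - Rm (e 4) Y Z (e 4)"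
proof -
  have "linear (\<lambda>X. R X Y *v Z)"
    by (auto intro!: linearI simp: linear_add[OF R_linear] linear_scale[OF R_linear]
     matrix_vector_mult_add_rdistrib matrix_vector_mult_neg)
  then have "matrix (\<lambda>X. R X Y *v Z) *v X = R X Y *v Z" for X
    using matrix_vector_mul(2) by metis
  then show ?thesis
    unfolding ricci_contraction_def trace_orthonormal_frame[OF assms(1)] Rm_def e_def by simp
qed

lemma scalar_frame:
  assumes "transpose F ** G ** F = eta"
  defines "e \<equiv> \<lambda>i. F *v axis i 1"
  shows "scalar_contraction G R = ricci_contraction R (e 1) (e 1) + ricci_contraction R (e 2) (e 2)
     - ricci_contraction R (e 3) (e 3) - ricci_contraction R (e 4) (e 4)"
proof -
  have "X \<bullet> ((\<chi> i j. ricci_contraction R (axis i 1) (axis j 1)) *v Y) = ricci_contraction R X Y" for X Y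
    by (rule bilinear_as_matrix[OF bilinear_ricci_contraction, symmetric])
  then show ?thesis
    unfolding scalar_contraction_def trace_inverse_orthonormal_frame[OF assms(1) G_invertible] e_def by simp
qed

text \<open>This is twice the Schouten tensor, normalised for dimension 4.\<close>

definition schouten :: "real ^ 4 \<Rightarrow> real ^ 4 \<Rightarrow> real" where
  "schouten X Y = ricci_contraction R X Y - scalar_contraction G R / 6 * (X \<bullet> (G *v Y))"

lemma bilinear_schouten: "bilinear schouten"
  unfolding bilinear_def schouten_def
  by (auto intro!: linearI simp: inner_add_left inner_add_right matrix_vector_right_distrib
    matrix_vector_mult_scaleR bilinear_ladd[OF bilinear_ricci_contraction]
    bilinear_radd[OF bilinear_ricci_contraction] bilinear_lmul[OF bilinear_ricci_contraction]
    bilinear_rmul[OF bilinear_ricci_contraction] algebra_simps)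

end

locale pq_curvature = pq_metric J1 J2 J3 G + algebraic_curvature G R
  for J1 J2 J3 G :: "real ^ 4 ^ 4" and R
begin

text \<open>As \<open>J\<^sub>a\<close> is skew, the trace is the contraction of the curvature with the two-form of \<open>J\<^sub>a\<close>, which is
  the sum of two decomposable forms in the adapted frame.\<close>

lemma trace_J_R_frame:
  fixes v assumes v: "v \<bullet> (G *v v) = 1"
  defines "e \<equiv> \<lambda>i. frame v *v axis i 1"
  shows "trace (J1 ** R X Y) = - 2 * (Rm X Y (e 1) (e 3) + Rm X Y (e 2) (e 4))"
    "trace (J2 ** R X Y) = - 2 * (Rm X Y (e 1) (e 4) - Rm X Y (e 2) (e 3))"
    "trace (J3 ** R X Y) = - 2 * (Rm X Y (e 1) (e 2) + Rm X Y (e 3) (e 4))"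
proof -
  have sk: "e i \<bullet> (G *v ((A ** R X Y) *v e i)) = - Rm X Y (e i) (A *v e i)"
    if "transpose A ** G = - (G ** A)" for A i
    using skew_inner[OF that, of "e i" "R X Y *v e i"] by (simp add: Rm_def matrix_vector_mul_assoc)
  note sk = sk[OF J1_skew] sk[OF J2_skew] sk[OF J3_skew]
  have tr: "trace A = e 1 \<bullet> (G *v (A *v e 1)) + e 2 \<bullet> (G *v (A *v e 2))
      - e 3 \<bullet> (G *v (A *v e 3)) - e 4 \<bullet> (G *v (A *v e 4))" for A
    unfolding e_def by (rule trace_orthonormal_frame[OF frame_orthonormal[OF v]])
  have neg: "Rm X Y Z (- V) = - Rm X Y Z V" for Z V by (simp add: Rm_def)
  have e: "e 1 = v" "e 2 = J3 *v v" "e 3 = J1 *v v" "e 4 = J2 *v v"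
    by (simp_all add: e_def frame_axis)
  note s = Rm_skew'[of X Y "J1 *v v" v] Rm_skew'[of X Y "J2 *v v" v] Rm_skew'[of X Y "J3 *v v" v]
    Rm_skew'[of X Y "J2 *v v" "J3 *v v"] Rm_skew'[of X Y "J1 *v v" "J3 *v v"] Rm_skew'[of X Y "J2 *v v" "J1 *v v"]
  show "trace (J1 ** R X Y) = - 2 * (Rm X Y (e 1) (e 3) + Rm X Y (e 2) (e 4))"
    "trace (J2 ** R X Y) = - 2 * (Rm X Y (e 1) (e 4) - Rm X Y (e 2) (e 3))"
    "trace (J3 ** R X Y) = - 2 * (Rm X Y (e 1) (e 2) + Rm X Y (e 3) (e 4))"
    unfolding tr unfolding sk unfolding e J_vec neg using s by auto
qed

text \<open>In the adapted frame all terms are linear in the components of the curvature, and after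
  normalising these by the symmetries the claim is a matter of linear arithmetic.\<close>

lemma ricci_identity_imp_frame:
  fixes v assumes v: "v \<bullet> (G *v v) = 1" and ri: "ricci_identity (\<lambda>a X Y. trace (J a ** R X Y))"
  defines "e \<equiv> \<lambda>i. frame v *v axis i 1"
  shows "\<forall>i j. trace (J1 ** R (e i) (e j)) = schouten (e j) (J1 *v e i) - schouten (e i) (J1 *v e j) \<and>
    trace (J2 ** R (e i) (e j)) = schouten (e j) (J2 *v e i) - schouten (e i) (J2 *v e j) \<and>
    trace (J3 ** R (e i) (e j)) = schouten (e j) (J3 *v e i) - schouten (e i) (J3 *v e j)"
proof -
  define r where "r i j k l = Rm (e i) (e j) (e k) (e l)" for i j k l
  have t: "trace (J1 ** R X Y) = - 2 * (Rm X Y (e 1) (e 3) + Rm X Y (e 2) (e 4))"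
    "trace (J2 ** R X Y) = - 2 * (Rm X Y (e 1) (e 4) - Rm X Y (e 2) (e 3))"
    "trace (J3 ** R X Y) = - 2 * (Rm X Y (e 1) (e 2) + Rm X Y (e 3) (e 4))" for X Y
    unfolding e_def by (rule trace_J_R_frame[OF v])+
  have e: "e 1 = v" "e 2 = J3 *v v" "e 3 = J1 *v v" "e 4 = J2 *v v"
    by (simp_all add: e_def frame_axis)
  have Je: "J1 *v e 1 = e 3" "J1 *v e 2 = e 4" "J1 *v e 3 = e 1" "J1 *v e 4 = e 2"
    "J2 *v e 1 = e 4" "J2 *v e 2 = - e 3" "J2 *v e 3 = - e 2" "J2 *v e 4 = e 1"
    "J3 *v e 1 = e 2" "J3 *v e 2 = - e 1" "J3 *v e 3 = - e 4" "J3 *v e 4 = e 3"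
    by (simp_all add: e J_vec)
  have neg: "Rm (- X) Y Z V = - Rm X Y Z V" "Rm X (- Y) Z V = - Rm X Y Z V" for X Y Z V
    by (simp_all add: Rm_def linear_neg[OF R_linear] linear_neg[OF R_linear'] matrix_vector_mult_neg)
  have t_e: "trace (J1 ** R (e i) (e j)) = - 2 * (r i j 1 3 + r i j 2 4)"
    "trace (J2 ** R (e i) (e j)) = - 2 * (r i j 1 4 - r i j 2 3)"
    "trace (J3 ** R (e i) (e j)) = - 2 * (r i j 1 2 + r i j 3 4)" for i j
    by (simp_all add: t r_def)
  have sk: "r 2 1 k l = - r 1 2 k l" "r 3 1 k l = - r 1 3 k l" "r 4 1 k l = - r 1 4 k l"
    "r 3 2 k l = - r 2 3 k l" "r 4 2 k l = - r 2 4 k l" "r 4 3 k l = - r 3 4 k l" for k l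
    unfolding r_def by (rule Rm_skew)+
  have sk': "r k l 2 1 = - r k l 1 2" "r k l 3 1 = - r k l 1 3" "r k l 4 1 = - r k l 1 4"
    "r k l 3 2 = - r k l 2 3" "r k l 4 2 = - r k l 2 4" "r k l 4 3 = - r k l 3 4" for k l
    unfolding r_def by (rule Rm_skew')+
  have z: "r i i k l = 0" "r k l i i = 0" for i k l
    unfolding r_def using Rm_skew[of "e i" "e i"] Rm_skew'[of _ _ "e i" "e i"] by (simp_all add: eq_neg_iff_add_eq_0)
  note sk = sk sk' z
  have pr: "r 1 3 1 2 = r 1 2 1 3" "r 1 4 1 2 = r 1 2 1 4" "r 2 3 1 2 = r 1 2 2 3"
    "r 2 4 1 2 = r 1 2 2 4" "r 3 4 1 2 = r 1 2 3 4"
    "r 1 4 1 3 = r 1 3 1 4" "r 2 3 1 3 = r 1 3 2 3" "r 2 4 1 3 = r 1 3 2 4" "r 3 4 1 3 = r 1 3 3 4"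
    "r 2 3 1 4 = r 1 4 2 3" "r 2 4 1 4 = r 1 4 2 4" "r 3 4 1 4 = r 1 4 3 4"
    "r 2 4 2 3 = r 2 3 2 4" "r 3 4 2 3 = r 2 3 3 4" "r 3 4 2 4 = r 2 4 3 4"
    unfolding r_def by (rule Rm_pair)+
  have bi: "r 1 2 3 4 = r 1 3 2 4 - r 1 4 2 3"
    using Rm_bianchi[of "e 1" "e 2" "e 3" "e 4"] pr(10) sk(2)[of 2 4] unfolding r_def by linarith
  have ric: "ricci_contraction R (e i) (e j) = r 1 i j 1 + r 2 i j 2 - r 3 i j 3 - r 4 i j 4" for i j
    unfolding r_def e_def by (rule ricci_frame[OF frame_orthonormal[OF v]])
  have sc: "scalar_contraction G R = ricci_contraction R (e 1) (e 1) + ricci_contraction R (e 2) (e 2)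
     - ricci_contraction R (e 3) (e 3) - ricci_contraction R (e 4) (e 4)"
    unfolding e_def by (rule scalar_frame[OF frame_orthonormal[OF v]])
  have ge: "e i \<bullet> (G *v e j) = eta $ i $ j" for i j
    using bilinear_entry[of "frame v" G "frame v" i j] unfolding frame_orthonormal[OF v] e_def by simp
  note b_neg = bilinear_rneg[OF bilinear_schouten]
  have b_e: "schouten (e i) (e j) = r 1 i j 1 + r 2 i j 2 - r 3 i j 3 - r 4 i j 4
    - (2 * (- r 1 2 1 2 + r 1 3 1 3 + r 1 4 1 4 + r 2 3 2 3 + r 2 4 2 4 - r 3 4 3 4)) / 6 * eta $ i $ j" for i j
    unfolding schouten_def ric sc ge by (simp add: sk)
  have tneg: "trace (A ** R (- X) Y) = - trace (A ** R X Y)" "trace (A ** R X (- Y)) = - trace (A ** R X Y)" for A X Y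
    by (simp_all add: linear_neg[OF R_linear] linear_neg[OF R_linear'] matrix_mult_distrib trace_linear)
  have ri1: "trace (J1 ** R (J2 *v e i) (J2 *v e j)) + trace (J1 ** R (e i) (e j))
      - (trace (J3 ** R (J2 *v e i) (e j)) + trace (J3 ** R (e i) (J2 *v e j))) = 0"
    and ri2: "trace (J2 ** R (J3 *v e i) (J3 *v e j)) - trace (J2 ** R (e i) (e j))
      + (trace (J1 ** R (J3 *v e i) (e j)) + trace (J1 ** R (e i) (J3 *v e j))) = 0"
    and ri3: "trace (J3 ** R (J1 *v e i) (J1 *v e j)) + trace (J3 ** R (e i) (e j))
      + (trace (J2 ** R (J1 *v e i) (e j)) + trace (J2 ** R (e i) (J1 *v e j))) = 0" for i j
    using ri unfolding ricci_identity_def by simp_all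
  note inst = ri1[of 1 2] ri1[of 1 3] ri1[of 1 4] ri1[of 2 3] ri1[of 2 4] ri1[of 3 4]
     ri2[of 1 2] ri2[of 1 3] ri2[of 1 4] ri2[of 2 3] ri2[of 2 4] ri2[of 3 4]
     ri3[of 1 2] ri3[of 1 3] ri3[of 1 4] ri3[of 2 3] ri3[of 2 4] ri3[of 3 4]
  note inst = inst[unfolded Je tneg t_e sk pr bi]
  \<comment> \<open>the five independent equations of the Ricci identity, which state that the trace-free part of the
    self-dual block of the curvature operator is zero\<close>
  have K: "r 1 2 1 3 + r 1 2 2 4 + r 1 3 3 4 + r 2 4 3 4 = 0"
    "r 1 2 2 3 + r 2 3 3 4 = r 1 2 1 4 + r 1 4 3 4"
    "r 1 3 2 3 + r 2 3 2 4 = r 1 3 1 4 + r 1 4 2 4"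
    "4 * r 1 3 2 4 = 2 * r 1 4 2 3 - (r 2 4 2 4 + r 1 3 1 3 + r 3 4 3 4 + r 1 2 1 2)"
    "2 * r 1 4 2 3 = r 2 3 2 3 + r 1 4 1 4 - 2 * r 1 3 2 4 - r 2 4 2 4 - r 1 3 1 3"
    using inst(1,15,8,2,9) by argo+
  have et: "eta $ i $ j = (if i = j then (if i = 1 \<or> i = 2 then 1 else - 1) else 0)" for i j
    by simp
  have et: "eta $ 1 $ 1 = 1" "eta $ 2 $ 2 = 1" "eta $ 3 $ 3 = -1" "eta $ 4 $ 4 = -1"
    "eta $ 1 $ 2 = 0" "eta $ 1 $ 3 = 0" "eta $ 1 $ 4 = 0" "eta $ 2 $ 1 = 0" "eta $ 2 $ 3 = 0" "eta $ 2 $ 4 = 0"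
    "eta $ 3 $ 1 = 0" "eta $ 3 $ 2 = 0" "eta $ 3 $ 4 = 0" "eta $ 4 $ 1 = 0" "eta $ 4 $ 2 = 0" "eta $ 4 $ 3 = 0"
    unfolding et by simp_all
  show ?thesis
    unfolding forall_4 Je b_neg t_e b_e sk pr bi et
    by (intro conjI; (simp add: field_simps del: One_nat_def)?; (insert K; linarith)?)
qed

text \<open>The right-hand side says that the self-dual part of the curvature is built from the Ricci tensor
  and the scalar curvature only, which is the vanishing of \<open>W\<^sup>+\<close>.\<close>

lemma ricci_identity_iff_schouten:
  "ricci_identity (\<lambda>a X Y. trace (J a ** R X Y)) \<longleftrightarrow>
    (\<forall>A\<in>span {J1, J2, J3}. \<forall>X Y. trace (A ** R X Y) = schouten Y (A *v X) - schouten X (A *v Y))"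
proof
  assume "\<forall>A\<in>span {J1, J2, J3}. \<forall>X Y. trace (A ** R X Y) = schouten Y (A *v X) - schouten X (A *v Y)"
  then have "trace (J a ** R X Y) = (- schouten X (J a *v Y)) - (- schouten Y (J a *v X))"
    if "a \<in> {1, 2, 3}" for a X Y using J_in_span[OF that] by auto
  note cong = ricci_identity_cong[of "\<lambda>a X Y. trace (J a ** R X Y)", OF this]
  have "bilinear (\<lambda>X Y. - schouten X Y)"
    using bilinear_schouten unfolding bilinear_def by (auto intro: linear_compose_neg)
  from ricci_identity_bilinear[OF this]
  show "ricci_identity (\<lambda>a X Y. trace (J a ** R X Y))"
    by (subst cong)
next
  assume ri: "ricci_identity (\<lambda>a X Y. trace (J a ** R X Y))"
  obtain v where v: "v \<bullet> (G *v v) = 1" using exists_unit_vector by blast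
  define e where "e i = frame v *v axis i 1" for i
  define d where "d A X Y = trace (A ** R X Y) - (schouten Y (A *v X) - schouten X (A *v Y))" for A X Y
  note bs = bilinear_schouten
  have bil: "bilinear (d A)" for A
    unfolding bilinear_def d_def
    by (auto intro!: linearI simp: linear_add[OF R_linear] linear_scale[OF R_linear] linear_add[OF R_linear']
        linear_scale[OF R_linear'] matrix_mult_distrib trace_add trace_linear matrix_vector_right_distrib
        matrix_vector_mult_scaleR bilinear_ladd[OF bs] bilinear_radd[OF bs] bilinear_lmul[OF bs] bilinear_rmul[OF bs]
        algebra_simps)
  have exp: "X = (\<Sum>i\<in>UNIV. (matrix_inv (frame v) *v X) $ i *\<^sub>R e i)" for X
  proof -
    have "X = frame v *v (\<Sum>i\<in>UNIV. (matrix_inv (frame v) *v X) $ i *\<^sub>R axis i 1)"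
      unfolding axis_expansion
      by (simp add: matrix_vector_mul_assoc invertible_matrix_inv[OF frame_invertible[OF v]])
    then show ?thesis
      by (simp add: e_def linear_sum[OF matrix_vector_mul_linear] matrix_vector_mult_scaleR)
  qed
  have zero: "d A X Y = 0" if "\<And>i j. d A (e i) (e j) = 0" for A X Y
  proof -
    have "d A (\<Sum>i\<in>UNIV. x i *\<^sub>R e i) (\<Sum>j\<in>UNIV. y j *\<^sub>R e j) = 0" for x y
      by (simp add: bilinear_sum[OF bil] bilinear_lmul[OF bil] bilinear_rmul[OF bil] that)
    from this[of "\<lambda>i. (matrix_inv (frame v) *v X) $ i" "\<lambda>i. (matrix_inv (frame v) *v Y) $ i"]
    show ?thesis unfolding exp[symmetric] .
  qed
  have "d J1 (e i) (e j) = 0 \<and> d J2 (e i) (e j) = 0 \<and> d J3 (e i) (e j) = 0" for i j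
    unfolding d_def e_def using ricci_identity_imp_frame[OF v ri] by simp
  then have d: "d J1 X Y = 0" "d J2 X Y = 0" "d J3 X Y = 0" for X Y
    using zero[of J1] zero[of J2] zero[of J3] by simp_all
  show "\<forall>A\<in>span {J1, J2, J3}. \<forall>X Y. trace (A ** R X Y) = schouten Y (A *v X) - schouten X (A *v Y)"
  proof (intro ballI allI)
    fix A X Y assume "A \<in> span {J1, J2, J3}"
    then obtain x y z where A: "A = x *\<^sub>R J1 + y *\<^sub>R J2 + z *\<^sub>R J3"
      using in_span_J by blast
    have "d A X Y = x * d J1 X Y + y * d J2 X Y + z * d J3 X Y"
      unfolding A d_def
      by (simp add: matrix_mult_distrib trace_add trace_linear matrix_vector_mult_add_rdistrib matrix_vector_mult_neg
         bilinear_radd[OF bs] bilinear_rmul[OF bs] algebra_simps)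
    then show "trace (A ** R X Y) = schouten Y (A *v X) - schouten X (A *v Y)"
      by (simp add: d) (simp add: d_def)
  qed
qed

end

subsection \<open>The Weyl operator on two-forms\<close>

definition contract :: "real ^ 4 ^ 4 \<Rightarrow> (real ^ 4 \<Rightarrow> real ^ 4 \<Rightarrow> real) \<Rightarrow> real" where
  "contract M f = (\<Sum>k\<in>UNIV. \<Sum>l\<in>UNIV. f (axis k 1) (axis l 1) * M $ k $ l)"

lemma contract_linear:
  "contract M (\<lambda>Z V. f Z V + h Z V) = contract M f + contract M h"
  "contract M (\<lambda>Z V. f Z V - h Z V) = contract M f - contract M h"
  "contract M (\<lambda>Z V. r * f Z V) = r * contract M f"
  "contract M (\<lambda>Z V. f Z V / r) = contract M f / r"
  by (simp_all add: contract_def sum.distrib sum_subtractf algebra_simps sum_distrib_left sum_divide_distrib)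

lemma linear_as_inner: "linear f \<Longrightarrow> f Z = (\<chi> i. f (axis i 1)) \<bullet> (Z :: real ^ 4)" for f :: "real ^ 4 \<Rightarrow> real"
proof -
  assume lin: "linear f"
  have "f Z = f (\<Sum>i\<in>UNIV. (Z $ i) *\<^sub>R axis i 1)" by (simp only: axis_expansion)
  also have "\<dots> = (\<chi> i. f (axis i 1)) \<bullet> Z"
    by (simp add: linear_sum[OF lin] linear_scale[OF lin] inner_vec_def mult.commute)
  finally show ?thesis .
qed

lemma contract_tensor:
  assumes "linear f" "linear h"
  shows "contract M (\<lambda>Z V. f Z * h V) = f (M *v (\<chi> i. h (axis i 1)))"
  unfolding linear_as_inner[OF assms(1), of "M *v _"]
  by (simp add: contract_def inner_vec_def matrix_vector_mult_def sum_distrib_left mult_ac)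

lemma contract_form: "contract M (\<lambda>Z V. Z \<bullet> (B *v V)) = trace (B ** transpose M)"
  by (simp add: contract_def trace_def matrix_matrix_mult_def transpose_def inner_axis'
      matrix_vector_mult_basis column_def)

context algebraic_curvature
begin

definition weyl_tensor :: "real ^ 4 \<Rightarrow> real ^ 4 \<Rightarrow> real ^ 4 \<Rightarrow> real ^ 4 \<Rightarrow> real" where
  "weyl_tensor X Y Z V = (R X Y *v Z) \<bullet> (G *v V)
      - (X \<bullet> (G *v V) * ricci_contraction R Y Z - X \<bullet> (G *v Z) * ricci_contraction R Y V
         + Y \<bullet> (G *v Z) * ricci_contraction R X V - Y \<bullet> (G *v V) * ricci_contraction R X Z) / 2
      + scalar_contraction G R / 6 * (X \<bullet> (G *v V) * (Y \<bullet> (G *v Z)) - X \<bullet> (G *v Z) * (Y \<bullet> (G *v V)))"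

text \<open>Raising both indices of the form \<open>g(A\<cdot>, \<cdot>)\<close> gives \<open>- A G\<^sup>-\<^sup>1\<close>, so that a contraction with it is a
  composition with \<open>A\<close> or a trace against \<open>A\<close>.\<close>

lemma contract_weyl_tensor:
  assumes A: "transpose A ** G = - (G ** A)"
  shows "contract (raise G (transpose A ** G)) (weyl_tensor X Y) =
    - trace (A ** R X Y) + ricci_contraction R Y (A *v X) - ricci_contraction R X (A *v Y)
      - scalar_contraction G R / 3 * (Y \<bullet> (G *v (A *v X)))"
proof -
  define M where "M = raise G (transpose A ** G)"
  note inv = invertible_matrix_inv[OF G_invertible]
  have iG: "matrix_inv G ** (G ** B) = B" "B ** G ** matrix_inv G = B" for B :: "real ^ 4 ^ 4"
    by (simp_all add: matrix_mul_assoc inv) (simp add: matrix_mul_assoc[symmetric] inv)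
  have inv_sym: "transpose (matrix_inv G) = matrix_inv G"
  proof -
    have "transpose (matrix_inv G) ** G = mat 1" "G ** transpose (matrix_inv G) = mat 1"
      using arg_cong[OF inv(1), of transpose] arg_cong[OF inv(2), of transpose]
      by (simp_all add: matrix_transpose_mul G_symmetric)
    then show ?thesis using matrix_inv_unique by metis
  qed
  have M: "M = matrix_inv G ** transpose A"
    by (simp add: M_def raise_def matrix_mul_assoc iG)
  have M': "M = - (A ** matrix_inv G)"
    by (simp add: M_def raise_def A matrix_mult_distrib matrix_mul_assoc inv)
  have MT: "transpose M = A ** matrix_inv G"
    by (simp add: M matrix_transpose_mul inv_sym)
  have lr: "linear (ricci_contraction R X)" for X
    using bilinear_ricci_contraction by (simp add: bilinear_def)
  have lg: "linear (\<lambda>V. X \<bullet> (G *v V))" for X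
    by (auto intro!: linearI simp: inner_add_right matrix_vector_right_distrib matrix_vector_mult_scaleR)
  have g: "(\<chi> i. X \<bullet> (G *v axis i 1)) = G *v X" for X
    by (simp add: symmetric_matrix_inner[OF G_symmetric, of X] vec_eq_iff inner_axis')
  have MG: "M *v (G *v X) = - (A *v X)" for X
    by (simp add: M' matrix_vector_mul_assoc matrix_mult_distrib matrix_vector_mult_neg matrix_mul_assoc[symmetric] inv)
  have c1: "contract M (\<lambda>Z V. X \<bullet> (G *v V) * f Z) = - f (A *v X)"
    if "linear f" for X and f :: "real ^ 4 \<Rightarrow> real"
    using contract_tensor[OF that lg[of X], of M] by (simp add: g MG linear_neg[OF that] mult.commute)
  have c2: "contract M (\<lambda>Z V. X \<bullet> (G *v Z) * f V) = f (A *v X)"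
    if "linear f" for X and f :: "real ^ 4 \<Rightarrow> real"
  proof -
    have "contract M (\<lambda>Z V. X \<bullet> (G *v Z) * f V) = X \<bullet> (G *v (M *v (\<chi> i. f (axis i 1))))"
      by (rule contract_tensor[OF lg that])
    also have "\<dots> = X \<bullet> (transpose A *v (\<chi> i. f (axis i 1)))"
      by (simp add: M matrix_vector_mul_assoc matrix_mul_assoc inv del: transpose_matrix_vector)
    also have "\<dots> = (A *v X) \<bullet> (\<chi> i. f (axis i 1))"
      by (simp only: inner_matrix_mult_transpose transpose_transpose)
    also have "\<dots> = f (A *v X)"
      using linear_as_inner[OF that, of "A *v X"] by (metis inner_commute)
    finally show ?thesis .
  qed
  have "contract M (\<lambda>Z V. (R X Y *v Z) \<bullet> (G *v V)) = contract M (\<lambda>Z V. Z \<bullet> ((transpose (R X Y) ** G) *v V))"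
    by (simp only: matrix_vector_mul_assoc[symmetric] inner_matrix_mult_transpose[of _ "transpose (R X Y)"] transpose_transpose)
  also have "\<dots> = trace (- (G ** R X Y) ** (A ** matrix_inv G))"
    by (simp only: contract_form MT R_skew_endo)
  also have "\<dots> = - trace (A ** R X Y)"
  proof -
    have "trace (G ** R X Y ** (A ** matrix_inv G)) = trace (R X Y ** A)"
      using trace_mul_sym[of "G" "R X Y ** A ** matrix_inv G"] by (simp add: matrix_mul_assoc iG)
         (simp add: matrix_mul_assoc[symmetric] inv)
    then show ?thesis by (simp add: matrix_mult_distrib trace_linear trace_mul_sym[of A])
  qed
  finally have c0: "contract M (\<lambda>Z V. (R X Y *v Z) \<bullet> (G *v V)) = - trace (A ** R X Y)" .
  show ?thesis
    unfolding M_def[symmetric] weyl_tensor_def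
    by (simp add: contract_linear c0 c1[OF lr] c2[OF lr] c1[OF lg] c2[OF lg])
       (simp add: field_simps)
qed

end

context pq_curvature
begin

lemma weyl_operator_vanishes_iff:
  assumes A: "transpose A ** G = - (G ** A)"
  shows "(\<chi> i j. contract (raise G (transpose A ** G)) (weyl_tensor (axis i 1) (axis j 1)) / 2) = (0 :: real ^ 4 ^ 4) \<longleftrightarrow>
    (\<forall>X Y. trace (A ** R X Y) = schouten Y (A *v X) - schouten X (A *v Y))"
proof -
  define w where "w X Y = contract (raise G (transpose A ** G)) (weyl_tensor X Y)" for X Y
  have w: "w X Y = schouten Y (A *v X) - schouten X (A *v Y) - trace (A ** R X Y)" for X Y
    unfolding w_def contract_weyl_tensor[OF A] schouten_def skew_form_antisymmetric[OF A G_sym, of X Y]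
    by simp
  note bs = bilinear_schouten
  have bil: "bilinear w"
    unfolding bilinear_def w
    by (auto intro!: linearI simp: linear_add[OF R_linear] linear_scale[OF R_linear] linear_add[OF R_linear']
        linear_scale[OF R_linear'] matrix_mult_distrib trace_add trace_linear matrix_vector_right_distrib
        matrix_vector_mult_scaleR bilinear_ladd[OF bs] bilinear_radd[OF bs] bilinear_lmul[OF bs] bilinear_rmul[OF bs]
        algebra_simps)
  have "(\<chi> i j. w (axis i 1) (axis j 1) / 2) = (0 :: real ^ 4 ^ 4) \<longleftrightarrow> (\<forall>X Y. w X Y = 0)"
  proof
    assume "(\<chi> i j. w (axis i 1) (axis j 1) / 2) = (0 :: real ^ 4 ^ 4)"
    then have "(\<chi> i j. w (axis i 1) (axis j 1)) = (0 :: real ^ 4 ^ 4)" by (simp add: vec_eq_iff)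
    then have "w X Y = 0" for X Y unfolding bilinear_as_matrix[OF bil, of X Y] by simp
    then show "\<forall>X Y. w X Y = 0" by blast
  qed (simp add: vec_eq_iff)
  then show ?thesis unfolding w_def[symmetric] by (auto simp: w)
qed

end

section \<open>Self-dual two-forms and orthonormal frames\<close>

lemma det_4:
  "det (A :: 'a::comm_ring_1 ^ 4 ^ 4) =
    A$1$1 * (A$2$2 * (A$3$3 * A$4$4 - A$3$4 * A$4$3) - A$2$3 * (A$3$2 * A$4$4 - A$3$4 * A$4$2)
       + A$2$4 * (A$3$2 * A$4$3 - A$3$3 * A$4$2)) -
    A$1$2 * (A$2$1 * (A$3$3 * A$4$4 - A$3$4 * A$4$3) - A$2$3 * (A$3$1 * A$4$4 - A$3$4 * A$4$1)
       + A$2$4 * (A$3$1 * A$4$3 - A$3$3 * A$4$1)) +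
    A$1$3 * (A$2$1 * (A$3$2 * A$4$4 - A$3$4 * A$4$2) - A$2$2 * (A$3$1 * A$4$4 - A$3$4 * A$4$1)
       + A$2$4 * (A$3$1 * A$4$2 - A$3$2 * A$4$1)) -
    A$1$4 * (A$2$1 * (A$3$2 * A$4$3 - A$3$3 * A$4$2) - A$2$2 * (A$3$1 * A$4$3 - A$3$3 * A$4$1)
       + A$2$3 * (A$3$1 * A$4$2 - A$3$2 * A$4$1))"
proof -
  have f1: "finite {2::4, 3, 4}" "1 \<notin> {2::4, 3, 4}" by auto
  have f2: "finite {3::4, 4}" "2 \<notin> {3::4, 4}" by auto
  have f3: "finite {4::4}" "3 \<notin> {4::4}" by auto
  show ?thesis
    unfolding det_def UNIV_4
    unfolding sum_over_permutations_insert[OF f1]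
    unfolding sum_over_permutations_insert[OF f2]
    unfolding sum_over_permutations_insert[OF f3]
    unfolding permutes_sing
    by (simp add: sign_swap_id permutation_swap_id permutation_compose sign_compose sign_id swap_id_eq)
       (simp add: algebra_simps)
qed

lemma vector_4 [simp]:
  "(vector [x, y, z, w] :: 'a::zero ^ 4) $ 1 = x" "(vector [x, y, z, w] :: 'a ^ 4) $ 2 = y"
  "(vector [x, y, z, w] :: 'a ^ 4) $ 3 = z" "(vector [x, y, z, w] :: 'a ^ 4) $ 4 = w"
  by (simp_all add: vector_def)

lemma linear_volume_form:
  "linear (\<lambda>x. volume_form G x y z w)" "linear (\<lambda>y. volume_form G x y z w)"
  "linear (\<lambda>z. volume_form G x y z w)" "linear (\<lambda>w. volume_form G x y z w)"
  by (rule linearI; simp add: volume_form_def det_4 algebra_simps)+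

lemma volume_form_congruence:
  assumes "det E > 0"
  shows "volume_form (transpose E ** G ** E) x y z w = volume_form G (E *v x) (E *v y) (E *v z) (E *v w)"
proof -
  have "(vector [E *v x, E *v y, E *v z, E *v w] :: real ^ 4 ^ 4) = vector [x, y, z, w] ** transpose E"
    by (simp add: vec_eq_iff forall_4 matrix_matrix_mult_def matrix_vector_mult_def transpose_def mult.commute)
  then have "det (vector [E *v x, E *v y, E *v z, E *v w] :: real ^ 4 ^ 4) = det (vector [x, y, z, w] :: real ^ 4 ^ 4) * det E"
    by (simp add: det_mul)
  moreover have "sqrt \<bar>det (transpose E ** G ** E)\<bar> = sqrt \<bar>det G\<bar> * det E"
    using assms by (simp add: det_mul abs_mult real_sqrt_mult)
  ultimately show ?thesis by (simp add: volume_form_def mult_ac)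
qed

lemma contract_congruence:
  assumes "bilinear f"
  shows "contract M (\<lambda>x y. f (E *v x) (E *v y)) = contract (E ** M ** transpose E) f"
proof -
  define B where "B = (\<chi> i j. f (axis i 1) (axis j 1))"
  have f: "f x y = x \<bullet> (B *v y)" for x y
    unfolding B_def by (rule bilinear_as_matrix[OF assms])
  have "(E *v x) \<bullet> (B *v (E *v y)) = x \<bullet> ((transpose E ** B ** E) *v y)" for x y
    by (simp only: matrix_vector_mul_assoc[symmetric] inner_matrix_mult_transpose[of _ "transpose E"] transpose_transpose)
  then have "contract M (\<lambda>x y. f (E *v x) (E *v y)) = trace (transpose E ** B ** E ** transpose M)"
    by (simp only: f contract_form)
  also have "\<dots> = trace (B ** transpose (E ** M ** transpose E))"
    using trace_mul_sym[of "transpose E" "B ** E ** transpose M"]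
    by (simp add: matrix_transpose_mul matrix_mul_assoc)
  also have "\<dots> = contract (E ** M ** transpose E) f"
    by (simp only: contract_form f[abs_def])
  finally show ?thesis .
qed

lemma hodge_contract:
  "hodge G \<omega> = (\<chi> k l. contract (raise G \<omega>) (\<lambda>x y. volume_form G x y (axis k 1) (axis l 1)) / 2)"
  by (simp add: hodge_def contract_def mult.commute)

lemma transpose_invertible_inverse:
  fixes A :: "real ^ 'n ^ 'n"
  assumes "invertible A"
  shows "transpose A ** transpose (matrix_inv A) = mat 1" "transpose (matrix_inv A) ** transpose A = mat 1"
  using arg_cong[OF invertible_matrix_inv(1)[OF assms], of transpose]
    arg_cong[OF invertible_matrix_inv(2)[OF assms], of transpose]
  by (simp_all add: matrix_transpose_mul)

lemma matrix_inv_congruence: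
  fixes E G :: "real ^ 'n ^ 'n"
  assumes "invertible E" "invertible G"
  shows "matrix_inv (transpose E ** G ** E) = matrix_inv E ** matrix_inv G ** transpose (matrix_inv E)"
proof (rule matrix_inv_unique)
  note inv = invertible_matrix_inv[OF assms(1)] invertible_matrix_inv[OF assms(2)]
    transpose_invertible_inverse[OF assms(1)]
  have left: "E ** (matrix_inv E ** B) = B" "matrix_inv E ** (E ** B) = B"
     "G ** (matrix_inv G ** B) = B" "matrix_inv G ** (G ** B) = B"
     "transpose E ** (transpose (matrix_inv E) ** B) = B"
     "transpose (matrix_inv E) ** (transpose E ** B) = B" for B :: "real ^ 'n ^ 'n"
    by (simp_all add: matrix_mul_assoc inv)
  show "transpose E ** G ** E ** (matrix_inv E ** matrix_inv G ** transpose (matrix_inv E)) = mat 1"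
    "matrix_inv E ** matrix_inv G ** transpose (matrix_inv E) ** (transpose E ** G ** E) = mat 1"
    by (simp_all add: matrix_mul_assoc[symmetric] left inv)
qed

text \<open>The Hodge star is natural under orientation preserving changes of basis, because the volume
  form is.\<close>

lemma hodge_congruence:
  assumes E: "det E > 0" and G: "invertible G"
  shows "hodge (transpose E ** G ** E) (transpose E ** \<omega> ** E) = transpose E ** hodge G \<omega> ** E"
proof -
  have iE: "invertible E" using E by (simp add: invertible_det_nz)
  note inv = invertible_matrix_inv[OF iE] transpose_invertible_inverse[OF iE]
  define M' where "M' = raise (transpose E ** G ** E) (transpose E ** \<omega> ** E)"
  have left: "E ** (matrix_inv E ** B) = B"
     "transpose (matrix_inv E) ** (transpose E ** B) = B" for B :: "real ^ 4 ^ 4"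
    by (simp_all add: matrix_mul_assoc inv)
  have M: "E ** M' ** transpose E = raise G \<omega>"
    unfolding M'_def raise_def matrix_inv_congruence[OF iE G]
    by (simp add: matrix_mul_assoc[symmetric] left inv)
  define h where "h z w = contract (raise G \<omega>) (\<lambda>x y. volume_form G x y z w) / 2" for z w
  have bil: "bilinear h"
    unfolding bilinear_def h_def contract_def
    by (auto intro!: linearI simp: linear_add[OF linear_volume_form(3)] linear_add[OF linear_volume_form(4)]
       linear_scale[OF linear_volume_form(3)] linear_scale[OF linear_volume_form(4)]
       algebra_simps sum.distrib sum_distrib_left add_divide_distrib sum_divide_distrib)
  have bil': "bilinear (\<lambda>x y. volume_form G x y z w)" for z w
    using linear_volume_form(1,2) by (simp add: bilinear_def)
  show ?thesis
  proof (simp only: vec_eq_iff, intro allI)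
    fix k l
    have "hodge (transpose E ** G ** E) (transpose E ** \<omega> ** E) $ k $ l =
      contract M' (\<lambda>x y. volume_form G (E *v x) (E *v y) (E *v axis k 1) (E *v axis l 1)) / 2"
      by (simp add: hodge_contract M'_def volume_form_congruence[OF E])
    also have "\<dots> = h (E *v axis k 1) (E *v axis l 1)"
      by (simp add: contract_congruence[OF bil'] M h_def)
    also have "\<dots> = (E *v axis k 1) \<bullet> (hodge G \<omega> *v (E *v axis l 1))"
      unfolding bilinear_as_matrix[OF bil, of "E *v axis k 1" "E *v axis l 1"]
      by (simp add: hodge_contract h_def)
    also have "\<dots> = (transpose E ** hodge G \<omega> ** E) $ k $ l"
      by (simp only: bilinear_entry)
    finally show "hodge (transpose E ** G ** E) (transpose E ** \<omega> ** E) $ k $ l = (transpose E ** hodge G \<omega> ** E) $ k $ l" .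
  qed
qed

text \<open>The fibre of the para-quaternionic structure of a metric with Gram matrix \<open>G\<close>.\<close>

definition pq_space :: "real ^ 4 ^ 4 \<Rightarrow> (real ^ 4 ^ 4) set" where
  "pq_space G = {A. transpose A ** G = - (G ** A) \<and> self_dual G (transpose A ** G)}"

lemma congruence_cancel:
  fixes A B E :: "real ^ 'n ^ 'n"
  assumes "invertible E"
  shows "transpose E ** A ** E = transpose E ** B ** E \<longleftrightarrow> A = B"
proof
  assume "transpose E ** A ** E = transpose E ** B ** E"
  then have "transpose (matrix_inv E) ** (transpose E ** A ** E) ** matrix_inv E =
    transpose (matrix_inv E) ** (transpose E ** B ** E) ** matrix_inv E" by simp
  then have "(transpose (matrix_inv E) ** transpose E) ** A ** (E ** matrix_inv E) =
    (transpose (matrix_inv E) ** transpose E) ** B ** (E ** matrix_inv E)"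
    by (simp only: matrix_mul_assoc)
  then show "A = B"
    by (simp add: invertible_matrix_inv[OF assms] transpose_invertible_inverse[OF assms])
qed simp

text \<open>The fibre is transported by conjugation, since self-duality is preserved by congruence.\<close>

lemma pq_space_congruence:
  assumes E: "det E > 0" and G: "invertible G"
  shows "E ** B ** matrix_inv E \<in> pq_space G \<longleftrightarrow> B \<in> pq_space (transpose E ** G ** E)"
proof -
  have iE: "invertible E" using E by (simp add: invertible_det_nz)
  note inv = invertible_matrix_inv[OF iE] transpose_invertible_inverse[OF iE]
  define A where "A = E ** B ** matrix_inv E"
  have left: "transpose E ** (transpose (matrix_inv E) ** B) = B" for B :: "real ^ 4 ^ 4"
    by (simp add: matrix_mul_assoc inv)
  have 1: "transpose E ** (transpose A ** G) ** E = transpose B ** (transpose E ** G ** E)"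
    by (simp add: A_def matrix_transpose_mul matrix_mul_assoc[symmetric] left)
  have 2: "transpose E ** (G ** A) ** E = (transpose E ** G ** E) ** B"
    by (simp add: A_def matrix_mul_assoc[symmetric] inv)
  have "transpose A ** G = - (G ** A) \<longleftrightarrow>
    transpose B ** (transpose E ** G ** E) = - ((transpose E ** G ** E) ** B)"
    using congruence_cancel[OF iE, of "transpose A ** G" "- (G ** A)"] unfolding 1[symmetric] 2[symmetric]
    by (simp add: matrix_mult_distrib)
  moreover have "self_dual (transpose E ** G ** E) (transpose E ** \<omega> ** E) \<longleftrightarrow> self_dual G \<omega>" for \<omega>
    unfolding self_dual_def hodge_congruence[OF E G] congruence_cancel[OF iE]
    using congruence_cancel[OF iE, of "transpose \<omega>" "- \<omega>"]
    by (simp add: matrix_transpose_mul matrix_mult_distrib matrix_mul_assoc)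
  ultimately show ?thesis
    unfolding pq_space_def A_def[symmetric] mem_Collect_eq 1[symmetric] by simp
qed

subsection \<open>The standard model\<close>

text \<open>The self-dual skew endomorphisms of \<open>\<real>\<^sup>2\<^sup>,\<^sup>2\<close> with \<open>K1 K2 = K3\<close>, which permute the standard basis up to
  signs.\<close>

definition K1 :: "real ^ 4 ^ 4" where
  "K1 = vector [vector [0, 0, 1, 0], vector [0, 0, 0, 1], vector [1, 0, 0, 0], vector [0, 1, 0, 0]]"
definition K2 :: "real ^ 4 ^ 4" where
  "K2 = vector [vector [0, 0, 0, 1], vector [0, 0, - 1, 0], vector [0, - 1, 0, 0], vector [1, 0, 0, 0]]"
definition K3 :: "real ^ 4 ^ 4" where
  "K3 = vector [vector [0, - 1, 0, 0], vector [1, 0, 0, 0], vector [0, 0, 0, 1], vector [0, 0, - 1, 0]]"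

interpretation K: pq_triple K1 K2 K3
  by unfold_locales
     (simp_all add: K1_def K2_def K3_def vec_eq_iff forall_4 matrix_matrix_mult_def sum_4 mat_def)

lemma matrix_inv_eta: "matrix_inv eta = eta"
  by (rule matrix_inv_unique[OF eta_square eta_square])

lemma eta_mult: "(eta ** A) $ i $ j = (if i = 1 \<or> i = 2 then A $ i $ j else - A $ i $ j)"
  "(A ** eta) $ i $ j = (if j = 1 \<or> j = 2 then A $ i $ j else - A $ i $ j)"
  using exhaust_4[of i] exhaust_4[of j] by (auto simp: matrix_matrix_mult_def sum_4)

lemma raise_eta: "raise eta \<omega> $ i $ j =
  (if (i = 1 \<or> i = 2) = (j = 1 \<or> j = 2) then \<omega> $ i $ j else - \<omega> $ i $ j)"
  unfolding raise_def matrix_inv_eta eta_mult by simp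

lemma volume_form_eta_axis:
  "volume_form eta x y (axis 1 1) (axis 2 1) = x $ 3 * y $ 4 - x $ 4 * y $ 3"
  "volume_form eta x y (axis 1 1) (axis 3 1) = - (x $ 2 * y $ 4 - x $ 4 * y $ 2)"
  "volume_form eta x y (axis 1 1) (axis 4 1) = x $ 2 * y $ 3 - x $ 3 * y $ 2"
  "volume_form eta x y (axis 2 1) (axis 3 1) = x $ 1 * y $ 4 - x $ 4 * y $ 1"
  "volume_form eta x y (axis 2 1) (axis 4 1) = - (x $ 1 * y $ 3 - x $ 3 * y $ 1)"
  "volume_form eta x y (axis 3 1) (axis 4 1) = x $ 1 * y $ 2 - x $ 2 * y $ 1"
  unfolding volume_form_def det_eta det_4 vector_4 by (simp_all add: axis_def)

lemma contract_minor: "contract M (\<lambda>x y. x $ i * y $ j - x $ j * y $ i) = M $ i $ j - M $ j $ i"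
proof -
  have "contract M (\<lambda>x y. x $ a * y $ b) = M $ a $ b" for a b
  proof -
    have "contract M (\<lambda>x y. x $ a * y $ b) = (\<Sum>k\<in>UNIV. \<Sum>l\<in>UNIV. if k = a then if l = b then M $ k $ l else 0 else 0)"
      unfolding contract_def by (intro sum.cong) (auto simp: axis_def)
    also have "\<dots> = (\<Sum>k\<in>UNIV. if k = a then \<Sum>l\<in>UNIV. if l = b then M $ k $ l else 0 else 0)"
      by (intro sum.cong) auto
    finally show ?thesis by simp
  qed
  then show ?thesis by (simp add: contract_linear)
qed

lemma skew_entry: "\<omega> $ j $ i = - \<omega> $ i $ j" if "transpose \<omega> = - \<omega>" for \<omega> :: "real ^ 'n ^ 'n"
  using arg_cong[OF that, of "\<lambda>M. M $ i $ j"] by (simp add: transpose_def)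

lemma hodge_eta:
  assumes "transpose \<omega> = - \<omega>"
  shows "hodge eta \<omega> $ 1 $ 2 = \<omega> $ 3 $ 4" "hodge eta \<omega> $ 1 $ 3 = \<omega> $ 2 $ 4" "hodge eta \<omega> $ 1 $ 4 = - \<omega> $ 2 $ 3"
    "hodge eta \<omega> $ 2 $ 3 = - \<omega> $ 1 $ 4" "hodge eta \<omega> $ 2 $ 4 = \<omega> $ 1 $ 3" "hodge eta \<omega> $ 3 $ 4 = \<omega> $ 1 $ 2"
    "hodge eta \<omega> $ j $ i = - hodge eta \<omega> $ i $ j"
proof -
  have sk: "\<omega> $ 2 $ 1 = - \<omega> $ 1 $ 2" "\<omega> $ 3 $ 1 = - \<omega> $ 1 $ 3" "\<omega> $ 4 $ 1 = - \<omega> $ 1 $ 4"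
     "\<omega> $ 3 $ 2 = - \<omega> $ 2 $ 3" "\<omega> $ 4 $ 2 = - \<omega> $ 2 $ 4" "\<omega> $ 4 $ 3 = - \<omega> $ 3 $ 4"
    using skew_entry[OF assms] by blast+
  have cneg: "contract M (\<lambda>x y. - f x y) = - contract M f" for M f
    by (simp add: contract_def sum_negf)
  note h = hodge_contract vec_lambda_beta volume_form_eta_axis cneg contract_minor raise_eta
  show "hodge eta \<omega> $ 1 $ 2 = \<omega> $ 3 $ 4" "hodge eta \<omega> $ 1 $ 3 = \<omega> $ 2 $ 4" "hodge eta \<omega> $ 1 $ 4 = - \<omega> $ 2 $ 3"
    "hodge eta \<omega> $ 2 $ 3 = - \<omega> $ 1 $ 4" "hodge eta \<omega> $ 2 $ 4 = \<omega> $ 1 $ 3" "hodge eta \<omega> $ 3 $ 4 = \<omega> $ 1 $ 2"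
    unfolding h by (simp_all add: sk)
  have v: "volume_form eta x y (axis j 1) (axis i 1) = - volume_form eta x y (axis i 1) (axis j 1)" for x y
    by (simp add: volume_form_def det_4 algebra_simps)
  show "hodge eta \<omega> $ j $ i = - hodge eta \<omega> $ i $ j"
    unfolding hodge_contract contract_def by (simp add: v sum_negf)
qed

lemma self_dual_eta:
  "self_dual eta \<omega> \<longleftrightarrow> transpose \<omega> = - \<omega> \<and> \<omega> $ 1 $ 2 = \<omega> $ 3 $ 4 \<and> \<omega> $ 1 $ 3 = \<omega> $ 2 $ 4 \<and> \<omega> $ 1 $ 4 = - \<omega> $ 2 $ 3"
proof -
  have "hodge eta \<omega> = \<omega> \<longleftrightarrow> \<omega> $ 1 $ 2 = \<omega> $ 3 $ 4 \<and> \<omega> $ 1 $ 3 = \<omega> $ 2 $ 4 \<and> \<omega> $ 1 $ 4 = - \<omega> $ 2 $ 3"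
    if sk: "transpose \<omega> = - \<omega>"
  proof -
    have skw: "\<omega> $ j $ i = - \<omega> $ i $ j" for i j
      by (rule skew_entry[OF sk])
    note h = hodge_eta[OF sk]
    have d: "hodge eta \<omega> $ i $ i = \<omega> $ i $ i" for i
      using h(7)[of i i] skw[of i i] by linarith
    have "hodge eta \<omega> = \<omega> \<longleftrightarrow> (\<forall>i j. hodge eta \<omega> $ i $ j = \<omega> $ i $ j)"
      by (simp add: vec_eq_iff)
    also have "\<dots> \<longleftrightarrow> \<omega> $ 1 $ 2 = \<omega> $ 3 $ 4 \<and> \<omega> $ 1 $ 3 = \<omega> $ 2 $ 4 \<and> \<omega> $ 1 $ 4 = - \<omega> $ 2 $ 3"
      unfolding forall_4 d h(1-6) h(7)[of 2 1] h(7)[of 3 1] h(7)[of 4 1] h(7)[of 3 2] h(7)[of 4 2] h(7)[of 4 3]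
      using skw[of 2 1] skw[of 3 1] skw[of 4 1] skw[of 3 2] skw[of 4 2] skw[of 4 3] by auto
    finally show ?thesis .
  qed
  then show ?thesis by (auto simp: self_dual_def)
qed

lemma pq_space_eta: "pq_space eta = span {K1, K2, K3}"
proof -
  have "A \<in> pq_space eta \<longleftrightarrow> (\<exists>x y z. A = x *\<^sub>R K1 + y *\<^sub>R K2 + z *\<^sub>R K3)" for A
  proof
    assume "A \<in> pq_space eta"
    then have sk: "transpose A ** eta = - (eta ** A)" and sd: "self_dual eta (transpose A ** eta)"
      by (auto simp: pq_space_def)
    have tr: "transpose A $ i $ j = A $ j $ i" for i j
      by (simp add: transpose_def)
    have 1: "(transpose A ** eta) $ i $ j = - ((eta ** A) $ i $ j)" for i j
      unfolding sk by simp
    have e: "(if j = 1 \<or> j = 2 then A $ j $ i else - A $ j $ i) = - (if i = 1 \<or> i = 2 then A $ i $ j else - A $ i $ j)" for i j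
      using 1[of i j] unfolding eta_mult tr .
    have e: "A $ 1 $ 1 = 0" "A $ 2 $ 2 = 0" "A $ 3 $ 3 = 0" "A $ 4 $ 4 = 0" "A $ 2 $ 1 = - A $ 1 $ 2" "A $ 3 $ 1 = A $ 1 $ 3"
      "A $ 4 $ 1 = A $ 1 $ 4" "A $ 3 $ 2 = A $ 2 $ 3" "A $ 4 $ 2 = A $ 2 $ 4" "A $ 4 $ 3 = - A $ 3 $ 4"
      using e[of 1 1] e[of 2 2] e[of 3 3] e[of 4 4] e[of 1 2] e[of 1 3] e[of 1 4] e[of 2 3] e[of 2 4] e[of 3 4]
      by simp_all
    have "A $ 2 $ 1 = - A $ 4 $ 3" "- A $ 3 $ 1 = - A $ 4 $ 2" "A $ 4 $ 1 = - A $ 3 $ 2"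
      using sd unfolding self_dual_eta eta_mult tr by simp_all
    with e have "A = (A $ 1 $ 3) *\<^sub>R K1 + (A $ 1 $ 4) *\<^sub>R K2 + (A $ 2 $ 1) *\<^sub>R K3"
      unfolding vec_eq_iff forall_4 by (simp add: K1_def K2_def K3_def)
    then show "\<exists>x y z. A = x *\<^sub>R K1 + y *\<^sub>R K2 + z *\<^sub>R K3" by blast
  next
    assume "\<exists>x y z. A = x *\<^sub>R K1 + y *\<^sub>R K2 + z *\<^sub>R K3"
    then obtain x y z where A: "A = x *\<^sub>R K1 + y *\<^sub>R K2 + z *\<^sub>R K3" by blast
    show "A \<in> pq_space eta"
      unfolding pq_space_def mem_Collect_eq self_dual_eta vec_eq_iff forall_4 A
      by (simp add: transpose_def eta_mult K1_def K2_def K3_def)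
  qed
  then show ?thesis unfolding set_eq_iff K.in_span_J by blast
qed

lemma pq_space_orthonormal_frame:
  assumes E: "det E > 0" and G: "invertible G" and on: "transpose E ** G ** E = eta"
  shows "pq_space G = span {E ** K1 ** matrix_inv E, E ** K2 ** matrix_inv E, E ** K3 ** matrix_inv E}"
    and "pq_triple (E ** K1 ** matrix_inv E) (E ** K2 ** matrix_inv E) (E ** K3 ** matrix_inv E)"
proof -
  have iE: "invertible E" using E by (simp add: invertible_det_nz)
  note inv = invertible_matrix_inv[OF iE]
  have left: "E ** (matrix_inv E ** B) = B" "matrix_inv E ** (E ** B) = B" for B :: "real ^ 4 ^ 4"
    by (simp_all add: matrix_mul_assoc inv)
  have conj: "(E ** A ** matrix_inv E) ** (E ** B ** matrix_inv E) = E ** (A ** B) ** matrix_inv E" for A B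
    by (simp add: matrix_mul_assoc[symmetric] left)
  show t: "pq_triple (E ** K1 ** matrix_inv E) (E ** K2 ** matrix_inv E) (E ** K3 ** matrix_inv E)"
    by unfold_locales (simp_all add: conj K.J_mult matrix_mult_distrib inv)
  have "A \<in> pq_space G \<longleftrightarrow> (\<exists>x y z. A = x *\<^sub>R (E ** K1 ** matrix_inv E) + y *\<^sub>R (E ** K2 ** matrix_inv E) + z *\<^sub>R (E ** K3 ** matrix_inv E))" for A
  proof -
    have A: "A = E ** (matrix_inv E ** A ** E) ** matrix_inv E"
      by (simp add: matrix_mul_assoc[symmetric] left inv)
    have "A \<in> pq_space G \<longleftrightarrow> matrix_inv E ** A ** E \<in> span {K1, K2, K3}"
      using pq_space_congruence[OF E G, of "matrix_inv E ** A ** E"]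
      unfolding A[symmetric] on pq_space_eta .
    also have "\<dots> \<longleftrightarrow> (\<exists>x y z. matrix_inv E ** A ** E = x *\<^sub>R K1 + y *\<^sub>R K2 + z *\<^sub>R K3)"
      by (rule K.in_span_J)
    also have "\<dots> \<longleftrightarrow> (\<exists>x y z. A = E ** (x *\<^sub>R K1 + y *\<^sub>R K2 + z *\<^sub>R K3) ** matrix_inv E)"
    proof -
      have "matrix_inv E ** A ** E = B \<longleftrightarrow> A = E ** B ** matrix_inv E" for B
      proof
        assume "matrix_inv E ** A ** E = B"
        then show "A = E ** B ** matrix_inv E" using A by (rule subst)
      next
        assume "A = E ** B ** matrix_inv E"
        then show "matrix_inv E ** A ** E = B" by (simp add: matrix_mul_assoc[symmetric] left inv)
      qed
      then show ?thesis by simp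
    qed
    finally show ?thesis by (simp add: matrix_mult_distrib)
  qed
  then show "pq_space G = span {E ** K1 ** matrix_inv E, E ** K2 ** matrix_inv E, E ** K3 ** matrix_inv E}"
    unfolding set_eq_iff pq_triple.in_span_J[OF t] by blast
qed

section \<open>Local admissible bases\<close>

lemma open_positive_in_chart:
  fixes f :: "'m::topological_space \<Rightarrow> real"
  assumes c: "is_chart c" and U: "open U" and f: "smooth_in_chart c U f"
  shows "open {q \<in> U \<inter> chart_dom c. f q > 0}"
proof -
  let ?D = "U \<inter> chart_dom c"
  have o: "open ?D" using c U by (auto simp: is_chart_def)
  have "times_differentiable_on 0 (coords c ` ?D) (f \<circ> chart_inv c)"
    using f unfolding smooth_in_chart_def smooth_on_def by blast
  then have 1: "continuous_on (coords c ` ?D) (f \<circ> chart_inv c)" by simp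
  have "continuous_on (chart_dom c) (coords c)"
    using c by (simp add: is_chart_def homeomorphism_def)
  then have "continuous_on ?D (coords c)" by (rule continuous_on_subset) auto
  from continuous_on_compose[OF this 1] have "continuous_on ?D (\<lambda>q. f (chart_inv c (coords c q)))"
    by (simp add: o_def)
  then have "continuous_on ?D f"
    by (rule continuous_on_eq) (auto simp: chart_inv_coords[OF c])
  from continuous_open_preimage[OF this o, of "{0<..}"] have "open (?D \<inter> f -` {0<..})"
    by simp
  also have "?D \<inter> f -` {0<..} = {q \<in> ?D. f q > 0}" by auto
  finally show ?thesis .
qed

context oriented_manifold
begin

definition vector_field :: "'m set \<Rightarrow> ('m chart \<Rightarrow> 'm \<Rightarrow> real ^ 4) \<Rightarrow> bool" where
  "vector_field U V \<longleftrightarrow> (\<forall>d\<in>\<A>. smooth_in_chart d U (V d)) \<and>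
     (\<forall>d\<in>\<A>. \<forall>e\<in>\<A>. \<forall>q\<in>U \<inter> chart_dom d \<inter> chart_dom e. jacobian d e q *v V d q = V e q)"

lemma vector_field_smooth: "vector_field U V \<Longrightarrow> d \<in> \<A> \<Longrightarrow> smooth_in_chart d U (V d)"
  unfolding vector_field_def by blast

lemma vector_fieldI:
  assumes "\<And>d. d \<in> \<A> \<Longrightarrow> smooth_in_chart d U (V d)"
    and "\<And>d e q. d \<in> \<A> \<Longrightarrow> e \<in> \<A> \<Longrightarrow> q \<in> U \<Longrightarrow> q \<in> chart_dom d \<Longrightarrow> q \<in> chart_dom e \<Longrightarrow>
      V e q = jacobian d e q *v V d q"
  shows "vector_field U V"
  unfolding vector_field_def using assms by (metis IntE)

lemma vector_field_change:
  "vector_field U V \<Longrightarrow> d \<in> \<A> \<Longrightarrow> e \<in> \<A> \<Longrightarrow> q \<in> U \<Longrightarrow> q \<in> chart_dom d \<Longrightarrow> q \<in> chart_dom e \<Longrightarrow>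
    V e q = jacobian d e q *v V d q"
  unfolding vector_field_def by (metis IntI)

lemma vector_field_subset:
  assumes "vector_field U V" "W \<subseteq> U" shows "vector_field W V"
proof (rule vector_fieldI)
  show "smooth_in_chart d W (V d)" if "d \<in> \<A>" for d
    by (rule smooth_in_chart_subset[OF vector_field_smooth[OF assms(1) that]]) (use assms(2) in blast)
  show "V e q = jacobian d e q *v V d q"
    if "d \<in> \<A>" "e \<in> \<A>" "q \<in> W" "q \<in> chart_dom d" "q \<in> chart_dom e" for d e q
    by (rule vector_field_change[OF assms(1) that(1,2) subsetD[OF assms(2) that(3)] that(4,5)])
qed

text \<open>The components in a chart \<open>d\<close> of a field that is constant in \<open>c\<close> involve the Jacobian from \<open>d\<close> to \<open>c\<close>
  only. That matrix is a smooth function of the coordinates of \<open>d\<close> by definition of the atlas, and the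
  smoothness of composite functions does not enter.\<close>

lemma vector_field_constant:
  assumes c: "c \<in> \<A>" and U: "open U" "U \<subseteq> chart_dom c"
  shows "vector_field U (\<lambda>d q. matrix_inv (jacobian d c q) *v w)"
proof (rule vector_fieldI)
  fix d assume d: "d \<in> \<A>"
  have "smooth_in_chart d U (jacobian d c)"
    by (rule smooth_in_chart_subset[OF smooth_jacobian[OF d c]]) (use U in blast)
  then have "smooth_in_chart d U (\<lambda>q. matrix_inv (jacobian d c q))"
    by (rule smooth_in_chart_matrix_inv[OF chart[OF d] U(1)]) (use U d c in \<open>blast intro: invertible_jacobian\<close>)
  then show "smooth_in_chart d U (\<lambda>q. matrix_inv (jacobian d c q) *v w)"
    by (rule smooth_in_chart_linear[OF chart[OF d] U(1)
          bounded_bilinear.bounded_linear_left[OF bounded_bilinear_matrix_vector_mult]])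
next
  fix d e q assume q: "d \<in> \<A>" "e \<in> \<A>" "q \<in> U" "q \<in> chart_dom d" "q \<in> chart_dom e"
  then have "q \<in> chart_dom c" using U by blast
  with q show "matrix_inv (jacobian e c q) *v w = jacobian d e q *v (matrix_inv (jacobian d c q) *v w)"
    using c by (simp add: invertible_jacobian matrix_vector_mul_assoc jacobian_compose)
qed

lemma vector_field_diff:
  assumes "open U" "vector_field U V" "vector_field U W"
  shows "vector_field U (\<lambda>d q. V d q - W d q)"
proof (rule vector_fieldI)
  show "smooth_in_chart d U (\<lambda>q. V d q - W d q)" if "d \<in> \<A>" for d
    by (intro smooth_in_chart_diff[OF chart assms(1)] vector_field_smooth assms that)
  show "V e q - W e q = jacobian d e q *v (V d q - W d q)"
    if "d \<in> \<A>" "e \<in> \<A>" "q \<in> U" "q \<in> chart_dom d" "q \<in> chart_dom e" for d e q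
    unfolding matrix_vector_mult_diff_distrib vector_field_change[OF assms(2) that]
      vector_field_change[OF assms(3) that] ..
qed

lemma vector_field_sum:
  assumes "open U" "\<And>i. i \<in> I \<Longrightarrow> vector_field U (V i)"
  shows "vector_field U (\<lambda>d q. \<Sum>i\<in>I. V i d q)"
proof (rule vector_fieldI)
  show "smooth_in_chart d U (\<lambda>q. \<Sum>i\<in>I. V i d q)" if "d \<in> \<A>" for d
    by (intro smooth_in_chart_sum[OF chart assms(1)] vector_field_smooth assms(2) that)
  show "(\<Sum>i\<in>I. V i e q) = jacobian d e q *v (\<Sum>i\<in>I. V i d q)"
    if "d \<in> \<A>" "e \<in> \<A>" "q \<in> U" "q \<in> chart_dom d" "q \<in> chart_dom e" for d e q
    unfolding linear_sum[OF matrix_vector_mul_linear]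
    by (intro sum.cong refl vector_field_change[OF assms(2) that])
qed

lemma vector_field_scale:
  assumes "open U" "vector_field U V" and f: "\<And>d. d \<in> \<A> \<Longrightarrow> smooth_in_chart d U (f d)"
    and ff: "\<And>d e q. d \<in> \<A> \<Longrightarrow> e \<in> \<A> \<Longrightarrow> q \<in> U \<Longrightarrow> q \<in> chart_dom d \<Longrightarrow> q \<in> chart_dom e \<Longrightarrow> f d q = f e q"
  shows "vector_field U (\<lambda>d q. f d q *\<^sub>R V d q)"
proof (rule vector_fieldI)
  show "smooth_in_chart d U (\<lambda>q. f d q *\<^sub>R V d q)" if "d \<in> \<A>" for d
    by (intro smooth_in_chart_scaleR[OF chart assms(1)] f vector_field_smooth assms(2) that)
  show "f e q *\<^sub>R V e q = jacobian d e q *v (f d q *\<^sub>R V d q)"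
    if "d \<in> \<A>" "e \<in> \<A>" "q \<in> U" "q \<in> chart_dom d" "q \<in> chart_dom e" for d e q
    unfolding ff[OF that] matrix_vector_mult_scaleR vector_field_change[OF assms(2) that] ..
qed

end

context neutral_manifold
begin

abbreviation ip :: "('m chart \<Rightarrow> 'm \<Rightarrow> real ^ 4) \<Rightarrow> ('m chart \<Rightarrow> 'm \<Rightarrow> real ^ 4) \<Rightarrow> 'm chart \<Rightarrow> 'm \<Rightarrow> real" where
  "ip V W d q \<equiv> V d q \<bullet> (g d q *v W d q)"

lemma ip_change:
  assumes V: "vector_field U V" and W: "vector_field U W"
    and de: "d \<in> \<A>" "e \<in> \<A>" "q \<in> U" "q \<in> chart_dom d" "q \<in> chart_dom e"
  shows "ip V W d q = ip V W e q"
proof -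
  let ?Q = "jacobian d e q"
  have "ip V W d q = V d q \<bullet> ((transpose ?Q ** g e q ** ?Q) *v W d q)"
    unfolding metric_change[OF de(1,2,4,5)] ..
  also have "\<dots> = V d q \<bullet> (transpose ?Q *v (g e q *v (?Q *v W d q)))"
    by (simp only: matrix_vector_mul_assoc matrix_mul_assoc)
  also have "\<dots> = (?Q *v V d q) \<bullet> (g e q *v (?Q *v W d q))"
    by (simp only: inner_matrix_mult_transpose[of _ "transpose ?Q"] transpose_transpose)
  finally show ?thesis
    by (simp only: vector_field_change[OF V de] vector_field_change[OF W de])
qed

lemma smooth_ip:
  assumes "vector_field U V" "vector_field U W" "d \<in> \<A>" "open U"
  shows "smooth_in_chart d U (ip V W d)"
proof -
  note dU = chart[OF assms(3)] assms(4)
  have s: "smooth_in_chart d U (V d)" "smooth_in_chart d U (W d)"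
    using assms vector_field_smooth by blast+
  show ?thesis
    by (intro smooth_in_chart_bilinear[OF dU bounded_bilinear_inner] s
        smooth_in_chart_bilinear[OF dU bounded_bilinear_matrix_vector_mult]
        smooth_in_chart_subset[OF metric_smooth[OF assms(3)]]) auto
qed

text \<open>Smooth Gram--Schmidt orthonormalisation of constant vector fields that are orthonormal at \<open>p\<close>.
  Causal types are constant near \<open>p\<close>, so that the process does not break down there.\<close>

lemma local_orthonormal_fields:
  fixes F :: "4 set" and w :: "4 \<Rightarrow> real ^ 4"
  assumes c: "c \<in> \<A>" "p \<in> chart_dom c"
    and w: "\<And>i j. w i \<bullet> (g c p *v w j) = eta $ i $ j"
  shows "\<exists>U e. open U \<and> p \<in> U \<and> U \<subseteq> chart_dom c \<and> (\<forall>i\<in>F. vector_field U (e i) \<and> e i c p = w i) \<and>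
    (\<forall>i\<in>F. \<forall>j\<in>F. \<forall>d\<in>\<A>. \<forall>q\<in>U \<inter> chart_dom d. ip (e i) (e j) d q = eta $ i $ j)"
proof (induction F rule: finite_induct[OF finite])
  case 1
  show ?case using c open_chart_dom by blast
next
  case (2 k F)
  then obtain U e where U: "open U" "p \<in> U" "U \<subseteq> chart_dom c"
    and e: "\<And>i. i \<in> F \<Longrightarrow> vector_field U (e i)" "\<And>i. i \<in> F \<Longrightarrow> e i c p = w i"
    and on: "\<And>i j d q. i \<in> F \<Longrightarrow> j \<in> F \<Longrightarrow> d \<in> \<A> \<Longrightarrow> q \<in> U \<Longrightarrow> q \<in> chart_dom d \<Longrightarrow> ip (e i) (e j) d q = eta $ i $ j"
    by blast
  have eta_sq: "eta $ i $ i * eta $ i $ i = 1" for i by simp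
  define W where "W d q = matrix_inv (jacobian d c q) *v w k" for d q
  have W: "vector_field U W"
    unfolding W_def by (rule vector_field_constant[OF c(1) U(1,3)])
  have Wp: "W c p = w k"
    using invertible_jacobian(2)[OF c(1,1,2,2)] jacobian_self[OF c] by (simp add: W_def)
  define u where "u d q = W d q - (\<Sum>i\<in>F. (eta $ i $ i * ip W (e i) d q) *\<^sub>R e i d q)" for d q
  have u: "vector_field U u"
    unfolding u_def
  proof (intro vector_field_diff[OF U(1)] W vector_field_sum[OF U(1)] vector_field_scale[OF U(1)] e(1))
    show "smooth_in_chart d U (\<lambda>q. eta $ i $ i * ip W (e i) d q)" if "i \<in> F" "d \<in> \<A>" for i d
      by (intro smooth_in_chart_mult[OF chart[OF that(2)] U(1)] smooth_in_chart_const
          smooth_ip[OF W e(1)[OF that(1)] that(2) U(1)])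
    show "eta $ i $ i * ip W (e i) d q = eta $ i $ i * ip W (e i) e' q"
      if "i \<in> F" "d \<in> \<A>" "e' \<in> \<A>" "q \<in> U" "q \<in> chart_dom d" "q \<in> chart_dom e'" for i d e' q
      by (rule arg_cong[OF ip_change[OF W e(1)[OF that(1)] that(2-)]])
  qed
  have up: "u c p = w k"
  proof -
    have "ip W (e i) c p = 0" if "i \<in> F" for i
      using w[of k i] 2(2) that by (auto simp: Wp e)
    then show ?thesis by (simp add: u_def Wp)
  qed
  have orth: "ip u (e j) d q = 0" if "j \<in> F" "d \<in> \<A>" "q \<in> U" "q \<in> chart_dom d" for j d q
  proof -
    have "ip u (e j) d q = ip W (e j) d q - (\<Sum>i\<in>F. eta $ i $ i * ip W (e i) d q * ip (e i) (e j) d q)"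
      by (simp add: u_def inner_diff_left inner_sum_left)
    also have "(\<Sum>i\<in>F. eta $ i $ i * ip W (e i) d q * ip (e i) (e j) d q)
      = (\<Sum>i\<in>F. if i = j then eta $ j $ j * eta $ j $ j * ip W (e j) d q else 0)"
      by (intro sum.cong) (auto simp: on[OF _ that])
    also have "\<dots> = ip W (e j) d q" using that(1) by simp
    finally show ?thesis by simp
  qed
  define n where "n d q = eta $ k $ k * ip u u d q" for d q
  have n: "smooth_in_chart d U (n d)" if "d \<in> \<A>" for d
    unfolding n_def
    by (intro smooth_in_chart_mult[OF chart U(1)] that smooth_in_chart_const smooth_ip u U(1))
  have nn: "n d q = n e q" if "d \<in> \<A>" "e \<in> \<A>" "q \<in> U" "q \<in> chart_dom d" "q \<in> chart_dom e" for d e q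
    unfolding n_def using ip_change[OF u u that] by simp
  define U' where "U' = {q \<in> U \<inter> chart_dom c. n c q > 0}"
  have U': "open U'" "p \<in> U'" "U' \<subseteq> U" "U' \<subseteq> chart_dom c"
  proof -
    show "open U'" unfolding U'_def by (rule open_positive_in_chart[OF chart[OF c(1)] U(1) n[OF c(1)]])
    have "n c p = 1" by (simp add: n_def up w[of k k])
    then show "p \<in> U'" using U c by (auto simp: U'_def)
  qed (auto simp: U'_def)
  have npos: "n d q > 0" if "d \<in> \<A>" "q \<in> U'" "q \<in> chart_dom d" for d q
    using nn[OF that(1) c(1)] that U' by (auto simp: U'_def)
  define f where "f d q = (n d q powr (- 1 / 2)) *\<^sub>R u d q" for d q
  have f: "vector_field U' f"
    unfolding f_def
  proof (intro vector_field_scale[OF U'(1)] vector_field_subset[OF u U'(3)])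
    show "smooth_in_chart d U' (\<lambda>q. n d q powr (- 1 / 2))" if "d \<in> \<A>" for d
      by (intro smooth_in_chart_powr[OF chart U'(1)] smooth_in_chart_subset[OF n] that)
         (use npos that U' in auto)
    show "n d q powr (- 1 / 2) = n e q powr (- 1 / 2)"
      if "d \<in> \<A>" "e \<in> \<A>" "q \<in> U'" "q \<in> chart_dom d" "q \<in> chart_dom e" for d e q
      using nn[of d e q] that U' by auto
  qed
  have fp: "f c p = w k"
    using w[of k k] by (simp add: f_def n_def up)
  have ff: "ip f f d q = eta $ k $ k" if "d \<in> \<A>" "q \<in> U'" "q \<in> chart_dom d" for d q
  proof -
    have "ip f f d q = (n d q powr (- 1 / 2) * n d q powr (- 1 / 2)) * ip u u d q"
      by (simp add: f_def matrix_vector_mult_scaleR mult.assoc)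
    also have "n d q powr (- 1 / 2) * n d q powr (- 1 / 2) = 1 / n d q"
      using npos[OF that] by (simp add: powr_add[symmetric] powr_minus_divide)
    also have "ip u u d q = eta $ k $ k * n d q"
      unfolding n_def mult.assoc[symmetric] eta_sq by simp
    finally show ?thesis using npos[OF that] by simp
  qed
  have fe: "ip f (e j) d q = 0" "ip (e j) f d q = 0" if "j \<in> F" "d \<in> \<A>" "q \<in> U'" "q \<in> chart_dom d" for j d q
  proof -
    show "ip f (e j) d q = 0" using orth[OF that(1,2) _ that(4)] that(3) U'(3) by (auto simp: f_def)
    then show "ip (e j) f d q = 0"
      using symmetric_matrix_inner[OF metric_symmetric[OF that(2,4)]] by metis
  qed
  show ?case
  proof (intro exI[of _ U'] exI[of _ "e(k := f)"] conjI U')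
    show "\<forall>i\<in>insert k F. vector_field U' ((e(k := f)) i) \<and> (e(k := f)) i c p = w i"
      using f fp e vector_field_subset[OF _ U'(3)] 2(2) by auto
    show "\<forall>i\<in>insert k F. \<forall>j\<in>insert k F. \<forall>d\<in>\<A>. \<forall>q\<in>U' \<inter> chart_dom d.
        ip ((e(k := f)) i) ((e(k := f)) j) d q = eta $ i $ j"
    proof (intro ballI)
      fix i j d q assume ij: "i \<in> insert k F" "j \<in> insert k F" and d: "d \<in> \<A>" "q \<in> U' \<inter> chart_dom d"
      have q: "q \<in> U'" "q \<in> U" "q \<in> chart_dom d" using d U' by auto
      show "ip ((e(k := f)) i) ((e(k := f)) j) d q = eta $ i $ j"
        using ij 2(2) ff[OF d(1) q(1,3)] fe[OF _ d(1) q(1,3)] on[OF _ _ d(1) q(2,3)]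
        by (cases "i = k"; cases "j = k") auto
    qed
  qed
qed

lemma oriented_orthonormal_basis:
  assumes "neutral_signature G"
  shows "\<exists>E. det E > 0 \<and> transpose E ** G ** E = eta"
proof -
  obtain E where E: "invertible E" "transpose E ** G ** E = eta"
    using assms by (auto simp: neutral_signature_def)
  show ?thesis
  proof (cases "det E > 0")
    case False
    then have neg: "det E < 0" using E by (simp add: invertible_det_nz)
    define D :: "real ^ 4 ^ 4" where "D = (\<chi> i j. if i = j then (if i = 1 then - 1 else 1) else 0)"
    have "det D = (\<Prod>i\<in>UNIV. D $ i $ i)"
      by (rule det_diagonal) (simp add: D_def)
    also have "\<dots> = D $ 1 $ 1 * D $ 2 $ 2 * D $ 3 $ 3 * D $ 4 $ 4" by (rule prod_4)
    also have "\<dots> = - 1" by (simp add: D_def)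
    finally have "det (E ** D) > 0" using neg by (simp add: det_mul)
    moreover have "transpose D ** eta ** D = eta"
      by (simp add: D_def vec_eq_iff forall_4 matrix_matrix_mult_def sum_4 transpose_def)
    then have "transpose (E ** D) ** G ** (E ** D) = eta"
      unfolding E(2)[symmetric] by (simp only: matrix_transpose_mul matrix_mul_assoc)
    ultimately show ?thesis by blast
  qed (use E in blast)
qed

lemma local_orthonormal_frame:
  assumes c: "c \<in> \<A>" "p \<in> chart_dom c"
  obtains U E where "open U" "p \<in> U" "\<And>d. d \<in> \<A> \<Longrightarrow> smooth_in_chart d U (E d)"
    "\<And>d e q. d \<in> \<A> \<Longrightarrow> e \<in> \<A> \<Longrightarrow> q \<in> U \<Longrightarrow> q \<in> chart_dom d \<Longrightarrow> q \<in> chart_dom e \<Longrightarrow>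
      E e q = jacobian d e q ** E d q"
    "\<And>d q. d \<in> \<A> \<Longrightarrow> q \<in> U \<Longrightarrow> q \<in> chart_dom d \<Longrightarrow> transpose (E d q) ** g d q ** E d q = eta"
    "\<And>d q. d \<in> \<A> \<Longrightarrow> q \<in> U \<Longrightarrow> q \<in> chart_dom d \<Longrightarrow> det (E d q) > 0"
proof -
  obtain E0 where E0: "det E0 > 0" "transpose E0 ** g c p ** E0 = eta"
    using oriented_orthonormal_basis[OF metric_signature[OF c]] by blast
  have "(E0 *v axis i 1) \<bullet> (g c p *v (E0 *v axis j 1)) = eta $ i $ j" for i j
    unfolding bilinear_entry[symmetric] E0(2) ..
  from local_orthonormal_fields[where w = "\<lambda>i. E0 *v axis i 1" and F = UNIV, OF c this]
  obtain U e where U: "open U" "p \<in> U" "U \<subseteq> chart_dom c"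
    and e: "\<And>i. vector_field U (e i)" "\<And>i. e i c p = E0 *v axis i 1"
    and on: "\<And>i j d q. d \<in> \<A> \<Longrightarrow> q \<in> U \<Longrightarrow> q \<in> chart_dom d \<Longrightarrow> ip (e i) (e j) d q = eta $ i $ j"
    by blast
  define E where "E d q = (\<chi> r i. e i d q $ r)" for d q
  have E_axis: "E d q *v axis i 1 = e i d q" for d q i
    by (simp add: E_def matrix_vector_mult_basis column_def)
  have s: "smooth_in_chart d U (E d)" if "d \<in> \<A>" for d
    unfolding E_def using e(1) that
    by (intro smooth_in_chart_vec[OF chart U(1)] smooth_in_chart_nth[OF chart U(1)])
       (auto intro: vector_field_smooth)
  have ch: "E e' q = jacobian d e' q ** E d q"
    if "d \<in> \<A>" "e' \<in> \<A>" "q \<in> U" "q \<in> chart_dom d" "q \<in> chart_dom e'" for d e' q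
  proof -
    have "E e' q *v x = (jacobian d e' q ** E d q) *v x" for x
    proof -
      have "E e' q *v axis i 1 = (jacobian d e' q ** E d q) *v axis i 1" for i
        by (simp only: matrix_vector_mul_assoc[symmetric] E_axis vector_field_change[OF e(1) that])
      then have "E e' q *v (\<Sum>i\<in>UNIV. (x $ i) *\<^sub>R axis i 1) = (jacobian d e' q ** E d q) *v (\<Sum>i\<in>UNIV. (x $ i) *\<^sub>R axis i 1)"
        by (simp only: linear_sum[OF matrix_vector_mul_linear] matrix_vector_mult_scaleR)
      then show ?thesis by (simp only: axis_expansion)
    qed
    then show ?thesis unfolding matrix_eq by blast
  qed
  have ort: "transpose (E d q) ** g d q ** E d q = eta" if "d \<in> \<A>" "q \<in> U" "q \<in> chart_dom d" for d q
  proof -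
    have "(transpose (E d q) ** g d q ** E d q) $ i $ j = eta $ i $ j" for i j
      unfolding bilinear_entry E_axis by (rule on[OF that])
    then show ?thesis unfolding vec_eq_iff by blast
  qed
  have Ep: "E c p = E0"
    by (simp add: E_def e(2) vec_eq_iff matrix_vector_mult_basis column_def)
  define U' where "U' = {q \<in> U \<inter> chart_dom c. det (E c q) > 0}"
  have U': "open U'" "p \<in> U'" "U' \<subseteq> U"
    unfolding U'_def using open_positive_in_chart[OF chart[OF c(1)] U(1)
        smooth_in_chart_det[OF chart[OF c(1)] U(1) s[OF c(1)]]] U c E0 Ep by auto
  show ?thesis
  proof (rule that[of U' E])
    show "smooth_in_chart d U' (E d)" if "d \<in> \<A>" for d
      using smooth_in_chart_subset[OF s[OF that]] U' by auto
    show "det (E d q) > 0" if "d \<in> \<A>" "q \<in> U'" "q \<in> chart_dom d" for d q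
      using ch[OF c(1) that(1)] det_jacobian_pos[OF c(1) that(1)] that by (auto simp: U'_def det_mul)
    show "E e q = jacobian d e q ** E d q"
      if "d \<in> \<A>" "e \<in> \<A>" "q \<in> U'" "q \<in> chart_dom d" "q \<in> chart_dom e" for d e q
      by (rule ch[OF that(1,2) subsetD[OF U'(3) that(3)] that(4,5)])
    show "transpose (E d q) ** g d q ** E d q = eta" if "d \<in> \<A>" "q \<in> U'" "q \<in> chart_dom d" for d q
      by (rule ort[OF that(1) subsetD[OF U'(3) that(2)] that(3)])
  qed (use U' in auto)
qed

lemma pq_structure_eq: "pq_structure g c p = pq_space (g c p)"
  by (simp add: pq_structure_def pq_space_def)

text \<open>Conjugate the standard matrices by an oriented orthonormal frame. The result is compatible with
  changes of charts, as the frame is multiplied by the Jacobian.\<close>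

lemma admissible_local_basis_exists:
  assumes c: "c \<in> \<A>" "p \<in> chart_dom c"
  shows "\<exists>U J. admissible_local_basis \<A> (pq_structure g) U J \<and> p \<in> U"
proof -
  obtain U E where U: "open U" "p \<in> U"
    and s: "\<And>d. d \<in> \<A> \<Longrightarrow> smooth_in_chart d U (E d)"
    and ch: "\<And>d e q. d \<in> \<A> \<Longrightarrow> e \<in> \<A> \<Longrightarrow> q \<in> U \<Longrightarrow> q \<in> chart_dom d \<Longrightarrow> q \<in> chart_dom e \<Longrightarrow>
      E e q = jacobian d e q ** E d q"
    and on: "\<And>d q. d \<in> \<A> \<Longrightarrow> q \<in> U \<Longrightarrow> q \<in> chart_dom d \<Longrightarrow> transpose (E d q) ** g d q ** E d q = eta"
    and det: "\<And>d q. d \<in> \<A> \<Longrightarrow> q \<in> U \<Longrightarrow> q \<in> chart_dom d \<Longrightarrow> det (E d q) > 0"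
    using local_orthonormal_frame[OF c] by blast
  define K where "K a = (if a = (1::nat) then K1 else if a = 2 then K2 else K3)" for a
  define J where "J a d q = E d q ** K a ** matrix_inv (E d q)" for a d q
  have inv: "invertible (E d q)" if "d \<in> \<A>" "q \<in> U" "q \<in> chart_dom d" for d q
    using det[OF that] by (simp add: invertible_det_nz)
  have sp: "pq_structure g d q = span {J 1 d q, J 2 d q, J 3 d q}"
    and tr: "pq_triple (J 1 d q) (J 2 d q) (J 3 d q)" if "d \<in> \<A>" "q \<in> U" "q \<in> chart_dom d" for d q
    using pq_space_orthonormal_frame[OF det[OF that] metric_invertible[OF that(1,3)] on[OF that]]
    by (simp_all add: J_def K_def pq_structure_eq)
  have "local_section \<A> (pq_structure g) U (J a)" if a: "a \<in> {1, 2, 3}" for a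
    unfolding local_section_def smooth_endo_field_def
  proof (intro conjI ballI)
    fix d assume d: "d \<in> \<A>"
    note dU = chart[OF d] U(1)
    show "smooth_in_chart d U (J a d)"
      unfolding J_def
      by (intro smooth_in_chart_bilinear[OF dU bounded_bilinear_matrix_mult] smooth_in_chart_const
          smooth_in_chart_matrix_inv[OF dU] s d) (use inv d in auto)
    show "J a d q \<in> pq_structure g d q" if "q \<in> U \<inter> chart_dom d" for q
      using sp[OF d] that a by (auto intro: span_base)
    show "J a e q ** jacobian d e q = jacobian d e q ** J a d q"
      if e: "e \<in> \<A>" and q: "q \<in> U \<inter> chart_dom d \<inter> chart_dom e" for e q
    proof -
      have E: "E e q = jacobian d e q ** E d q" using ch d e q by blast
      have i: "matrix_inv (E e q) = matrix_inv (E d q) ** jacobian e d q"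
      proof (rule matrix_inv_unique)
        have iE: "E d q ** matrix_inv (E d q) = mat 1" "matrix_inv (E d q) ** E d q = mat 1"
          using invertible_matrix_inv[OF inv[OF d]] q by auto
        have jj: "jacobian d e q ** jacobian e d q = mat 1" "jacobian e d q ** jacobian d e q = mat 1"
          using jacobian_inverse d e q by auto
        have left: "E d q ** (matrix_inv (E d q) ** B) = B" "jacobian e d q ** (jacobian d e q ** B) = B" for B :: "real ^ 4 ^ 4"
          by (simp_all add: matrix_mul_assoc iE jj)
        show "E e q ** (matrix_inv (E d q) ** jacobian e d q) = mat 1"
          "matrix_inv (E d q) ** jacobian e d q ** E e q = mat 1"
          by (simp_all add: E matrix_mul_assoc[symmetric] left iE jj)
      qed
      have "jacobian e d q ** jacobian d e q = mat 1"
        using jacobian_inverse d e q by auto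
      then show ?thesis
        unfolding J_def i unfolding E by (simp add: matrix_mul_assoc[symmetric])
    qed
  qed
  then have "admissible_local_basis \<A> (pq_structure g) U J"
    unfolding admissible_local_basis_def using U(1) sp tr
    by (auto simp: pq_triple_def)
  then show ?thesis using U by blast
qed

end

section \<open>The Levi-Civita connection preserves the para-quaternionic structure\<close>

context pq_metric
begin

lemma trace_skew:
  assumes "transpose D ** G = - (G ** D)"
  shows "trace D = 0"
proof -
  obtain v where v: "v \<bullet> (G *v v) = 1" using exists_unit_vector by blast
  show ?thesis
    unfolding trace_orthonormal_frame[OF frame_orthonormal[OF v]] skew_inner_self[OF assms] by simp
qed

text \<open>The skew endomorphisms are the sum of the span of the \<open>J\<^sub>a\<close> and of its commutant in them, so those that
  anticommute with \<open>J\<^sub>1\<close> lie in the span of \<open>J\<^sub>2\<close> and \<open>J\<^sub>3\<close>. Concretely, \<open>D w\<close> is orthogonal to \<open>w\<close> and \<open>J\<^sub>1 w\<close>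
  for every \<open>w\<close>, and \<open>D\<close> is determined by its value at a single unit vector.\<close>

lemma anticommuting_skew:
  assumes D: "transpose D ** G = - (G ** D)" and anti: "D ** J1 = - (J1 ** D)"
  shows "\<exists>b c. D = b *\<^sub>R J2 + c *\<^sub>R J3"
proof -
  obtain v where v: "v \<bullet> (G *v v) = 1" using exists_unit_vector by blast
  have zero: "w = 0" if "v \<bullet> (G *v w) = 0" "(J1 *v v) \<bullet> (G *v w) = 0" "(J2 *v v) \<bullet> (G *v w) = 0"
    "(J3 *v v) \<bullet> (G *v w) = 0" for w
  proof -
    obtain a b c d where w: "w = a *\<^sub>R v + b *\<^sub>R (J3 *v v) + c *\<^sub>R (J1 *v v) + d *\<^sub>R (J2 *v v)"
      by (rule frame_expansion[OF v])
    have "a = 0" "b = 0" "c = 0" "d = 0"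
      using that unfolding w by (simp_all add: matrix_vector_right_distrib matrix_vector_mult_scaleR inner_add_right
        J_inner J_vec J_inner_self v matrix_vector_mult_neg)
    then show ?thesis by (simp add: w)
  qed
  have J1z: "(J1 *v w) \<bullet> (G *v (N *v w)) = 0"
    if "transpose N ** G = - (G ** N)" "N ** J1 = - (J1 ** N)" for N w
  proof -
    have "(J1 *v w) \<bullet> (G *v (N *v w)) = - (w \<bullet> (G *v (J1 *v (N *v w))))" by (rule J_inner(1))
    also have "J1 *v (N *v w) = - (N *v (J1 *v w))"
      by (simp add: matrix_vector_mul_assoc that matrix_vector_mult_neg)
    also have "- (w \<bullet> (G *v (- (N *v (J1 *v w))))) = w \<bullet> (G *v (N *v (J1 *v w)))"
      by (simp add: matrix_vector_mult_neg)
    also have "\<dots> = - ((J1 *v w) \<bullet> (G *v (N *v w)))"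
      by (rule skew_form_antisymmetric[OF that(1) G_sym])
    finally show ?thesis by simp
  qed
  obtain a b c d where Dv: "D *v v = a *\<^sub>R v + b *\<^sub>R (J3 *v v) + c *\<^sub>R (J1 *v v) + d *\<^sub>R (J2 *v v)"
    by (rule frame_expansion[OF v])
  have "a = 0" "c = 0"
    using skew_inner_self[OF D, of v] J1z[OF D anti, of v] unfolding Dv
    by (simp_all add: matrix_vector_right_distrib matrix_vector_mult_scaleR inner_add_right
        J_inner J_vec J_inner_self v matrix_vector_mult_neg)
  \<comment> \<open>subtract the element of the span with the same value at \<open>v\<close>\<close>
  define N where "N = D - d *\<^sub>R J2 - b *\<^sub>R J3"
  have N: "transpose N ** G = - (G ** N)" "N ** J1 = - (J1 ** N)"
    by (simp_all add: N_def transpose_linear transpose_scalar matrix_mult_distrib D J2_skew J3_skew anti J_mult)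
  have Nv: "N *v v = 0"
    by (simp add: N_def matrix_vector_mult_diff_rdistrib matrix_vector_mult_neg Dv \<open>a = 0\<close> \<open>c = 0\<close>)
  have NJ1: "N *v (J1 *v w) = - (J1 *v (N *v w))" for w
    by (simp add: matrix_vector_mul_assoc N matrix_vector_mult_neg)
  have N1: "N *v (J1 *v v) = 0" by (simp add: NJ1 Nv)
  have N2: "N *v (J2 *v v) = 0"
  proof (rule zero)
    show "v \<bullet> (G *v (N *v (J2 *v v))) = 0"
      using skew_form_antisymmetric[OF N(1) G_sym, of v "J2 *v v"] by (simp add: Nv)
    show "(J1 *v v) \<bullet> (G *v (N *v (J2 *v v))) = 0"
      using skew_form_antisymmetric[OF N(1) G_sym, of "J1 *v v" "J2 *v v"] by (simp add: N1)
    show "(J2 *v v) \<bullet> (G *v (N *v (J2 *v v))) = 0"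
      by (rule skew_inner_self[OF N(1)])
    show "(J3 *v v) \<bullet> (G *v (N *v (J2 *v v))) = 0"
      using J1z[OF N, of "J2 *v v"] by (simp add: J_vec)
  qed
  have N3: "N *v (J3 *v v) = 0" using NJ1[of "J2 *v v"] by (simp add: J_vec N2)
  have "N *v x = 0 *v x" for x
  proof -
    obtain a b c d where x: "x = a *\<^sub>R v + b *\<^sub>R (J3 *v v) + c *\<^sub>R (J1 *v v) + d *\<^sub>R (J2 *v v)"
      by (rule frame_expansion[OF v])
    show ?thesis
      by (simp add: x matrix_vector_right_distrib matrix_vector_mult_scaleR Nv N1 N2 N3)
  qed
  then have "N = 0" unfolding matrix_eq by blast
  then show ?thesis by (intro exI[of _ d] exI[of _ b]) (simp add: N_def algebra_simps)
qed

text \<open>The values at a point of the derivations of the relations between the \<open>J\<^sub>a\<close>.\<close>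

lemma derivation_in_span:
  assumes skew: "transpose D1 ** G = - (G ** D1)" "transpose D2 ** G = - (G ** D2)" "transpose D3 ** G = - (G ** D3)"
    and d11: "D1 ** J1 + J1 ** D1 = 0" and d22: "D2 ** J2 + J2 ** D2 = 0"
    and d12: "D3 = D1 ** J2 + J1 ** D2"
  shows "D1 \<in> span {J1, J2, J3}" "D2 \<in> span {J1, J2, J3}" "D3 \<in> span {J1, J2, J3}"
proof -
  interpret s: pq_metric J2 J1 "- J3" G by (rule swap)
  obtain b c where D1: "D1 = b *\<^sub>R J2 + c *\<^sub>R J3"
    using anticommuting_skew[OF skew(1)] d11 by (auto simp: eq_neg_iff_add_eq_0)
  obtain b' c' where D2: "D2 = b' *\<^sub>R J1 + c' *\<^sub>R (- J3)"
    using s.anticommuting_skew[OF skew(2)] d22 by (auto simp: eq_neg_iff_add_eq_0)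
  have "D3 = (b + b') *\<^sub>R mat 1 + c *\<^sub>R J1 - c' *\<^sub>R J2"
    by (simp add: d12 D1 D2 matrix_mult_distrib J_mult algebra_simps)
  moreover from this have "b + b' = 0"
    using trace_skew[OF skew(3)] by (simp add: trace_add trace_sub trace_linear trace_I trace_J)
  ultimately have D3: "D3 = c *\<^sub>R J1 + (- c') *\<^sub>R J2 + 0 *\<^sub>R J3" by simp
  show "D1 \<in> span {J1, J2, J3}" unfolding D1 by (intro span_add span_scale span_base) auto
  show "D2 \<in> span {J1, J2, J3}" unfolding D2 by (intro span_add span_scale span_neg span_base) auto
  show "D3 \<in> span {J1, J2, J3}" unfolding D3 by (intro span_add span_scale span_base) auto
qed

end

context neutral_manifold
begin

lemma admissible_basisD:
  assumes "admissible_local_basis \<A> (pq_structure g) U J"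
  shows "open U"
    "c \<in> \<A> \<Longrightarrow> a \<in> {1, 2, 3} \<Longrightarrow> smooth_in_chart c U (J a c)"
    "c \<in> \<A> \<Longrightarrow> q \<in> U \<Longrightarrow> q \<in> chart_dom c \<Longrightarrow> pq_structure g c q = span {J 1 c q, J 2 c q, J 3 c q}"
    "c \<in> \<A> \<Longrightarrow> q \<in> U \<Longrightarrow> q \<in> chart_dom c \<Longrightarrow> pq_metric (J 1 c q) (J 2 c q) (J 3 c q) (g c q)"
proof -
  show "open U" using assms by (simp add: admissible_local_basis_def)
  show "smooth_in_chart c U (J a c)" if "c \<in> \<A>" "a \<in> {1, 2, 3}"
    using assms that unfolding admissible_local_basis_def local_section_def smooth_endo_field_def by blast
  assume c: "c \<in> \<A>" "q \<in> U" "q \<in> chart_dom c"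
  then show sp: "pq_structure g c q = span {J 1 c q, J 2 c q, J 3 c q}"
    using assms unfolding admissible_local_basis_def by blast
  have skew: "transpose A ** g c q = - (g c q ** A)" if "A \<in> pq_structure g c q" for A
    using that by (simp add: pq_structure_def)
  have inP: "J 1 c q \<in> pq_structure g c q" "J 2 c q \<in> pq_structure g c q" "J 3 c q \<in> pq_structure g c q"
    unfolding sp by (auto intro: span_base)
  have "pq_triple (J 1 c q) (J 2 c q) (J 3 c q)"
    using assms c unfolding admissible_local_basis_def pq_triple_def by blast
  then show "pq_metric (J 1 c q) (J 2 c q) (J 3 c q) (g c q)"
    using inP[THEN skew] metric_symmetric[OF c(1,3)] metric_invertible[OF c(1,3)]
    by (simp add: pq_metric_def pq_metric_axioms_def)
qed

text \<open>Covariant differentiation of endomorphisms preserves skewness because the metric is parallel.\<close>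

lemma cov_deriv_skew:
  assumes c: "c \<in> \<A>" and U: "open U" "p \<in> U \<inter> chart_dom c" and J: "smooth_in_chart c U (J c)"
    and skew: "\<And>q. q \<in> U \<inter> chart_dom c \<Longrightarrow> transpose (J c q) ** g c q = - (g c q ** J c q)"
  defines "D \<equiv> \<lambda>X. cov_deriv_endo (levi_civita g) J c p X"
  shows "transpose (D X) ** g c p = - (g c p ** D X)"
proof -
  have p: "p \<in> chart_dom c" using U by blast
  let ?L = "levi_civita g c p X" and ?G = "g c p" and ?J = "J c p"
  note dJ = smooth_in_chart_differentiable[OF chart[OF c] U(1) J U(2)]
  note dg = metric_differentiable[OF c p]
  note pr = bounded_bilinear.chart_deriv[OF bounded_bilinear_matrix_mult chart[OF c] p]
  note tr = bounded_linear.chart_deriv[OF bounded_linear_transpose]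
  have "chart_deriv c X (\<lambda>q. transpose (J c q) ** g c q + g c q ** J c q) p = chart_deriv c X (\<lambda>q. 0) p"
    by (rule chart_deriv_cong(2)[OF chart[OF c] U]) (simp add: skew)
  then have "transpose ?J ** chart_deriv c X (g c) p + transpose (chart_deriv c X (J c) p) ** ?G
     + (?G ** chart_deriv c X (J c) p + chart_deriv c X (g c) p ** ?J) = 0"
    by (simp add: chart_deriv_add[OF pr(1)[OF tr(1)[OF dJ] dg] pr(1)[OF dg dJ]]
        pr(2)[OF tr(1)[OF dJ] dg] pr(2)[OF dg dJ] tr(2)[OF dJ])
  then have 1: "transpose (chart_deriv c X (J c) p) ** ?G + ?G ** chart_deriv c X (J c) p =
     - (transpose ?J ** (transpose ?L ** ?G + ?G ** ?L)) - (transpose ?L ** ?G + ?G ** ?L) ** ?J"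
    unfolding levi_civita_metric[OF c p] by (simp add: algebra_simps eq_neg_iff_add_eq_0)
  have 2: "A ** ?G ** ?J = - (A ** transpose ?J ** ?G)" for A :: "real ^ 4 ^ 4"
    unfolding matrix_mul_assoc[symmetric] skew[OF U(2)] by (simp add: matrix_mult_distrib)
  have 3: "transpose ?J ** ?G ** A = - (?G ** ?J ** A)" for A :: "real ^ 4 ^ 4"
    unfolding skew[OF U(2)] by (simp add: matrix_mult_distrib)
  have "transpose (D X) ** ?G + ?G ** D X = (transpose (chart_deriv c X (J c) p) ** ?G + ?G ** chart_deriv c X (J c) p)
    + transpose ?J ** transpose ?L ** ?G - transpose ?L ** transpose ?J ** ?G + ?G ** ?L ** ?J - ?G ** ?J ** ?L"
    by (simp add: D_def cov_deriv_endo_def transpose_linear matrix_transpose_mul matrix_mult_distrib matrix_mul_assoc)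
  also have "\<dots> = 0"
    unfolding 1 by (simp add: matrix_mult_distrib matrix_mul_assoc 2 3)
  finally show ?thesis by (simp add: eq_neg_iff_add_eq_0)
qed

lemma cov_deriv_mult:
  assumes c: "c \<in> \<A>" "p \<in> chart_dom c"
    and d: "differentiable_in_chart c (A c) p" "differentiable_in_chart c (B c) p"
  shows "cov_deriv_endo \<Gamma> (\<lambda>c q. A c q ** B c q) c p X =
    cov_deriv_endo \<Gamma> A c p X ** B c p + A c p ** cov_deriv_endo \<Gamma> B c p X"
  by (simp add: cov_deriv_endo_def bounded_bilinear.chart_deriv(2)[OF bounded_bilinear_matrix_mult chart[OF c(1)] c(2) d]
     matrix_mult_distrib matrix_mul_assoc algebra_simps)

lemma cov_deriv_admissible_basis:
  assumes J: "admissible_local_basis \<A> (pq_structure g) U J"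
    and c: "c \<in> \<A>" "p \<in> U" "p \<in> chart_dom c" and a: "a \<in> {1, 2, 3}"
  shows "cov_deriv_endo (levi_civita g) (J a) c p X \<in> pq_structure g c p"
proof -
  note U = admissible_basisD(1)[OF J] and sm = admissible_basisD(2)[OF J c(1)]
  have pU: "p \<in> U \<inter> chart_dom c" using c by auto
  note m = admissible_basisD(4)[OF J c(1)]
  interpret P: pq_metric "J 1 c p" "J 2 c p" "J 3 c p" "g c p" by (rule m[OF c(2,3)])
  have mq: "pq_triple (J 1 c q) (J 2 c q) (J 3 c q)" if "q \<in> U \<inter> chart_dom c" for q
    using m[of q] that by (auto simp: pq_metric_def)
  define D where "D a = cov_deriv_endo (levi_civita g) (J a) c p X" for a
  have d: "differentiable_in_chart c (J a c) p" if "a \<in> {1, 2, 3}" for a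
    by (rule smooth_in_chart_differentiable[OF chart[OF c(1)] U sm[OF that] pU])
  have skew: "transpose (D a) ** g c p = - (g c p ** D a)" if "a \<in> {1, 2, 3}" for a
    unfolding D_def
  proof (rule cov_deriv_skew[where J = "J a", OF c(1) U pU sm[OF that]])
    fix q assume "q \<in> U \<inter> chart_dom c"
    then interpret Q: pq_metric "J 1 c q" "J 2 c q" "J 3 c q" "g c q" using m by blast
    show "transpose (J a c q) ** g c q = - (g c q ** J a c q)"
      using that Q.J1_skew Q.J2_skew Q.J3_skew by auto
  qed
  have cong: "cov_deriv_endo (levi_civita g) A c p X = cov_deriv_endo (levi_civita g) B c p X"
    if "\<And>q. q \<in> U \<inter> chart_dom c \<Longrightarrow> A c q = B c q" for A B
    using chart_deriv_cong(2)[OF chart[OF c(1)] U pU that] that[OF pU] by (simp add: cov_deriv_endo_def)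
  have mult: "D a ** J b c p + J a c p ** D b = cov_deriv_endo (levi_civita g) (\<lambda>c q. J a c q ** J b c q) c p X"
    if "a \<in> {1, 2, 3}" "b \<in> {1, 2, 3}" for a b
    unfolding D_def
    by (rule cov_deriv_mult[where A = "J a" and B = "J b", OF c(1,3) d[OF that(1)] d[OF that(2)], symmetric])
  have "D 1 ** J 1 c p + J 1 c p ** D 1 = cov_deriv_endo (levi_civita g) (\<lambda>c q. J 1 c q ** J 1 c q) c p X"
    by (rule mult) auto
  also have "\<dots> = cov_deriv_endo (levi_civita g) (\<lambda>c q. mat 1) c p X"
    by (rule cong) (rule pq_triple.J11[OF mq])
  finally have d11: "D 1 ** J 1 c p + J 1 c p ** D 1 = 0" by (simp add: cov_deriv_endo_def)
  have "D 2 ** J 2 c p + J 2 c p ** D 2 = cov_deriv_endo (levi_civita g) (\<lambda>c q. J 2 c q ** J 2 c q) c p X"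
    by (rule mult) auto
  also have "\<dots> = cov_deriv_endo (levi_civita g) (\<lambda>c q. mat 1) c p X"
    by (rule cong) (rule pq_triple.J22[OF mq])
  finally have d22: "D 2 ** J 2 c p + J 2 c p ** D 2 = 0" by (simp add: cov_deriv_endo_def)
  have d12: "D 3 = D 1 ** J 2 c p + J 1 c p ** D 2"
  proof -
    have "D 3 = cov_deriv_endo (levi_civita g) (\<lambda>c q. J 1 c q ** J 2 c q) c p X"
      unfolding D_def by (rule cong) (rule pq_triple.J12[OF mq, symmetric])
    also have "\<dots> = D 1 ** J 2 c p + J 1 c p ** D 2" by (rule mult[symmetric]) auto
    finally show ?thesis .
  qed
  show ?thesis
    using P.derivation_in_span[OF skew[of 1] skew[of 2] skew[of 3] d11 d22 d12] a
    unfolding admissible_basisD(3)[OF J c] D_def by auto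
qed

text \<open>A section is a combination of an admissible basis with differentiable coefficients, namely traces,
  so that the product rule reduces the claim to the basis itself.\<close>

lemma levi_civita_pq_connection: "levi_civita g \<in> pq_connections \<A> (pq_structure g)"
  unfolding pq_connections_def mem_Collect_eq
proof (intro conjI allI impI ballI)
  show "linear_connection \<A> (levi_civita g)" by (rule linear_connection_levi_civita)
  fix U J c p X
  assume UJ: "open U \<and> local_section \<A> (pq_structure g) U J" and c: "c \<in> \<A>" and p: "p \<in> U \<inter> chart_dom c"
  obtain U0 B where B: "admissible_local_basis \<A> (pq_structure g) U0 B" and p0: "p \<in> U0"
    using admissible_local_basis_exists[of c p] c p by blast
  define V where "V = U \<inter> U0"
  note U0 = admissible_basisD(1)[OF B]
  have V: "open V" "p \<in> V \<inter> chart_dom c" using U0 UJ p p0 by (auto simp: V_def)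
  have pc: "p \<in> chart_dom c" using p by blast
  have inP: "J c q \<in> span {B 1 c q, B 2 c q, B 3 c q}" if "q \<in> V \<inter> chart_dom c" for q
    using UJ that c admissible_basisD(3)[OF B c, of q] unfolding local_section_def V_def by blast
  have m: "pq_metric (B 1 c q) (B 2 c q) (B 3 c q) (g c q)" if "q \<in> V \<inter> chart_dom c" for q
    using admissible_basisD(4)[OF B c, of q] that by (auto simp: V_def)
  interpret P: pq_metric "B 1 c p" "B 2 c p" "B 3 c p" "g c p" by (rule m[OF V(2)])
  define f where "f a q = trace (B a c q ** J c q) / 4" for a q
  have expand: "J c q = f 1 q *\<^sub>R B 1 c q + f 2 q *\<^sub>R B 2 c q - f 3 q *\<^sub>R B 3 c q" if "q \<in> V \<inter> chart_dom c" for q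
  proof -
    interpret Q: pq_metric "B 1 c q" "B 2 c q" "B 3 c q" "g c q" by (rule m[OF that])
    show ?thesis using Q.pq_part_span[OF inP[OF that]] unfolding Q.pq_part_def f_def by (rule sym)
  qed
  have dB: "differentiable_in_chart c (B a c) p" if "a \<in> {1, 2, 3}" for a
    by (rule smooth_in_chart_differentiable[OF chart[OF c] U0 admissible_basisD(2)[OF B c that]])
       (use p0 pc in auto)
  have dJ: "differentiable_in_chart c (J c) p"
    using UJ c p by (intro smooth_in_chart_differentiable[OF chart[OF c], of U])
      (auto simp only: local_section_def smooth_endo_field_def)
  have df: "differentiable_in_chart c (f a) p" if "a \<in> {1, 2, 3}" for a
    unfolding f_def divide_inverse
    by (intro bounded_linear.chart_deriv(1)[OF bounded_linear_mult_left]
        bounded_linear.chart_deriv(1)[OF bounded_linear_trace]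
        bounded_bilinear.chart_deriv(1)[OF bounded_bilinear_matrix_mult chart[OF c] pc] dB that dJ)
  define F where "F a = chart_deriv c X (f a) p" for a
  define D where "D a = cov_deriv_endo (levi_civita g) (B a) c p X" for a
  have sc: "differentiable_in_chart c (\<lambda>q. f a q *\<^sub>R B a c q) p"
    "chart_deriv c X (\<lambda>q. f a q *\<^sub>R B a c q) p = f a p *\<^sub>R chart_deriv c X (B a c) p + F a *\<^sub>R B a c p"
    if "a \<in> {1, 2, 3}" for a
    unfolding F_def
    by (rule bounded_bilinear.chart_deriv[OF bounded_bilinear_scaleR chart[OF c] pc df[OF that] dB[OF that]])+
  note mn = bounded_linear.chart_deriv[OF bounded_linear_minus[OF bounded_linear_ident]]
  have 1: "1 \<in> {1, 2, 3::nat}" and 2: "2 \<in> {1, 2, 3::nat}" and 3: "3 \<in> {1, 2, 3::nat}" by auto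
  have "chart_deriv c X (J c) p = chart_deriv c X (\<lambda>q. (f 1 q *\<^sub>R B 1 c q + f 2 q *\<^sub>R B 2 c q) + (- (f 3 q *\<^sub>R B 3 c q))) p"
    by (rule chart_deriv_cong(2)[OF chart[OF c] V]) (simp add: expand)
  also have "\<dots> = f 1 p *\<^sub>R chart_deriv c X (B 1 c) p + F 1 *\<^sub>R B 1 c p + (f 2 p *\<^sub>R chart_deriv c X (B 2 c) p + F 2 *\<^sub>R B 2 c p)
      + (- (f 3 p *\<^sub>R chart_deriv c X (B 3 c) p + F 3 *\<^sub>R B 3 c p))"
    unfolding chart_deriv_add(2)[OF chart_deriv_add(1)[OF sc(1)[OF 1] sc(1)[OF 2]] mn(1)[OF sc(1)[OF 3]]]
      chart_deriv_add(2)[OF sc(1)[OF 1] sc(1)[OF 2]] mn(2)[OF sc(1)[OF 3]] sc(2)[OF 1] sc(2)[OF 2] sc(2)[OF 3] ..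
  finally have "cov_deriv_endo (levi_civita g) J c p X =
    (F 1 *\<^sub>R B 1 c p + F 2 *\<^sub>R B 2 c p - F 3 *\<^sub>R B 3 c p) + (f 1 p *\<^sub>R D 1 + f 2 p *\<^sub>R D 2 - f 3 p *\<^sub>R D 3)"
    unfolding cov_deriv_endo_def D_def expand[OF V(2)] by (simp add: matrix_mult_distrib algebra_simps)
  moreover have "D a \<in> span {B 1 c p, B 2 c p, B 3 c p}" if "a \<in> {1, 2, 3}" for a
    using cov_deriv_admissible_basis[OF B c p0 pc that] unfolding D_def admissible_basisD(3)[OF B c p0 pc] .
  ultimately show "cov_deriv_endo (levi_civita g) J c p X \<in> pq_structure g c p"
    unfolding admissible_basisD(3)[OF B c p0 pc]
    by (auto intro!: span_add span_diff span_scale intro: span_base)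
qed

end

section \<open>The Ricci forms\<close>

lemma ricci_form_condition_pointwise:
  fixes J :: "nat \<Rightarrow> 'm matrix_field"
  assumes "pq_triple (J 1 c p) (J 2 c p) (J 3 c p)"
  shows "(\<forall>(a, b, d) \<in> {(1,2,3), (2,3,1), (3,1,2)}. \<forall>X Y.
          ricci_form \<Gamma> J a c p (J b c p *v X) (J b c p *v Y)
          + \<epsilon> b * ricci_form \<Gamma> J a c p X Y
          + \<epsilon> a * ricci_form \<Gamma> J d c p (J b c p *v X) Y
          + \<epsilon> a * ricci_form \<Gamma> J d c p X (J b c p *v Y) = 0) \<longleftrightarrow>
    pq_triple.ricci_identity (J 1 c p) (J 2 c p) (J 3 c p) (\<lambda>a X Y. trace (J a c p ** curvature \<Gamma> c p X Y))"
  (is "?L \<longleftrightarrow> ?R")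
proof -
  define t where "t a X Y = trace (J a c p ** curvature \<Gamma> c p X Y)" for a X Y
  have rf: "ricci_form \<Gamma> J 1 c p X Y = t 1 X Y / 2" "ricci_form \<Gamma> J 2 c p X Y = t 2 X Y / 2"
     "ricci_form \<Gamma> J 3 c p X Y = - t 3 X Y / 2" for X Y
    by (simp_all add: ricci_form_def sgn_idx_def t_def)
  have "?L \<longleftrightarrow> (\<forall>X Y. t 1 (J 2 c p *v X) (J 2 c p *v Y) / 2 + t 1 X Y / 2 + - t 3 (J 2 c p *v X) Y / 2 + - t 3 X (J 2 c p *v Y) / 2 = 0) \<and>
    (\<forall>X Y. t 2 (J 3 c p *v X) (J 3 c p *v Y) / 2 + - (t 2 X Y / 2) + t 1 (J 3 c p *v X) Y / 2 + t 1 X (J 3 c p *v Y) / 2 = 0) \<and>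
    (\<forall>X Y. - t 3 (J 1 c p *v X) (J 1 c p *v Y) / 2 + - t 3 X Y / 2 + - (t 2 (J 1 c p *v X) Y / 2) + - (t 2 X (J 1 c p *v Y) / 2) = 0)"
  proof -
    have e: "\<epsilon> 1 = 1" "\<epsilon> 2 = 1" "\<epsilon> 3 = - 1" by (simp_all add: sgn_idx_def)
    show ?thesis by (simp only: ball_simps prod.case rf e mult_1 mult_minus1 simp_thms)
  qed
  also have "\<dots> \<longleftrightarrow> (\<forall>X Y.
     t 1 (J 2 c p *v X) (J 2 c p *v Y) + t 1 X Y - (t 3 (J 2 c p *v X) Y + t 3 X (J 2 c p *v Y)) = 0 \<and>
     t 2 (J 3 c p *v X) (J 3 c p *v Y) - t 2 X Y + (t 1 (J 3 c p *v X) Y + t 1 X (J 3 c p *v Y)) = 0 \<and>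
     t 3 (J 1 c p *v X) (J 1 c p *v Y) + t 3 X Y + (t 2 (J 1 c p *v X) Y + t 2 X (J 1 c p *v Y)) = 0)"
  proof -
    have "(x / 2 + y / 2 + - z / 2 + - w / 2 = 0) = (x + y - (z + w) = 0)"
      "(x / 2 + - (y / 2) + z / 2 + w / 2 = 0) = (x - y + (z + w) = 0)"
      "(- x / 2 + - y / 2 + - (z / 2) + - (w / 2) = 0) = (x + y + (z + w) = 0)" for x y z w :: real
      by (simp_all add: field_simps) linarith+
    then show ?thesis by (auto simp only: all_conj_distrib)
  qed
  also have "\<dots> \<longleftrightarrow> ?R"
    unfolding pq_triple.ricci_identity_def[OF assms] t_def ..
  finally show ?thesis .
qed

context neutral_manifold
begin

lemma ricci_form_condition_iff:
  "ricci_form_condition \<A> (pq_structure g) \<Gamma> \<longleftrightarrow>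
    (\<forall>U J. admissible_local_basis \<A> (pq_structure g) U J \<longrightarrow> (\<forall>c\<in>\<A>. \<forall>p\<in>U \<inter> chart_dom c.
      pq_triple.ricci_identity (J 1 c p) (J 2 c p) (J 3 c p) (\<lambda>a X Y. trace (J a c p ** curvature \<Gamma> c p X Y))))"
  (is "?L \<longleftrightarrow> ?R")
proof -
  have t: "pq_triple (J 1 c p) (J 2 c p) (J 3 c p)"
    if "admissible_local_basis \<A> (pq_structure g) U J" "c \<in> \<A>" "p \<in> U \<inter> chart_dom c" for U J c p
    using admissible_basisD(4)[OF that(1,2), of p] that(3) by (auto simp: pq_metric_def)
  have "?L \<longleftrightarrow> (\<forall>U J. admissible_local_basis \<A> (pq_structure g) U J \<longrightarrow> (\<forall>c\<in>\<A>. \<forall>p\<in>U \<inter> chart_dom c.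
     \<forall>(a, b, d) \<in> {(1,2,3), (2,3,1), (3,1,2)}. \<forall>X Y.
          ricci_form \<Gamma> J a c p (J b c p *v X) (J b c p *v Y)
          + \<epsilon> b * ricci_form \<Gamma> J a c p X Y
          + \<epsilon> a * ricci_form \<Gamma> J d c p (J b c p *v X) Y
          + \<epsilon> a * ricci_form \<Gamma> J d c p X (J b c p *v Y) = 0))"
    unfolding ricci_form_condition_def by blast
  also have "\<dots> \<longleftrightarrow> ?R"
    by (intro all_cong1 imp_cong refl ball_cong) (rule ricci_form_condition_pointwise, rule t)
  finally show ?thesis .
qed

lemma algebraic_curvature_levi_civita:
  assumes c: "c \<in> \<A>" "p \<in> chart_dom c"
  shows "algebraic_curvature (g c p) (curvature (levi_civita g) c p)"
proof (rule algebraic_curvature.intro)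
  show "linear (\<lambda>X. curvature (levi_civita g) c p X Y)" for Y
    by (rule linear_curvature[OF linear_connection_levi_civita c])
  show "curvature (levi_civita g) c p X Y = - curvature (levi_civita g) c p Y X" for X Y
    by (rule curvature_skew)
qed (use c metric_symmetric metric_invertible levi_civita_curvature_skew_endo levi_civita_curvature_bianchi in auto)

lemma weyl_operator_eq:
  assumes c: "c \<in> \<A>" "p \<in> chart_dom c"
  shows "weyl_operator g c p \<omega> = (\<chi> i j. contract (raise (g c p) \<omega>)
    (algebraic_curvature.weyl_tensor (g c p) (curvature (levi_civita g) c p) (axis i 1) (axis j 1)) / 2)"
proof -
  interpret algebraic_curvature "g c p" "curvature (levi_civita g) c p"
    by (rule algebraic_curvature_levi_civita[OF c])
  have "weyl g c p = weyl_tensor"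
    by (intro ext) (simp add: weyl_def weyl_tensor_def Let_def ricci_def ricci_contraction_def
        scalar_curvature_def scalar_contraction_def)
  then show ?thesis by (simp add: weyl_operator_def contract_def)
qed

text \<open>The self-dual forms at a point are the forms \<open>g(A\<cdot>, \<cdot>)\<close> with \<open>A\<close> in the fibre of the structure, and
  every point has an admissible basis nearby; so the algebraic equivalence applies at each point.\<close>

theorem anti_self_dual_iff_ricci_forms:
  "anti_self_dual \<A> g \<longleftrightarrow> ricci_form_condition \<A> (pq_structure g) (levi_civita g)"
proof -
  have key: "pq_triple.ricci_identity (J 1 c p) (J 2 c p) (J 3 c p) (\<lambda>a X Y. trace (J a c p ** curvature (levi_civita g) c p X Y))
    \<longleftrightarrow> (\<forall>A\<in>pq_structure g c p. weyl_operator g c p (transpose A ** g c p) = 0)"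
    if J: "admissible_local_basis \<A> (pq_structure g) U J" and c: "c \<in> \<A>" "p \<in> U" "p \<in> chart_dom c" for U J c p
  proof -
    interpret P: pq_curvature "J 1 c p" "J 2 c p" "J 3 c p" "g c p" "curvature (levi_civita g) c p"
      unfolding pq_curvature_def
      using admissible_basisD(4)[OF J c] algebraic_curvature_levi_civita[OF c(1,3)] by blast
    have "P.ricci_identity (\<lambda>a X Y. trace (J a c p ** curvature (levi_civita g) c p X Y)) \<longleftrightarrow>
      P.ricci_identity (\<lambda>a X Y. trace (P.J a ** curvature (levi_civita g) c p X Y))"
      by (rule P.ricci_identity_cong) (unfold P.J_def, auto)
    also have "\<dots> \<longleftrightarrow> (\<forall>A\<in>pq_structure g c p. \<forall>X Y. trace (A ** curvature (levi_civita g) c p X Y) =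
        P.schouten Y (A *v X) - P.schouten X (A *v Y))"
      unfolding P.ricci_identity_iff_schouten admissible_basisD(3)[OF J c] ..
    also have "\<dots> \<longleftrightarrow> (\<forall>A\<in>pq_structure g c p. weyl_operator g c p (transpose A ** g c p) = 0)"
    proof (rule ball_cong[OF refl])
      fix A assume "A \<in> pq_structure g c p"
      then have "transpose A ** g c p = - (g c p ** A)" by (simp add: pq_structure_def)
      from P.weyl_operator_vanishes_iff[OF this]
      show "(\<forall>X Y. trace (A ** curvature (levi_civita g) c p X Y) = P.schouten Y (A *v X) - P.schouten X (A *v Y)) \<longleftrightarrow>
        weyl_operator g c p (transpose A ** g c p) = 0"
        unfolding weyl_operator_eq[OF c(1,3)] by blast
    qed
    finally show ?thesis .
  qed
  have forms: "\<exists>A\<in>pq_structure g c p. transpose A ** g c p = \<omega>"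
    if c: "c \<in> \<A>" "p \<in> chart_dom c" and \<omega>: "self_dual (g c p) \<omega>" for c p \<omega>
  proof -
    note inv = invertible_matrix_inv[OF metric_invertible[OF c]] transpose_invertible_inverse[OF metric_invertible[OF c]]
    have sk: "transpose \<omega> = - \<omega>" using \<omega> by (simp add: self_dual_def)
    define A where "A = - (matrix_inv (g c p) ** \<omega>)"
    have 1: "transpose A ** g c p = \<omega>"
      using inv(4) metric_symmetric[OF c]
      by (simp add: A_def transpose_linear matrix_transpose_mul sk matrix_mult_distrib matrix_mul_assoc[symmetric])
    have 2: "g c p ** A = - \<omega>"
      by (simp add: A_def matrix_mult_distrib matrix_mul_assoc inv)
    show ?thesis using 1 2 \<omega> by (intro bexI[of _ A]) (simp_all add: pq_structure_def)
  qed
  have self_dual_forms: "self_dual (g c p) (transpose A ** g c p)" if "A \<in> pq_structure g c p" for A c p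
    using that unfolding pq_structure_def by blast
  show ?thesis
  proof
    assume asd: "anti_self_dual \<A> g"
    show "ricci_form_condition \<A> (pq_structure g) (levi_civita g)"
      unfolding ricci_form_condition_iff
    proof (intro allI impI ballI)
      fix U J c p assume J: "admissible_local_basis \<A> (pq_structure g) U J" and c: "c \<in> \<A>" and p: "p \<in> U \<inter> chart_dom c"
      have pp: "p \<in> U" "p \<in> chart_dom c" using p by auto
      show "pq_triple.ricci_identity (J 1 c p) (J 2 c p) (J 3 c p) (\<lambda>a X Y. trace (J a c p ** curvature (levi_civita g) c p X Y))"
        unfolding key[OF J c pp] using asd c pp self_dual_forms unfolding anti_self_dual_def by blast
    qed
  next
    assume ric: "ricci_form_condition \<A> (pq_structure g) (levi_civita g)"
    show "anti_self_dual \<A> g"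
      unfolding anti_self_dual_def
    proof (intro ballI allI impI)
      fix c p \<omega> assume c: "c \<in> \<A>" "p \<in> chart_dom c" and \<omega>: "self_dual (g c p) \<omega>"
      obtain U J where J: "admissible_local_basis \<A> (pq_structure g) U J" and p: "p \<in> U"
        using admissible_local_basis_exists[OF c] by blast
      have "\<forall>A\<in>pq_structure g c p. weyl_operator g c p (transpose A ** g c p) = 0"
        using ric J c p unfolding ricci_form_condition_iff key[OF J c(1) p c(2), symmetric] by blast
      then show "weyl_operator g c p \<omega> = 0" using forms[OF c \<omega>] by blast
    qed
  qed
qed

section \<open>Change of the para-quaternionic connection\<close>

text \<open>The curvature of \<open>\<nabla>\<^sup>g + S\<close> is \<open>R\<^sup>g(X, Y) + (\<nabla>\<^sup>g\<^sub>X S)\<^sub>Y - (\<nabla>\<^sup>g\<^sub>Y S)\<^sub>X + [S\<^sub>X, S\<^sub>Y]\<close>. Under the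
  torsion condition \<open>tr (A S\<^sub>X) = \<alpha>(A X)\<close> for all sections \<open>A\<close> of \<open>P\<close>. Covariant differentiation of this
  equation, where \<open>\<nabla>\<^sup>g A\<close> is again in \<open>P\<close>, evaluates the traces of the derivative terms against \<open>J\<^sub>a\<close> as
  \<open>(\<nabla>\<^sup>g\<^sub>X \<alpha>)(J\<^sub>a Y)\<close>; both these and the commutator term solve the Ricci identity.\<close>

theorem ricci_identity_independent_of_connection:
  assumes \<Gamma>: "\<Gamma> \<in> pq_connections \<A> (pq_structure g)" and tor: "torsion02_vanishes \<A> (pq_structure g) \<Gamma>"
    and J: "admissible_local_basis \<A> (pq_structure g) U J" and c: "c \<in> \<A>" and pU: "p \<in> U" "p \<in> chart_dom c"
  shows "pq_triple.ricci_identity (J 1 c p) (J 2 c p) (J 3 c p) (\<lambda>a X Y. trace (J a c p ** curvature \<Gamma> c p X Y)) \<longleftrightarrow>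
    pq_triple.ricci_identity (J 1 c p) (J 2 c p) (J 3 c p) (\<lambda>a X Y. trace (J a c p ** curvature (levi_civita g) c p X Y))"
proof -
  let ?L = "levi_civita g"
  note U = admissible_basisD(1)[OF J] and sm = admissible_basisD(2)[OF J c]
  note cU = chart[OF c] U
  have p: "p \<in> U \<inter> chart_dom c" using pU by blast
  note L = levi_civita_pq_connection
  have lc: "linear_connection \<A> \<Gamma>" using \<Gamma> by (simp add: pq_connections_def)
  note lL = linear_connection_levi_civita
  have sec: "local_section \<A> (pq_structure g) U (J a)" if "a \<in> {1, 2, 3}" for a
    using J that unfolding admissible_local_basis_def by blast
  have cov: "cov_deriv_endo C (J a) c q X \<in> pq_structure g c q"
    if "C \<in> pq_connections \<A> (pq_structure g)" "a \<in> {1, 2, 3}" "q \<in> U \<inter> chart_dom c" for C a q X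
    using that sec[OF that(2)] U c unfolding pq_connections_def by blast
  define S where "S q X = \<Gamma> c q X - ?L c q X" for q X
  have smS: "smooth_in_chart c U (\<lambda>q. S q X)" for X
    unfolding S_def
    by (intro smooth_in_chart_diff[OF cU] smooth_in_chart_subset[OF linear_connection_smooth[OF lc c]]
        smooth_in_chart_subset[OF linear_connection_smooth[OF lL c]]) auto
  have linS: "linear (S q)" if "q \<in> U \<inter> chart_dom c" for q
    unfolding S_def using that
    by (intro linear_compose_sub linear_connection_linear[OF lc c] linear_connection_linear[OF lL c]) auto
  have metr: "pq_metric (J 1 c q) (J 2 c q) (J 3 c q) (g c q)" if "q \<in> U \<inter> chart_dom c" for q
    using admissible_basisD(4)[OF J c, of q] that by blast
  have spn: "pq_structure g c q = span {J 1 c q, J 2 c q, J 3 c q}" if "q \<in> U \<inter> chart_dom c" for q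
    using admissible_basisD(3)[OF J c, of q] that by blast
  have comm: "J a c q ** S q X - S q X ** J a c q \<in> span {J 1 c q, J 2 c q, J 3 c q}"
    if "a \<in> {1, 2, 3}" "q \<in> U \<inter> chart_dom c" for a q X
  proof -
    have "J a c q ** S q X - S q X ** J a c q = cov_deriv_endo ?L (J a) c q X - cov_deriv_endo \<Gamma> (J a) c q X"
      by (simp add: S_def cov_deriv_endo_def matrix_mult_distrib algebra_simps)
    then show ?thesis
      using span_diff[OF cov[OF L that, of X, unfolded spn[OF that(2)]] cov[OF \<Gamma> that, of X, unfolded spn[OF that(2)]]]
      by simp
  qed
  \<comment> \<open>the one-form \<open>Z \<mapsto> - tr (J\<^sub>3 S\<^bsub>J\<^sub>3 Z\<^esub>)\<close>, expanded so that it is visibly smooth\<close>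
  define \<alpha> where "\<alpha> q = (\<chi> i. - (\<Sum>j\<in>UNIV. J 3 c q $ j $ i * trace (J 3 c q ** S q (axis j 1))))" for q
  have \<alpha>: "trace (A ** S q X) = \<alpha> q \<bullet> (A *v X)"
    if q: "q \<in> U \<inter> chart_dom c" and A: "A \<in> pq_structure g c q" for q A X
  proof -
    interpret Q: pq_metric "J 1 c q" "J 2 c q" "J 3 c q" "g c q" by (rule metr[OF q])
    have QJ: "Q.J a = J a c q" if "a \<in> {1, 2, 3}" for a unfolding Q.J_def using that by auto
    have T: "part02 1 (J a c q) (\<lambda>X Y. S q X *v Y - S q Y *v X) X Y = 0"
      if a: "a \<in> {1, 2}" for a X Y
    proof -
      have "J a c q \<in> pq_structure g c q" using a unfolding spn[OF q] by (auto intro: span_base)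
      moreover have "J a c q ** J a c q = mat 1" using a Q.J11 Q.J22 by auto
      ultimately have "part02 1 (J a c q) (torsion \<Gamma> c q) X Y = 0"
        using tor c q unfolding torsion02_vanishes_def by blast
      moreover have "torsion \<Gamma> c q X Y = S q X *v Y - S q Y *v X" for X Y
        using levi_civita_torsion_free[OF c, of q X Y] q
        by (simp add: torsion_def S_def matrix_vector_mult_diff_rdistrib)
      ultimately show ?thesis by (simp add: part02_def)
    qed
    have 1: "trace (A ** S q X) = - trace (J 3 c q ** S q (J 3 c q *v (A *v X)))"
      by (rule Q.part02_vanishes_trace[OF linS[OF q]])
         (use comm[OF _ q] T A QJ in \<open>simp_all add: spn[OF q]\<close>)
    have lin: "linear (\<lambda>Z. - trace (J 3 c q ** S q (J 3 c q *v Z)))"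
      by (auto intro!: linearI simp: matrix_vector_right_distrib matrix_vector_mult_scaleR linear_add[OF linS[OF q]]
         linear_scale[OF linS[OF q]] matrix_mult_distrib trace_add trace_linear)
    have 2: "trace (J 3 c q ** S q (J 3 c q *v axis i 1)) = (\<Sum>j\<in>UNIV. J 3 c q $ j $ i * trace (J 3 c q ** S q (axis j 1)))" for i
    proof -
      have l: "linear (\<lambda>Z. trace (J 3 c q ** S q Z))"
        by (auto intro!: linearI simp: linear_add[OF linS[OF q]] linear_scale[OF linS[OF q]]
          matrix_mult_distrib trace_add trace_linear)
      have "J 3 c q *v axis i 1 = (\<Sum>j\<in>UNIV. ((J 3 c q *v axis i 1) $ j) *\<^sub>R axis j 1)"
        by (simp only: axis_expansion)
      also have "\<dots> = (\<Sum>j\<in>UNIV. (J 3 c q $ j $ i) *\<^sub>R axis j 1)"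
        by (simp add: matrix_vector_mult_basis column_def)
      finally show ?thesis by (simp add: linear_sum[OF l] linear_scale[OF l])
    qed
    show ?thesis
      unfolding 1 linear_as_inner[OF lin, of "A *v X"] \<alpha>_def 2 ..
  qed
  have sm\<alpha>: "smooth_in_chart c U \<alpha>"
  proof -
    have s3: "smooth_in_chart c U (J 3 c)" by (rule sm) simp
    have st: "smooth_in_chart c U (\<lambda>q. trace (J 3 c q ** S q (axis j 1)))" for j
      by (rule smooth_in_chart_linear[OF cU bounded_linear_trace
            smooth_in_chart_bilinear[OF cU bounded_bilinear_matrix_mult s3 smS]])
    have "smooth_in_chart c U (\<lambda>q. \<chi> i. (\<Sum>j\<in>UNIV. (- 1) * (J 3 c q $ j $ i * trace (J 3 c q ** S q (axis j 1)))))"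
      by (intro smooth_in_chart_vec[OF cU] smooth_in_chart_sum[OF cU] smooth_in_chart_mult[OF cU]
          smooth_in_chart_const smooth_in_chart_nth[OF cU] s3 st)
    then show ?thesis by (simp add: \<alpha>_def[abs_def] sum_negf)
  qed
  note diff = smooth_in_chart_differentiable[OF cU _ p]
  have dJ: "differentiable_in_chart c (J a c) p" if "a \<in> {1, 2, 3}" for a
    by (rule diff[OF sm[OF that]])
  note dS = diff[OF smS] and d\<alpha> = diff[OF sm\<alpha>]
  define DS where "DS X Y = chart_deriv c X (\<lambda>q. S q Y) p" for X Y
  define DJ where "DJ a X = chart_deriv c X (J a c) p" for a X
  define D\<alpha> where "D\<alpha> X = chart_deriv c X \<alpha> p" for X
  define LX where "LX X = ?L c p X" for X
  note mm = bounded_bilinear.chart_deriv[OF bounded_bilinear_matrix_mult cU(1) pU(2)]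
  note mv = bounded_bilinear.chart_deriv[OF bounded_bilinear_matrix_vector_mult cU(1) pU(2)]
  note ii = bounded_bilinear.chart_deriv[OF bounded_bilinear_inner cU(1) pU(2)]
  note tt = bounded_linear.chart_deriv[OF bounded_linear_trace]
  \<comment> \<open>both sides of the trace identity for \<open>A = J\<^sub>a\<close> are differentiable functions on \<open>U\<close>\<close>
  have deriv: "trace (J a c p ** DS X Y) + trace (DJ a X ** S p Y) =
      \<alpha> p \<bullet> (DJ a X *v Y) + D\<alpha> X \<bullet> (J a c p *v Y)" if a: "a \<in> {1, 2, 3}" for a X Y
  proof -
    have "chart_deriv c X (\<lambda>q. trace (J a c q ** S q Y)) p = chart_deriv c X (\<lambda>q. \<alpha> q \<bullet> (J a c q *v Y)) p"
    proof (rule chart_deriv_cong(2)[OF cU p])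
      fix q assume q: "q \<in> U \<inter> chart_dom c"
      have "J a c q \<in> pq_structure g c q" using a unfolding spn[OF q] by (auto intro: span_base)
      then show "trace (J a c q ** S q Y) = \<alpha> q \<bullet> (J a c q *v Y)" by (rule \<alpha>[OF q])
    qed
    then show ?thesis
      unfolding tt(2)[OF mm(1)[OF dJ[OF a] dS]] mm(2)[OF dJ[OF a] dS]
        ii(2)[OF d\<alpha> mv(1)[OF dJ[OF a] chart_deriv_const(1)]] mv(2)[OF dJ[OF a] chart_deriv_const(1)]
      by (simp add: trace_add DS_def DJ_def D\<alpha>_def)
  qed
  \<comment> \<open>the same identity for the element \<open>\<nabla>\<^sup>g\<^sub>X J\<^sub>a\<close> of the fibre\<close>
  have covL: "trace ((DJ a X + LX X ** J a c p - J a c p ** LX X) ** S p Y) =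
      \<alpha> p \<bullet> ((DJ a X + LX X ** J a c p - J a c p ** LX X) *v Y)" if a: "a \<in> {1, 2, 3}" for a X Y
    using \<alpha>[OF p cov[OF L a p, of X], of Y] unfolding cov_deriv_endo_def DJ_def LX_def .
  \<comment> \<open>the covariant derivative of \<open>\<alpha>\<close>\<close>
  define b where "b X Z = D\<alpha> X \<bullet> Z - \<alpha> p \<bullet> (LX X *v Z)" for X Z
  have curv: "curvature \<Gamma> c p X Y = curvature ?L c p X Y + DS X Y - DS Y X
    + (LX X ** S p Y - S p Y ** LX X) - (LX Y ** S p X - S p X ** LX Y) + (S p X ** S p Y - S p Y ** S p X)" for X Y
  proof -
    have \<Gamma>S: "\<Gamma> c q X = ?L c q X + S q X" for q X by (simp add: S_def)
    note dL = linear_connection_differentiable[OF lL c pU(2)]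
    show ?thesis
      unfolding curvature_def \<Gamma>S chart_deriv_add(2)[OF dL dS] DS_def LX_def
      by (simp add: matrix_mult_distrib algebra_simps)
  qed
  have tf: "LX X *v Y = LX Y *v X" for X Y
    unfolding LX_def by (rule levi_civita_torsion_free[OF c pU(2)])
  interpret P: pq_metric "J 1 c p" "J 2 c p" "J 3 c p" "g c p" by (rule metr[OF p])
  have PJ: "P.J a = J a c p" if "a \<in> {1, 2, 3}" for a unfolding P.J_def using that by auto
  have tr: "trace (J a c p ** curvature \<Gamma> c p X Y) = trace (J a c p ** curvature ?L c p X Y)
      + (b X (P.J a *v Y) - b Y (P.J a *v X)) + \<alpha> p \<bullet> ((P.J a ** S p X - S p X ** P.J a) *v Y)"
    if a: "a \<in> {1, 2, 3}" for a X Y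
  proof -
    let ?J = "J a c p"
    have cyc: "trace (?J ** (A ** B - B ** A)) = trace ((?J ** A - A ** ?J) ** B)" for A B :: "real ^ 4 ^ 4"
      using trace_mul_sym[of "?J ** B" A] by (simp add: matrix_mult_distrib trace_sub matrix_mul_assoc)
    have first: "trace (?J ** DS X Y) + trace (?J ** (LX X ** S p Y - S p Y ** LX X)) =
      D\<alpha> X \<bullet> (?J *v Y) - \<alpha> p \<bullet> (LX X *v (?J *v Y)) + \<alpha> p \<bullet> (?J *v (LX X *v Y))" for X Y
      using deriv[OF a, of X Y] covL[OF a, of X Y] unfolding cyc
      by (simp add: matrix_mult_distrib trace_add trace_sub matrix_vector_mult_add_rdistrib
         matrix_vector_mult_diff_rdistrib inner_add_right inner_diff_right matrix_vector_mul_assoc)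
    have SS: "trace (?J ** (S p X ** S p Y - S p Y ** S p X)) = \<alpha> p \<bullet> ((?J ** S p X - S p X ** ?J) *v Y)"
      unfolding cyc by (rule \<alpha>[OF p]) (use comm[OF a p] spn[OF p] in auto)
    have "trace (?J ** curvature \<Gamma> c p X Y) = trace (?J ** curvature ?L c p X Y)
      + (trace (?J ** DS X Y) + trace (?J ** (LX X ** S p Y - S p Y ** LX X)))
      - (trace (?J ** DS Y X) + trace (?J ** (LX Y ** S p X - S p X ** LX Y)))
      + trace (?J ** (S p X ** S p Y - S p Y ** S p X))"
      unfolding curv by (simp add: matrix_mult_distrib trace_add trace_sub)
    then show ?thesis unfolding first SS PJ[OF a] b_def using tf[of X Y] by simp
  qed
  have bil: "bilinear b"
    unfolding bilinear_def b_def D\<alpha>_def LX_def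
    by (auto intro!: linearI simp: linear_add[OF linear_chart_deriv[OF d\<alpha>]] linear_scale[OF linear_chart_deriv[OF d\<alpha>]]
       linear_add[OF linear_levi_civita[OF c pU(2)]] linear_scale[OF linear_levi_civita[OF c pU(2)]]
       inner_add_left inner_add_right matrix_vector_right_distrib matrix_vector_mult_scaleR
       matrix_vector_mult_add_rdistrib matrix_vector_mult_neg algebra_simps)
  have lin: "linear (\<lambda>Z. \<alpha> p \<bullet> Z)"
    by (auto intro!: linearI simp: inner_add_right)
  have inP: "J 1 c p \<in> pq_structure g c p" "J 2 c p \<in> pq_structure g c p" "J 3 c p \<in> pq_structure g c p"
    unfolding spn[OF p] by (auto intro: span_base)
  have pp: "P.pq_part (S p X) = (\<alpha> p \<bullet> (J 1 c p *v X) / 4) *\<^sub>R J 1 c p + (\<alpha> p \<bullet> (J 2 c p *v X) / 4) *\<^sub>R J 2 c p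
      - (\<alpha> p \<bullet> (J 3 c p *v X) / 4) *\<^sub>R J 3 c p" for X
    unfolding P.pq_part_def \<alpha>[OF p inP(1)] \<alpha>[OF p inP(2)] \<alpha>[OF p inP(3)] ..
  have quad: "P.ricci_identity (\<lambda>a X Y. \<alpha> p \<bullet> ((P.J a ** S p X - S p X ** P.J a) *v Y))"
  proof (rule P.ricci_identity_quadratic[OF lin])
    fix a :: nat and X assume a: "a \<in> {1, 2, 3}"
    have "P.J a ** S p X - S p X ** P.J a = P.J a ** P.pq_part (S p X) - P.pq_part (S p X) ** P.J a"
      by (rule P.commutator_pq_part[OF _ a]) (use comm[OF a p, of X] PJ[OF a] in simp)
    then show "P.J a ** S p X - S p X ** P.J a =
      (\<alpha> p \<bullet> (J 1 c p *v X) / 4) *\<^sub>R (P.J a ** J 1 c p - J 1 c p ** P.J a)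
      + (\<alpha> p \<bullet> (J 2 c p *v X) / 4) *\<^sub>R (P.J a ** J 2 c p - J 2 c p ** P.J a)
      - (\<alpha> p \<bullet> (J 3 c p *v X) / 4) *\<^sub>R (P.J a ** J 3 c p - J 3 c p ** P.J a)"
      unfolding pp by (simp add: matrix_mult_distrib algebra_simps)
  qed
  have "P.ricci_identity (\<lambda>a X Y. trace (J a c p ** curvature \<Gamma> c p X Y)) \<longleftrightarrow>
    P.ricci_identity (\<lambda>a X Y. trace (J a c p ** curvature ?L c p X Y)
      + (b X (P.J a *v Y) - b Y (P.J a *v X)) + \<alpha> p \<bullet> ((P.J a ** S p X - S p X ** P.J a) *v Y))"
    by (rule P.ricci_identity_cong) (rule tr)
  also have "\<dots> \<longleftrightarrow> P.ricci_identity (\<lambda>a X Y. trace (J a c p ** curvature ?L c p X Y)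
      + (b X (P.J a *v Y) - b Y (P.J a *v X)))"
    by (rule P.ricci_identity_add_iff[OF quad])
  also have "\<dots> \<longleftrightarrow> P.ricci_identity (\<lambda>a X Y. trace (J a c p ** curvature ?L c p X Y))"
    by (rule P.ricci_identity_add_iff[OF P.ricci_identity_bilinear[OF bil]])
  finally show ?thesis .
qed

lemma torsion02_vanishes_levi_civita: "torsion02_vanishes \<A> (pq_structure g) (levi_civita g)"
proof -
  have "torsion (levi_civita g) c p X Y = 0" if "c \<in> \<A>" "p \<in> chart_dom c" for c p X Y
    using levi_civita_torsion_free[OF that, of X Y] by (simp add: torsion_def)
  then show ?thesis by (simp add: torsion02_vanishes_def part02_def)
qed

theorem ricci_forms_iff_all_connections:
  "ricci_form_condition \<A> (pq_structure g) (levi_civita g) \<longleftrightarrow>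
    (\<forall>\<Gamma>\<in>pq_connections \<A> (pq_structure g). torsion02_vanishes \<A> (pq_structure g) \<Gamma> \<longrightarrow>
       ricci_form_condition \<A> (pq_structure g) \<Gamma>)"
  using ricci_identity_independent_of_connection levi_civita_pq_connection torsion02_vanishes_levi_civita
  unfolding ricci_form_condition_iff by (metis IntE)

end

theorem theorem3p7:
  fixes \<A> :: "'m::{t2_space, second_countable_topology} chart set"
    and g :: "'m matrix_field"
  assumes "oriented_smooth_atlas \<A>"
    and "neutral_metric \<A> g"
  shows "(anti_self_dual \<A> g \<longleftrightarrow>
            ricci_form_condition \<A> (pq_structure g) (levi_civita g)) \<and>
         (ricci_form_condition \<A> (pq_structure g) (levi_civita g) \<longleftrightarrow>
            (\<forall>\<Gamma>\<in>pq_connections \<A> (pq_structure g).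
               torsion02_vanishes \<A> (pq_structure g) \<Gamma> \<longrightarrow>
               ricci_form_condition \<A> (pq_structure g) \<Gamma>))"
proof -
  interpret neutral_manifold \<A> g
    using assms by (simp add: neutral_manifold_def neutral_manifold_axioms_def oriented_manifold_def)
  show ?thesis
    using anti_self_dual_iff_ricci_forms ricci_forms_iff_all_connections by blast
qed

end
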